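(* Let $\mathfrak t$ be a Lie algebroid over a smooth manifold $M$, let $\mathfrak g\subset J^1\mathfrak t$ be an infinitesimal geometric structure on $\mathfrak t$, and assume that the projection $a\colon\mathfrak g\to\mathfrak t$ has constant rank. Then $\mathfrak g$ has a unique generator $\nabla$ if and only if $\mathfrak g$ is surjective and has structure kernel $\mathfrak h=0$. In that case $\nabla$ is a Cartan connection on $\mathfrak t$ whose parallel sections are precisely the symmetries of $\mathfrak g$.
   Context: Everything is $C^\infty$. A Lie algebroid over $M$ is a vector bundle $\mathfrak t$ over $M$ with a Lie bracket on its sections and a vector bundle morphism $\#\colon\mathfrak t\to TM$ (the anchor) inducing a Lie algebra homomorphism on sections, with $[X,fY]=f[X,Y]+df(\#X)Y$. A subalgebroid is a subbundle (of constant rank) whose sections are closed under the bracket. $J^1\mathfrak t$ is the bundle of 1-jets of sections of $\mathfrak t$; for a section $W$ of $\mathfrak t$, $J^1W$ denotes its prolongation, a section of $J^1\mathfrak t$. $J^1\mathfrak t$ is a Lie algebroid with anchor $J^1\mathfrak t\to\mathfrak t\xrightarrow{\#}TM$ and the unique bracket satisfying $[J^1X,J^1Y]=J^1[X,Y]$. There is an exact sequence $0\to T^*M\otimes\mathfrak t\to J^1\mathfrak t\to\mathfrak t\to0$, where the inclusion sends, on sections, $df\otimes X$ to $fJ^1X-J^1(fX)$. Linear connections $\nabla$ on $\mathfrak t$ correspond one-to-one to splittings $s_\nabla\colon\mathfrak t\to J^1\mathfrak t$ of this sequence, via $s_\nabla X=J^1X+\nabla X$, where $\nabla X\in\Gamma(T^*M\otimes\mathfrak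 t)$ is $V\mapsto\nabla_VX$. An infinitesimal geometric structure on $\mathfrak t$ is a subalgebroid $\mathfrak g\subset J^1\mathfrak t$. Let $a\colon\mathfrak g\to\mathfrak t$ be the restriction of the projection $J^1\mathfrak t\to\mathfrak t$. The image of $\mathfrak g$ is $\mathfrak t_1:=a(\mathfrak g)$; the structure kernel is $\mathfrak h:=\ker a\subset T^*M\otimes\mathfrak t$; $\mathfrak g$ is surjective if $a$ is surjective. A symmetry of $\mathfrak g$ is a section $W$ of $\mathfrak t$ such that $J^1W$ is a section of $\mathfrak g$. A generator of $\mathfrak g$ is a linear connection $\nabla$ on $\mathfrak t$ such that $s_\nabla(\mathfrak t_1)\subset\mathfrak g$. A linear connection $\nabla$ on $\mathfrak t$ is a Cartan connection if $s_\nabla\colon\mathfrak t\to J^1\mathfrak t$ is a morphism of Lie algebroids.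
   Formalization: M is assumed nonempty of dimension at least 1; over a point, any proper subalgebra of t = J¹t has the zero connection as unique generator without being surjective, so the claim fails in dimension 0. *)

theory Defs
  imports "HOL-Analysis.Analysis" "HOL-Library.Function_Algebras"
begin

section \<open>Functions as a real vector space\<close>

instantiation "fun" :: (type, real_vector) real_vector
begin

definition scaleR_fun :: "real \<Rightarrow> ('a \<Rightarrow> 'b) \<Rightarrow> 'a \<Rightarrow> 'b" where
  "scaleR_fun c f = (\<lambda>x. c *\<^sub>R f x)"

instance
  by standard (simp_all add: scaleR_fun_def fun_eq_iff scaleR_add_right scaleR_add_left)

end

lemma scaleR_fun_apply [simp]: "(c *\<^sub>R f) x = c *\<^sub>R f x"
  by (simp add: scaleR_fun_def)


section \<open>Smooth manifolds\<close>

text \<open>\<open>S\<close> is meant to be open.\<close>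

primrec C_upto :: "nat \<Rightarrow> 'a::real_normed_vector set \<Rightarrow> ('a \<Rightarrow> 'b::real_normed_vector) \<Rightarrow> bool" where
  "C_upto 0 S f \<longleftrightarrow> continuous_on S f"
| "C_upto (Suc n) S f \<longleftrightarrow>
     (\<forall>x\<in>S. f differentiable (at x)) \<and> (\<forall>v. C_upto n S (\<lambda>x. frechet_derivative f (at x) v))"

definition smooth_on :: "'a::real_normed_vector set \<Rightarrow> ('a \<Rightarrow> 'b::real_normed_vector) \<Rightarrow> bool" where
  "smooth_on S f \<longleftrightarrow> (\<forall>n. C_upto n S f)"

text \<open>A manifold is a (Hausdorff, second countable) topological space \<open>'m\<close> together with a smooth
  atlas with values in \<open>'e\<close>.  Its dimension \<open>DIM('e)\<close> is positive.
  A chart is recorded with its domain; its values outside the domain are irrelevant.\<close>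

type_synonym ('m, 'e) atlas = "('m set \<times> ('m \<Rightarrow> 'e)) set"

definition smooth_manifold ::
  "('m::{t2_space, second_countable_topology}, 'e::euclidean_space) atlas \<Rightarrow> bool" where
  "smooth_manifold A \<longleftrightarrow>
     (\<Union>(U, \<phi>)\<in>A. U) = UNIV \<and>
     (\<forall>(U, \<phi>)\<in>A. open U \<and> open (\<phi> ` U) \<and> homeomorphism U (\<phi> ` U) \<phi> (inv_into U \<phi>)) \<and>
     (\<forall>(U, \<phi>)\<in>A. \<forall>(V, \<psi>)\<in>A. smooth_on (\<phi> ` (U \<inter> V)) (\<psi> \<circ> inv_into U \<phi>))"

definition smooth_fun :: "('m, 'e::euclidean_space) atlas \<Rightarrow> 'm set \<Rightarrow> ('m \<Rightarrow> real) \<Rightarrow> bool" where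
  "smooth_fun A W f \<longleftrightarrow> (\<forall>(U, \<phi>)\<in>A. smooth_on (\<phi> ` (U \<inter> W)) (f \<circ> inv_into U \<phi>))"

abbreviation C_inf :: "('m, 'e::euclidean_space) atlas \<Rightarrow> ('m \<Rightarrow> real) set" where
  "C_inf A \<equiv> {f. smooth_fun A UNIV f}"


section \<open>Vector bundles\<close>

text \<open>The fibres of a vector bundle are linear subspaces of one ambient real vector space \<open>'v\<close>.
  As \<open>'v\<close> carries no further structure and may be infinite-dimensional, this is no restriction:
  the fibres of any vector bundle embed into the direct sum of all of them.
  The smooth structure is recorded by the set of global smooth sections.\<close>

record ('m, 'v) vbundle =
  fibre :: "'m \<Rightarrow> 'v set"
  sections :: "('m \<Rightarrow> 'v) set"

definition smooth_combination ::
  "('m, 'e::euclidean_space) atlas \<Rightarrow> 'm set \<Rightarrow> nat \<Rightarrow> (nat \<Rightarrow> 'm \<Rightarrow> 'v::real_vector) \<Rightarrow>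
   ('m \<Rightarrow> 'v) \<Rightarrow> bool" where
  "smooth_combination A W k e s \<longleftrightarrow>
     (\<exists>c. (\<forall>i<k. smooth_fun A W (c i)) \<and> (\<forall>q\<in>W. s q = (\<Sum>i<k. c i q *\<^sub>R e i q)))"

definition pointwise_basis ::
  "('m \<Rightarrow> 'v::real_vector set) \<Rightarrow> 'm set \<Rightarrow> nat \<Rightarrow> (nat \<Rightarrow> 'm \<Rightarrow> 'v) \<Rightarrow> bool" where
  "pointwise_basis E W k e \<longleftrightarrow>
     (\<forall>q\<in>W. inj_on (\<lambda>i. e i q) {..<k} \<and> independent ((\<lambda>i. e i q) ` {..<k}) \<and>
            span ((\<lambda>i. e i q) ` {..<k}) = E q)"

text \<open>A local trivialisation over \<open>W\<close> is a frame \<open>(W, e)\<close>.  A bundle atlas is a set of frames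
  covering the base, with smooth transition functions; the smooth sections are those with smooth
  coefficients in every frame of the atlas.\<close>

definition bundle_atlas ::
  "('m::topological_space, 'e::euclidean_space) atlas \<Rightarrow> nat \<Rightarrow> ('m \<Rightarrow> 'v::real_vector set) \<Rightarrow>
   ('m set \<times> (nat \<Rightarrow> 'm \<Rightarrow> 'v)) set \<Rightarrow> bool" where
  "bundle_atlas A k E F \<longleftrightarrow>
     (\<Union>(W, e)\<in>F. W) = UNIV \<and>
     (\<forall>(W, e)\<in>F. open W \<and> pointwise_basis E W k e) \<and>
     (\<forall>(W, e)\<in>F. \<forall>(W', e')\<in>F. \<forall>j<k. smooth_combination A (W \<inter> W') k e (e' j))"

definition vector_bundle ::
  "('m::topological_space, 'e::euclidean_space) atlas \<Rightarrow> ('m, 'v::real_vector, 'z) vbundle_scheme \<Rightarrow>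
   bool" where
  "vector_bundle A B \<longleftrightarrow>
     (\<exists>k F. bundle_atlas A k (fibre B) F \<and>
        sections B = {s. (\<forall>p. s p \<in> fibre B p) \<and> (\<forall>(W, e)\<in>F. smooth_combination A W k e s)})"

text \<open>A subbundle (of constant rank) is a family of subspaces which is a vector bundle in the induced
  smooth structure, i.e.\ whose smooth sections are the smooth sections of \<open>B\<close> with values in it.\<close>

definition subbundle_sections :: "('m, 'v, 'z) vbundle_scheme \<Rightarrow> ('m \<Rightarrow> 'v set) \<Rightarrow> ('m \<Rightarrow> 'v) set" where
  "subbundle_sections B S = {s \<in> sections B. \<forall>p. s p \<in> S p}"

definition subbundle ::
  "('m::topological_space, 'e::euclidean_space) atlas \<Rightarrow> ('m, 'v::real_vector, 'z) vbundle_scheme \<Rightarrow>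
   ('m \<Rightarrow> 'v set) \<Rightarrow> bool" where
  "subbundle A B S \<longleftrightarrow>
     (\<forall>p. S p \<subseteq> fibre B p) \<and>
     vector_bundle A \<lparr>fibre = S, sections = subbundle_sections B S\<rparr>"

definition linear_between ::
  "'v::real_vector set \<Rightarrow> 'w::real_vector set \<Rightarrow> ('v \<Rightarrow> 'w) \<Rightarrow> bool" where
  "linear_between E F T \<longleftrightarrow>
     (\<forall>x\<in>E. T x \<in> F) \<and> (\<forall>x\<in>E. \<forall>y\<in>E. T (x + y) = T x + T y) \<and>
     (\<forall>c. \<forall>x\<in>E. T (c *\<^sub>R x) = c *\<^sub>R T x)"

text \<open>Vector bundle morphisms over the identity; values outside the fibres are irrelevant.
  A fibrewise linear map is smooth iff it maps smooth sections to smooth sections.\<close>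

definition bundle_morphism ::
  "('m, 'v::real_vector, 'y) vbundle_scheme \<Rightarrow> ('m, 'w::real_vector, 'z) vbundle_scheme \<Rightarrow>
   ('m \<Rightarrow> 'v \<Rightarrow> 'w) \<Rightarrow> bool" where
  "bundle_morphism B C \<Phi> \<longleftrightarrow>
     (\<forall>p. linear_between (fibre B p) (fibre C p) (\<Phi> p)) \<and>
     (\<forall>s\<in>sections B. (\<lambda>p. \<Phi> p (s p)) \<in> sections C)"


section \<open>The tangent bundle\<close>

text \<open>Tangent vectors are derivations of \<open>C\<^sup>\<infinity>(M)\<close> at a point.  They are made to vanish on
  non-smooth functions, so that equal derivations are equal as HOL functions.\<close>

type_synonym 'm tangent = "('m \<Rightarrow> real) \<Rightarrow> real"

definition tangent_space :: "('m, 'e::euclidean_space) atlas \<Rightarrow> 'm \<Rightarrow> 'm tangent set" where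
  "tangent_space A p = {v.
     (\<forall>f\<in>C_inf A. \<forall>g\<in>C_inf A. v (\<lambda>q. f q + g q) = v f + v g) \<and>
     (\<forall>c. \<forall>f\<in>C_inf A. v (\<lambda>q. c * f q) = c * v f) \<and>
     (\<forall>f\<in>C_inf A. \<forall>g\<in>C_inf A. v (\<lambda>q. f q * g q) = v f * g p + f p * v g) \<and>
     (\<forall>f. f \<notin> C_inf A \<longrightarrow> v f = 0)}"

definition tangent_bundle :: "('m, 'e::euclidean_space) atlas \<Rightarrow> ('m, 'm tangent) vbundle" where
  "tangent_bundle A = \<lparr>fibre = tangent_space A,
     sections = {V. (\<forall>p. V p \<in> tangent_space A p) \<and> (\<forall>f\<in>C_inf A. (\<lambda>p. V p f) \<in> C_inf A)}\<rparr>"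


section \<open>Lie algebroids\<close>

record ('m, 'v) algebroid = "('m, 'v) vbundle" +
  anchor :: "'m \<Rightarrow> 'v \<Rightarrow> 'm tangent"
  bracket :: "('m \<Rightarrow> 'v) \<Rightarrow> ('m \<Rightarrow> 'v) \<Rightarrow> 'm \<Rightarrow> 'v"

definition lie_bracket_on ::
  "('m \<Rightarrow> 'v::real_vector) set \<Rightarrow> (('m \<Rightarrow> 'v) \<Rightarrow> ('m \<Rightarrow> 'v) \<Rightarrow> 'm \<Rightarrow> 'v) \<Rightarrow> bool" where
  "lie_bracket_on \<Gamma> br \<longleftrightarrow>
     (\<forall>X\<in>\<Gamma>. \<forall>Y\<in>\<Gamma>. br X Y \<in> \<Gamma>) \<and>
     (\<forall>X\<in>\<Gamma>. \<forall>Y\<in>\<Gamma>. \<forall>Z\<in>\<Gamma>. br X (Y + Z) = br X Y + br X Z) \<and>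
     (\<forall>c. \<forall>X\<in>\<Gamma>. \<forall>Y\<in>\<Gamma>. br X (c *\<^sub>R Y) = c *\<^sub>R br X Y) \<and>
     (\<forall>X\<in>\<Gamma>. \<forall>Y\<in>\<Gamma>. br X Y = - br Y X) \<and>
     (\<forall>X\<in>\<Gamma>. \<forall>Y\<in>\<Gamma>. \<forall>Z\<in>\<Gamma>. br X (br Y Z) + br Y (br Z X) + br Z (br X Y) = 0)"

definition lie_algebroid ::
  "('m::topological_space, 'e::euclidean_space) atlas \<Rightarrow> ('m, 'v::real_vector) algebroid \<Rightarrow> bool" where
  "lie_algebroid A L \<longleftrightarrow>
     vector_bundle A L \<and>
     lie_bracket_on (sections L) (bracket L) \<and>
     bundle_morphism L (tangent_bundle A) (anchor L) \<and>
     (\<forall>X\<in>sections L. \<forall>Y\<in>sections L. \<forall>f\<in>C_inf A. \<forall>p.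
        anchor L p (bracket L X Y p) f =
          anchor L p (X p) (\<lambda>q. anchor L q (Y q) f) - anchor L p (Y p) (\<lambda>q. anchor L q (X q) f)) \<and>
     (\<forall>X\<in>sections L. \<forall>Y\<in>sections L. \<forall>f\<in>C_inf A. \<forall>p.
        bracket L X (\<lambda>q. f q *\<^sub>R Y q) p = f p *\<^sub>R bracket L X Y p + anchor L p (X p) f *\<^sub>R Y p)"

definition subalgebroid ::
  "('m::topological_space, 'e::euclidean_space) atlas \<Rightarrow> ('m, 'v::real_vector) algebroid \<Rightarrow>
   ('m \<Rightarrow> 'v set) \<Rightarrow> bool" where
  "subalgebroid A L S \<longleftrightarrow>
     subbundle A L S \<and>
     (\<forall>X\<in>subbundle_sections L S. \<forall>Y\<in>subbundle_sections L S. bracket L X Y \<in> subbundle_sections L S)"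

text \<open>Morphisms of Lie algebroids over the identity of the base.\<close>

definition algebroid_morphism ::
  "('m, 'v::real_vector) algebroid \<Rightarrow> ('m, 'w::real_vector) algebroid \<Rightarrow> ('m \<Rightarrow> 'v \<Rightarrow> 'w) \<Rightarrow> bool" where
  "algebroid_morphism L K \<Phi> \<longleftrightarrow>
     bundle_morphism L K \<Phi> \<and>
     (\<forall>p. \<forall>x\<in>fibre L p. anchor K p (\<Phi> p x) = anchor L p x) \<and>
     (\<forall>X\<in>sections L. \<forall>Y\<in>sections L.
        (\<lambda>p. \<Phi> p (bracket L X Y p)) = bracket K (\<lambda>p. \<Phi> p (X p)) (\<lambda>p. \<Phi> p (Y p)))"


section \<open>The bundle of 1-jets\<close>

definition dual_sections ::
  "('m, 'e::euclidean_space) atlas \<Rightarrow> ('m, 'v::real_vector, 'z) vbundle_scheme \<Rightarrow> ('m \<Rightarrow> 'v \<Rightarrow> real) set" where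
  "dual_sections A B = {\<alpha>. (\<forall>p. linear_between (fibre B p) UNIV (\<alpha> p)) \<and>
     (\<forall>X\<in>sections B. (\<lambda>p. \<alpha> p (X p)) \<in> C_inf A)}"

text \<open>The 1-jet at \<open>p\<close> of a section \<open>X\<close> of \<open>B\<close> consists of the value \<open>X p\<close> and of the differential
  of the map \<open>X\<close> at \<open>p\<close>.  A tangent vector \<open>v\<close> is sent by the latter to the tangent vector
  \<open>F \<mapsto> v (F \<circ> X)\<close> of the total space at \<open>X p\<close>, which is determined by its values on the functions
  pulled back from the base (where it is \<open>v\<close>) and on the fibrewise linear functions \<open>F = \<alpha>\<close>.
  So it is encoded as \<open>(\<alpha>, v) \<mapsto> v (\<alpha> X)\<close>; in this encoding the vector space operations
  on jets are pointwise.\<close>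

type_synonym ('m, 'v) jet = "'v \<times> (('m \<Rightarrow> 'v \<Rightarrow> real) \<Rightarrow> 'm tangent \<Rightarrow> real)"

definition prolong ::
  "('m, 'e::euclidean_space) atlas \<Rightarrow> ('m, 'v::real_vector, 'z) vbundle_scheme \<Rightarrow>
   ('m \<Rightarrow> 'v) \<Rightarrow> 'm \<Rightarrow> ('m, 'v) jet" where
  "prolong A B X p =
     (X p, \<lambda>\<alpha> v. if \<alpha> \<in> dual_sections A B \<and> v \<in> tangent_space A p then v (\<lambda>q. \<alpha> q (X q)) else 0)"

text \<open>The smooth structure of the jet bundle: its smooth sections are locally the linear combinations,
  with smooth coefficients, of prolongations.\<close>

definition jet_space ::
  "('m, 'e::euclidean_space) atlas \<Rightarrow> ('m, 'v::real_vector, 'z) vbundle_scheme \<Rightarrow>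
   'm \<Rightarrow> ('m, 'v) jet set" where
  "jet_space A B p = {prolong A B X p |X. X \<in> sections B}"

definition jet_sections ::
  "('m::topological_space, 'e::euclidean_space) atlas \<Rightarrow> ('m, 'v::real_vector, 'z) vbundle_scheme \<Rightarrow>
   ('m \<Rightarrow> ('m, 'v) jet) set" where
  "jet_sections A B = {\<xi>. (\<forall>p. \<xi> p \<in> jet_space A B p) \<and>
     (\<forall>p. \<exists>W k X. open W \<and> p \<in> W \<and> (\<forall>i<k. X i \<in> sections B) \<and>
        smooth_combination A W k (\<lambda>i. prolong A B (X i)) \<xi>)}"

text \<open>The inclusion \<open>T\<^sup>*M \<otimes> B \<rightarrow> J\<^sup>1 B\<close>, where elements of \<open>T\<^sup>*M \<otimes> B\<close> at \<open>p\<close> are linear maps from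
  the tangent space to the fibre.  The sign is the one of the convention
  \<open>df \<otimes> X \<mapsto> f J\<^sup>1X - J\<^sup>1(fX)\<close>, see the lemma below.\<close>

definition jet_incl ::
  "('m, 'e::euclidean_space) atlas \<Rightarrow> ('m, 'v::real_vector, 'z) vbundle_scheme \<Rightarrow>
   'm \<Rightarrow> ('m tangent \<Rightarrow> 'v) \<Rightarrow> ('m, 'v) jet" where
  "jet_incl A B p \<phi> =
     (0, \<lambda>\<alpha> v. if \<alpha> \<in> dual_sections A B \<and> v \<in> tangent_space A p then - \<alpha> p (\<phi> v) else 0)"

lemma jet_incl_tensor:
  assumes "f \<in> C_inf A" and "X \<in> sections B" and fib: "\<And>q. X q \<in> fibre B q"
  shows "jet_incl A B p (\<lambda>v. v f *\<^sub>R X p) =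
           f p *\<^sub>R prolong A B X p - prolong A B (\<lambda>q. f q *\<^sub>R X q) p"
proof -
  have "- \<alpha> p (v f *\<^sub>R X p) = f p * v (\<lambda>q. \<alpha> q (X q)) - v (\<lambda>q. \<alpha> q (f q *\<^sub>R X q))"
    if "\<alpha> \<in> dual_sections A B" "v \<in> tangent_space A p" for \<alpha> v
  proof -
    have lin: "\<alpha> q (c *\<^sub>R X q) = c * \<alpha> q (X q)" for q c
      using that(1) fib by (simp add: dual_sections_def linear_between_def)
    have "(\<lambda>q. \<alpha> q (X q)) \<in> C_inf A"
      using that(1) assms(2) by (auto simp: dual_sections_def)
    moreover have "\<And>g. g \<in> C_inf A \<Longrightarrow> v (\<lambda>q. f q * g q) = v f * g p + f p * v g"
      using assms(1) that(2) by (simp add: tangent_space_def)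
    ultimately have "v (\<lambda>q. f q * \<alpha> q (X q)) = v f * \<alpha> p (X p) + f p * v (\<lambda>q. \<alpha> q (X q))"
      by blast
    then show ?thesis by (simp add: lin)
  qed
  then show ?thesis
    by (auto simp: jet_incl_def prolong_def fun_eq_iff)
qed

text \<open>The algebroid \<open>J\<^sup>1 L\<close>, given its bracket.  The projection to \<open>L\<close> is \<^const>\<open>fst\<close>.\<close>

definition jet_algebroid ::
  "('m::topological_space, 'e::euclidean_space) atlas \<Rightarrow> ('m, 'v::real_vector) algebroid \<Rightarrow>
   (('m \<Rightarrow> ('m, 'v) jet) \<Rightarrow> ('m \<Rightarrow> ('m, 'v) jet) \<Rightarrow> 'm \<Rightarrow> ('m, 'v) jet) \<Rightarrow>
   ('m, ('m, 'v) jet) algebroid" where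
  "jet_algebroid A L br = \<lparr>fibre = jet_space A L, sections = jet_sections A L,
     anchor = (\<lambda>p \<xi>. anchor L p (fst \<xi>)), bracket = br\<rparr>"

text \<open>The characterisation of the bracket of \<open>J\<^sup>1 L\<close>: there is exactly one such bracket (up to its
  irrelevant values on arguments which are not smooth sections).\<close>

definition jet_bracket ::
  "('m::topological_space, 'e::euclidean_space) atlas \<Rightarrow> ('m, 'v::real_vector) algebroid \<Rightarrow>
   (('m \<Rightarrow> ('m, 'v) jet) \<Rightarrow> ('m \<Rightarrow> ('m, 'v) jet) \<Rightarrow> 'm \<Rightarrow> ('m, 'v) jet) \<Rightarrow> bool" where
  "jet_bracket A L br \<longleftrightarrow>
     lie_algebroid A (jet_algebroid A L br) \<and>
     (\<forall>X\<in>sections L. \<forall>Y\<in>sections L. br (prolong A L X) (prolong A L Y) = prolong A L (bracket L X Y))"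


section \<open>Linear connections\<close>

text \<open>A connection maps a section \<open>X\<close> to the section \<open>D X\<close> of \<open>T\<^sup>*M \<otimes> B\<close>, i.e.\ to a bundle morphism
  from the tangent bundle to \<open>B\<close>; \<open>D X p v\<close> is the derivative of \<open>X\<close> in direction \<open>v\<close> at \<open>p\<close>.
  The last two conditions fix the values at meaningless arguments, so that equality of connections is
  equality of HOL functions.\<close>

definition linear_connection ::
  "('m, 'e::euclidean_space) atlas \<Rightarrow> ('m, 'v::real_vector, 'z) vbundle_scheme \<Rightarrow>
   (('m \<Rightarrow> 'v) \<Rightarrow> 'm \<Rightarrow> 'm tangent \<Rightarrow> 'v) \<Rightarrow> bool" where
  "linear_connection A B D \<longleftrightarrow>
     (\<forall>X\<in>sections B. bundle_morphism (tangent_bundle A) B (D X)) \<and>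
     (\<forall>X\<in>sections B. \<forall>Y\<in>sections B. \<forall>p. \<forall>v\<in>tangent_space A p.
        D (\<lambda>q. X q + Y q) p v = D X p v + D Y p v) \<and>
     (\<forall>X\<in>sections B. \<forall>f\<in>C_inf A. \<forall>p. \<forall>v\<in>tangent_space A p.
        D (\<lambda>q. f q *\<^sub>R X q) p v = v f *\<^sub>R X p + f p *\<^sub>R D X p v) \<and>
     (\<forall>X p v. X \<notin> sections B \<longrightarrow> D X p v = 0) \<and>
     (\<forall>X p v. v \<notin> tangent_space A p \<longrightarrow> D X p v = 0)"

text \<open>The splitting with \<open>s X = J\<^sup>1X + D X\<close> on sections.  The right-hand side at \<open>p\<close> depends
  only on \<open>x = X p\<close>.\<close>

definition splitting ::
  "('m, 'e::euclidean_space) atlas \<Rightarrow> ('m, 'v::real_vector, 'z) vbundle_scheme \<Rightarrow>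
   (('m \<Rightarrow> 'v) \<Rightarrow> 'm \<Rightarrow> 'm tangent \<Rightarrow> 'v) \<Rightarrow> 'm \<Rightarrow> 'v \<Rightarrow> ('m, 'v) jet" where
  "splitting A B D p x =
     (let X = SOME X. X \<in> sections B \<and> X p = x in prolong A B X p + jet_incl A B p (D X p))"

definition cartan_connection ::
  "('m::topological_space, 'e::euclidean_space) atlas \<Rightarrow> ('m, 'v::real_vector) algebroid \<Rightarrow>
   (('m \<Rightarrow> ('m, 'v) jet) \<Rightarrow> ('m \<Rightarrow> ('m, 'v) jet) \<Rightarrow> 'm \<Rightarrow> ('m, 'v) jet) \<Rightarrow>
   (('m \<Rightarrow> 'v) \<Rightarrow> 'm \<Rightarrow> 'm tangent \<Rightarrow> 'v) \<Rightarrow> bool" where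
  "cartan_connection A L br D \<longleftrightarrow>
     linear_connection A L D \<and> algebroid_morphism L (jet_algebroid A L br) (splitting A L D)"

definition parallel ::
  "('m, 'v::real_vector, 'z) vbundle_scheme \<Rightarrow> (('m \<Rightarrow> 'v) \<Rightarrow> 'm \<Rightarrow> 'm tangent \<Rightarrow> 'v) \<Rightarrow>
   ('m \<Rightarrow> 'v) \<Rightarrow> bool" where
  "parallel B D W \<longleftrightarrow> W \<in> sections B \<and> (\<forall>p v. D W p v = 0)"


section \<open>Infinitesimal geometric structures\<close>

definition infinitesimal_geometric_structure ::
  "('m::topological_space, 'e::euclidean_space) atlas \<Rightarrow> ('m, 'v::real_vector) algebroid \<Rightarrow>
   (('m \<Rightarrow> ('m, 'v) jet) \<Rightarrow> ('m \<Rightarrow> ('m, 'v) jet) \<Rightarrow> 'm \<Rightarrow> ('m, 'v) jet) \<Rightarrow>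
   ('m \<Rightarrow> ('m, 'v) jet set) \<Rightarrow> bool" where
  "infinitesimal_geometric_structure A L br g \<longleftrightarrow> subalgebroid A (jet_algebroid A L br) g"

definition igs_image :: "('m \<Rightarrow> ('m, 'v) jet set) \<Rightarrow> 'm \<Rightarrow> 'v set" where
  "igs_image g p = fst ` g p"

definition structure_kernel :: "('m \<Rightarrow> ('m, 'v::real_vector) jet set) \<Rightarrow> 'm \<Rightarrow> ('m, 'v) jet set" where
  "structure_kernel g p = {\<xi> \<in> g p. fst \<xi> = 0}"

definition constant_rank :: "('m \<Rightarrow> ('m, 'v::real_vector) jet set) \<Rightarrow> bool" where
  "constant_rank g \<longleftrightarrow> (\<exists>r. \<forall>p. dim (igs_image g p) = r)"

definition igs_surjective ::
  "('m, 'v, 'z) vbundle_scheme \<Rightarrow> ('m \<Rightarrow> ('m, 'v) jet set) \<Rightarrow> bool" where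
  "igs_surjective B g \<longleftrightarrow> (\<forall>p. igs_image g p = fibre B p)"

definition symmetry ::
  "('m::topological_space, 'e::euclidean_space) atlas \<Rightarrow> ('m, 'v::real_vector) algebroid \<Rightarrow>
   ('m \<Rightarrow> ('m, 'v) jet set) \<Rightarrow> ('m \<Rightarrow> 'v) \<Rightarrow> bool" where
  "symmetry A L g W \<longleftrightarrow> W \<in> sections L \<and> (\<forall>p. prolong A L W p \<in> g p)"

definition generator ::
  "('m, 'e::euclidean_space) atlas \<Rightarrow> ('m, 'v::real_vector) algebroid \<Rightarrow>
   ('m \<Rightarrow> ('m, 'v) jet set) \<Rightarrow> (('m \<Rightarrow> 'v) \<Rightarrow> 'm \<Rightarrow> 'm tangent \<Rightarrow> 'v) \<Rightarrow> bool" where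
  "generator A L g D \<longleftrightarrow>
     linear_connection A L D \<and> (\<forall>p. splitting A L D p ` igs_image g p \<subseteq> g p)"

end

theory Submission
  imports Defs
begin

text \<open>If \<open>\<nabla>\<close> is a generator, so is \<open>\<nabla> + \<alpha> \<otimes> \<Psi>\<close> for \<open>\<alpha>\<close> in \<open>\<Gamma>(t\<^sup>*)\<close> and \<open>\<Psi>\<close> in \<open>\<Gamma>(T\<^sup>*M \<otimes> t)\<close>, provided
  that \<open>\<alpha>\<close> vanishes on the image or \<open>\<Psi>\<close> takes values in the structure kernel.  If the image is a
  proper subspace somewhere, constant rank yields a nonzero such \<open>\<alpha>\<close>; if the projection is surjective
  with nonzero kernel, subtracting \<open>s\<^sub>\<nabla>(a \<xi>)\<close> from a section \<open>\<xi>\<close> of \<open>g\<close> yields a nonzero such \<open>\<Psi>\<close>.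
  Conversely, if the projection \<open>a\<close> is bijective, \<open>s\<^sub>\<nabla> = a\<^sup>-\<^sup>1\<close> determines \<open>\<nabla>\<close>; it is a morphism because
  \<open>g\<close> is closed under brackets and \<open>a\<close> preserves them.\<close>

section \<open>Smooth functions on open sets\<close>

text \<open>Derivations, connections, prolongations and dual sections act on global objects only,
  whereas frames and coefficients exist locally. Each local construction is therefore multiplied by
  a bump function; this is why a calculus of smooth functions and the locality of derivations stand
  at the start. What constant rank provides: sections of \<open>g\<close> whose projections form a
  basis of the image at one point have independent projections nearby, and equality of dimensions
  makes these span the image nearby. A dual section that annihilates these finitely many projections
  thus annihilates the image on a whole neighbourhood, and after a cutoff everywhere. If the image
  filled the fibre at points accumulating at p, continuity would force \<alpha> to vanish at p. That
  nonzero \<Psi> are available rests on tangent vectors: the model space has positive dimension, so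
  some v and f satisfy v f \<noteq> 0 at each point. Conversely, the pointwise inverse of the
  projection must be shown to be smooth.\<close>

lemma C_upto_cong:
  assumes "open S" "\<And>x. x \<in> S \<Longrightarrow> f x = g x" "C_upto n S f"
  shows "C_upto n S g"
  using assms(2,3)
proof (induction n arbitrary: f g)
  case 0
  then show ?case using continuous_on_eq by auto
next
  case (Suc n)
  \<comment> \<open>A derivative depends only on the germ at x, and S is a neighbourhood of
    x.\<close>
  have d: "(g has_derivative frechet_derivative f (at x)) (at x)" if "x \<in> S" for x
  proof (rule has_derivative_transform_within_open[OF _ \<open>open S\<close> that])
    show "(f has_derivative frechet_derivative f (at x)) (at x)"
      using Suc.prems(2) that by (simp add: frechet_derivative_works)
  qed (rule Suc.prems(1))
  have "C_upto n S (\<lambda>x. frechet_derivative g (at x) v)" for v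
  proof (rule Suc.IH)
    show "frechet_derivative f (at x) v = frechet_derivative g (at x) v" if "x \<in> S" for x
      using frechet_derivative_at[OF d[OF that]] by simp
    show "C_upto n S (\<lambda>x. frechet_derivative f (at x) v)" using Suc.prems(2) by simp
  qed
  then show ?case using d by (auto simp: differentiable_def)
qed

text \<open>Lets the closure properties below name a derivative explicitly:
  \<open>frechet_derivative\<close> has to agree with it only on S, and \<open>C_upto_cong\<close>
  does the rest.\<close>

lemma C_upto_SucI:
  assumes "open S" "\<And>x. x \<in> S \<Longrightarrow> (f has_derivative f' x) (at x)"
    and "\<And>v. C_upto n S (\<lambda>x. f' x v)"
  shows "C_upto (Suc n) S f"
proof -
  have "C_upto n S (\<lambda>x. frechet_derivative f (at x) v)" for v
    by (rule C_upto_cong[OF assms(1) _ assms(3)[of v]])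
      (use assms(2) in \<open>metis frechet_derivative_at\<close>)
  then show ?thesis using assms(2) by (auto simp: differentiable_def)
qed

lemma C_upto_SucD:
  assumes "C_upto (Suc n) S f"
  shows "x \<in> S \<Longrightarrow> (f has_derivative frechet_derivative f (at x)) (at x)"
    and "C_upto n S (\<lambda>x. frechet_derivative f (at x) v)"
  using assms by (auto simp: frechet_derivative_works)

text \<open>Product, inverse and chain rule have derivatives that contain the original functions,
  which are then wanted at order n instead of Suc n.\<close>

lemma C_upto_pred: "C_upto (Suc n) S f \<Longrightarrow> C_upto n S f"
proof (induction n arbitrary: f)
  case 0
  then show ?case
    by (auto intro!: continuous_at_imp_continuous_on differentiable_imp_continuous_within)
next
  case (Suc n)
  then show ?case by (metis C_upto.simps(2))
qed

lemma C_upto_subset: "C_upto n S f \<Longrightarrow> T \<subseteq> S \<Longrightarrow> C_upto n T f"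
  by (induction n arbitrary: f) (auto intro: continuous_on_subset)

lemma C_upto_local:
  assumes "\<And>x. x \<in> S \<Longrightarrow> \<exists>T. open T \<and> x \<in> T \<and> C_upto n T f"
  shows "C_upto n S f"
  using assms
proof (induction n arbitrary: f)
  case 0
  show ?case
  proof (unfold C_upto.simps, intro continuous_at_imp_continuous_on ballI)
    fix x assume "x \<in> S"
    then obtain T where "open T" "x \<in> T" "continuous_on T f" using 0 by auto
    then show "isCont f x" by (simp add: continuous_on_eq_continuous_at)
  qed
next
  case (Suc n)
  show ?case
  proof (simp only: C_upto.simps, intro conjI allI ballI)
    fix x assume "x \<in> S"
    then show "f differentiable (at x)" using Suc.prems by fastforce
  next
    fix v
    show "C_upto n S (\<lambda>x. frechet_derivative f (at x) v)"
      by (rule Suc.IH) (use Suc.prems in fastforce)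
  qed
qed

lemma C_upto_const [simp]: "open S \<Longrightarrow> C_upto n S (\<lambda>x. c)"
proof (induction n arbitrary: c)
  case (Suc n)
  then show ?case
    by (intro C_upto_SucI[where f' = "\<lambda>x v. 0"]) auto
qed auto

lemma C_upto_bounded_linear:
  assumes "open S" "bounded_linear T" "C_upto n S f"
  shows "C_upto n S (\<lambda>x. T (f x))"
  using assms(3)
proof (induction n arbitrary: f)
  case 0
  then show ?case using assms by (auto intro: bounded_linear.continuous_on)
next
  case (Suc n)
  show ?case
    by (rule C_upto_SucI[OF assms(1), where f' = "\<lambda>x v. T (frechet_derivative f (at x) v)"])
      (use Suc.prems in \<open>auto intro!: Suc.IH C_upto_SucD
        bounded_linear.has_derivative[OF assms(2)]\<close>)
qed

lemma C_upto_id: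
  assumes "open S"
  shows "C_upto n S (\<lambda>x. x)"
proof (cases n)
  case (Suc m)
  then show ?thesis
    using assms C_upto_SucI[OF assms, of "\<lambda>x. x" "\<lambda>x v. v" m] by auto
qed auto

lemma C_upto_add:
  assumes "open S" "C_upto n S f" "C_upto n S g"
  shows "C_upto n S (\<lambda>x. f x + g x)"
  using assms(2,3)
proof (induction n arbitrary: f g)
  case (Suc n)
  show ?case
    by (rule C_upto_SucI[OF assms(1), where
          f' = "\<lambda>x v. frechet_derivative f (at x) v + frechet_derivative g (at x) v"])
      (use Suc.prems in \<open>auto intro!: Suc.IH C_upto_SucD has_derivative_add\<close>)
qed (auto intro: continuous_on_add)

lemma C_upto_mult:
  fixes f g :: "'a::real_normed_vector \<Rightarrow> real"
  assumes "open S" "C_upto n S f" "C_upto n S g"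
  shows "C_upto n S (\<lambda>x. f x * g x)"
  using assms(2,3)
proof (induction n arbitrary: f g)
  case (Suc n)
  show ?case
    by (rule C_upto_SucI[OF assms(1), where
          f' = "\<lambda>x v. f x * frechet_derivative g (at x) v + frechet_derivative f (at x) v * g x"])
      (use Suc.prems in \<open>auto intro!: Suc.IH C_upto_SucD C_upto_add[OF assms(1)] has_derivative_mult
        intro: C_upto_pred simp del: C_upto.simps\<close>)
qed (auto intro: continuous_on_mult)

lemma C_upto_sum:
  assumes "open S" "\<And>i. i \<in> I \<Longrightarrow> C_upto n S (f i)"
  shows "C_upto n S (\<lambda>x. \<Sum>i\<in>I. f i x)"
  using assms(2) by (induction I rule: infinite_finite_induct) (auto intro: C_upto_add C_upto_const assms(1))

text \<open>The derivative contains 1/f again, so the induction keeps f fixed and feeds on its own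
  hypothesis. The minus sign is written as a factor, which leaves only products to treat.\<close>

lemma C_upto_inverse:
  fixes f :: "'a::real_normed_vector \<Rightarrow> real"
  assumes "open S" "C_upto n S f" "\<And>x. x \<in> S \<Longrightarrow> f x \<noteq> 0"
  shows "C_upto n S (\<lambda>x. inverse (f x))"
  using assms(2)
proof (induction n)
  case 0
  then show ?case using assms(3) by (auto intro: continuous_on_inverse)
next
  case (Suc n)
  have inv: "C_upto n S (\<lambda>x. inverse (f x))" using Suc C_upto_pred by blast
  show ?case
  proof (rule C_upto_SucI[OF assms(1), where
          f' = "\<lambda>x v. (- 1) * (inverse (f x) * (frechet_derivative f (at x) v * inverse (f x)))"])
    fix x assume x: "x \<in> S"
    from Deriv.has_derivative_inverse[OF assms(3)[OF x] C_upto_SucD(1)[OF Suc.prems x]]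
    show "((\<lambda>x. inverse (f x)) has_derivative
       (\<lambda>v. (- 1) * (inverse (f x) * (frechet_derivative f (at x) v * inverse (f x))))) (at x)"
      by (simp add: mult.assoc)
  next
    fix v
    show "C_upto n S
       (\<lambda>x. (- 1) * (inverse (f x) * (frechet_derivative f (at x) v * inverse (f x))))"
      by (intro C_upto_mult assms(1) inv C_upto_const C_upto_SucD(2)[OF Suc.prems])
  qed
qed

text \<open>In the chain rule both the base point u x and the direction u' x v vary with x.
  Expanding the direction in the basis of the intermediate space gives a finite sum of products, and
  the induction hypothesis, general in h, applies to the partial derivatives of h.\<close>

lemma C_upto_compose:
  fixes u :: "'a::real_normed_vector \<Rightarrow> 'b::euclidean_space" and h :: "'b \<Rightarrow> real"
  assumes "open S" "open T" "u ` S \<subseteq> T" "C_upto n S u" "C_upto n T h"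
  shows "C_upto n S (\<lambda>x. h (u x))"
  using assms(4,5)
proof (induction n arbitrary: h)
  case 0
  then show ?case
    using continuous_on_compose2 assms(3) by (metis C_upto.simps(1))
next
  case (Suc n)
  let ?u' = "\<lambda>x. frechet_derivative u (at x)" and ?h' = "\<lambda>y. frechet_derivative h (at y)"
  show ?case
  proof (rule C_upto_SucI[OF assms(1), where
          f' = "\<lambda>x v. \<Sum>b\<in>Basis. (?u' x v \<bullet> b) * ?h' (u x) b"])
    fix x assume x: "x \<in> S"
    then have ux: "u x \<in> T" using assms(3) by auto
    have h: "(h has_derivative ?h' (u x)) (at (u x))" using C_upto_SucD(1)[OF Suc.prems(2) ux] .
    have eq: "?h' (u x) y = (\<Sum>b\<in>Basis. (y \<bullet> b) * ?h' (u x) b)" for y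
    proof -
      have "linear (?h' (u x))" using h has_derivative_linear by blast
      then have "?h' (u x) (\<Sum>b\<in>Basis. (y \<bullet> b) *\<^sub>R b) = (\<Sum>b\<in>Basis. (y \<bullet> b) * ?h' (u x) b)"
        by (simp add: linear_sum linear_cmul)
      then show ?thesis by (simp add: euclidean_representation)
    qed
    have "(\<lambda>v. ?h' (u x) (?u' x v)) = (\<lambda>v. \<Sum>b\<in>Basis. (?u' x v \<bullet> b) * ?h' (u x) b)"
      by (rule ext) (rule eq)
    then show "((\<lambda>x. h (u x)) has_derivative (\<lambda>v. \<Sum>b\<in>Basis. (?u' x v \<bullet> b) * ?h' (u x) b)) (at x)"
      using has_derivative_compose[OF C_upto_SucD(1)[OF Suc.prems(1) x] h]
      by (rule subst[where P = "\<lambda>d. ((\<lambda>x. h (u x)) has_derivative d) (at x)"])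
  next
    fix v
    show "C_upto n S (\<lambda>x. \<Sum>b\<in>Basis. (?u' x v \<bullet> b) * ?h' (u x) b)"
    proof (intro C_upto_sum C_upto_mult assms(1))
      fix b :: 'b
      show "C_upto n S (\<lambda>x. ?u' x v \<bullet> b)"
        by (rule C_upto_bounded_linear[OF assms(1) bounded_linear_inner_left C_upto_SucD(2)[OF Suc.prems(1)]])
      show "C_upto n S (\<lambda>x. ?h' (u x) b)"
        by (rule Suc.IH[OF C_upto_pred[OF Suc.prems(1)] C_upto_SucD(2)[OF Suc.prems(2)]])
    qed
  qed
qed

section \<open>Passage from finite order to smoothness\<close>

lemma smooth_on_const: "open S \<Longrightarrow> smooth_on S (\<lambda>x. c)"
  by (simp add: smooth_on_def)

lemma smooth_on_cong:
  "open S \<Longrightarrow> (\<And>x. x \<in> S \<Longrightarrow> f x = g x) \<Longrightarrow> smooth_on S f \<Longrightarrow> smooth_on S g"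
  unfolding smooth_on_def using C_upto_cong by blast

lemma smooth_on_subset: "smooth_on S f \<Longrightarrow> T \<subseteq> S \<Longrightarrow> smooth_on T f"
  unfolding smooth_on_def using C_upto_subset by blast

lemma smooth_on_local:
  "(\<And>x. x \<in> S \<Longrightarrow> \<exists>T. open T \<and> x \<in> T \<and> smooth_on T f) \<Longrightarrow> smooth_on S f"
  unfolding smooth_on_def using C_upto_local by meson

lemma smooth_on_imp_differentiable: "smooth_on S f \<Longrightarrow> x \<in> S \<Longrightarrow> f differentiable (at x)"
  unfolding smooth_on_def by (metis C_upto.simps(2))

lemma smooth_on_imp_continuous: "smooth_on S f \<Longrightarrow> continuous_on S f"
  unfolding smooth_on_def by (metis C_upto.simps(1))

lemma smooth_on_add:
  "open S \<Longrightarrow> smooth_on S f \<Longrightarrow> smooth_on S g \<Longrightarrow> smooth_on S (\<lambda>x. f x + g x)"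
  unfolding smooth_on_def by (simp add: C_upto_add)

lemma smooth_on_mult:
  fixes f g :: "'a::real_normed_vector \<Rightarrow> real"
  shows "open S \<Longrightarrow> smooth_on S f \<Longrightarrow> smooth_on S g \<Longrightarrow> smooth_on S (\<lambda>x. f x * g x)"
  unfolding smooth_on_def by (simp add: C_upto_mult)

lemma smooth_on_inverse:
  fixes f :: "'a::real_normed_vector \<Rightarrow> real"
  shows "open S \<Longrightarrow> smooth_on S f \<Longrightarrow> (\<And>x. x \<in> S \<Longrightarrow> f x \<noteq> 0) \<Longrightarrow> smooth_on S (\<lambda>x. inverse (f x))"
  unfolding smooth_on_def by (simp add: C_upto_inverse)

lemma smooth_on_compose:
  fixes u :: "'a::real_normed_vector \<Rightarrow> 'b::euclidean_space" and h :: "'b \<Rightarrow> real"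
  shows "open S \<Longrightarrow> open T \<Longrightarrow> u ` S \<subseteq> T \<Longrightarrow> smooth_on S u \<Longrightarrow> smooth_on T h \<Longrightarrow> smooth_on S (\<lambda>x. h (u x))"
  unfolding smooth_on_def by (simp add: C_upto_compose)

lemma smooth_on_inner:
  fixes a :: "'a::euclidean_space"
  shows "open S \<Longrightarrow> smooth_on S (\<lambda>x. x \<bullet> a)"
  unfolding smooth_on_def
  using C_upto_bounded_linear[OF _ bounded_linear_inner_left C_upto_id] by blast


subsection \<open>Bump functions\<close>

text \<open>The powers of \<open>1 / t\<close> make this family closed under differentiation.\<close>

definition flat_exp :: "nat \<Rightarrow> real \<Rightarrow> real" where
  "flat_exp m t = (if t > 0 then inverse t ^ m * exp (- inverse t) else 0)"

text \<open>Substituting x = 1/t turns this into the decay of x^m / exp x at infinity.\<close>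

lemma flat_exp_tendsto_0: "(flat_exp m \<longlongrightarrow> 0) (at_right 0)"
proof -
  have "((\<lambda>x::real. x ^ m / exp x) \<longlongrightarrow> 0) at_top"
    by (rule tendsto_power_div_exp_0)
  then have "((\<lambda>t::real. inverse t ^ m / exp (inverse t)) \<longlongrightarrow> 0) (at_right 0)"
    by (rule filterlim_compose) (rule filterlim_inverse_at_top_right)
  moreover have "eventually (\<lambda>t. inverse t ^ m / exp (inverse t) = flat_exp m t) (at_right 0)"
    unfolding eventually_at_right_field by (auto simp: flat_exp_def exp_minus field_simps intro!: exI[of _ 1])
  ultimately show ?thesis by (rule Lim_transform_eventually)
qed

lemma flat_exp_has_derivative:
  "(flat_exp m has_real_derivative (flat_exp (m + 2) t - m * flat_exp (m + 1) t)) (at t)"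
proof -
  consider "t > 0" | "t < 0" | "t = 0" by linarith
  then show ?thesis
  proof cases
    case 1
    have "((\<lambda>t. inverse t ^ m * exp (- inverse t)) has_real_derivative
        (flat_exp (m + 2) t - m * flat_exp (m + 1) t)) (at t)"
      using 1
      apply (auto intro!: derivative_eq_intros simp: flat_exp_def)
      apply (cases m; simp add: field_simps power2_eq_square)
      done
    then show ?thesis
      by (rule has_field_derivative_transform_within_open[where S = "{0<..}"])
        (use 1 in \<open>auto simp: flat_exp_def\<close>)
  next
    case 2
    have "((\<lambda>t. 0) has_real_derivative (flat_exp (m + 2) t - m * flat_exp (m + 1) t)) (at t)"
      using 2 by (auto simp: flat_exp_def)
    then show ?thesis
      by (rule has_field_derivative_transform_within_open[where S = "{..<0}"])
        (use 2 in \<open>auto simp: flat_exp_def\<close>)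
  next
    case 3
    \<comment> \<open>For h > 0 the difference quotient at 0 is \<open>flat_exp (m + 1) h\<close>,
      again a member of the family; for h < 0 it is 0.\<close>
    have "((\<lambda>h. flat_exp m h / h) \<longlongrightarrow> 0) (at_right 0)"
      by (rule Lim_transform_eventually[OF flat_exp_tendsto_0[of "m + 1"]])
        (auto simp: flat_exp_def eventually_at_right_field field_simps intro!: exI[of _ 1])
    moreover have "((\<lambda>h. flat_exp m h / h) \<longlongrightarrow> 0) (at_left 0)"
      by (rule Lim_transform_eventually[OF tendsto_const])
        (auto simp: flat_exp_def eventually_at_left_field intro!: exI[of _ "-1"])
    ultimately have "((\<lambda>h. flat_exp m h / h) \<longlongrightarrow> 0) (at 0)"
      by (simp add: filterlim_split_at)
    then show ?thesis using 3 by (simp add: DERIV_def flat_exp_def)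
  qed
qed

lemma smooth_on_flat_exp: "smooth_on UNIV (flat_exp m)"
proof -
  have "C_upto n UNIV (flat_exp m)" for n
  proof (induction n arbitrary: m)
    case 0
    have "isCont (flat_exp m) t" for t
      using DERIV_isCont[OF flat_exp_has_derivative] .
    then show ?case by (simp add: continuous_at_imp_continuous_on)
  next
    case (Suc n)
    show ?case
    proof (rule C_upto_SucI[where
          f' = "\<lambda>t v. (flat_exp (m + 2) t + (- real m) * flat_exp (m + 1) t) * v"])
      show "(flat_exp m has_derivative
          (\<lambda>v. (flat_exp (m + 2) t + (- real m) * flat_exp (m + 1) t) * v)) (at t)" for t
        using flat_exp_has_derivative[of m t, unfolded has_field_derivative_def] by simp
      show "C_upto n UNIV (\<lambda>t. (flat_exp (m + 2) t + (- real m) * flat_exp (m + 1) t) * v)" for v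
        by (intro C_upto_mult C_upto_add C_upto_const open_UNIV Suc.IH)
    qed auto
  qed
  then show ?thesis by (simp add: smooth_on_def)
qed

lemma flat_exp_pos_iff: "flat_exp m t > 0 \<longleftrightarrow> t > 0"
  by (simp add: flat_exp_def)

lemma flat_exp_nonneg: "flat_exp m t \<ge> 0"
  by (simp add: flat_exp_def)

text \<open>The function is P / (P + Q), where P is positive exactly at distance less than 2 r from
  a, and Q exactly at distance greater than r. These two regions cover the space, so the denominator
  never vanishes.\<close>

lemma euclidean_bump:
  fixes a :: "'a::euclidean_space"
  assumes "r > 0"
  obtains h :: "'a \<Rightarrow> real" where "smooth_on UNIV h"
    "\<And>x. x \<in> ball a r \<Longrightarrow> h x = 1" "\<And>x. x \<notin> cball a (2 * r) \<Longrightarrow> h x = 0"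
proof -
  \<comment> \<open>The squared distance to a, written as a polynomial in the coordinates so that
    its smoothness follows from sums and products.\<close>
  define n2 where "n2 x = (\<Sum>b\<in>Basis. (x \<bullet> b + - (a \<bullet> b)) * (x \<bullet> b + - (a \<bullet> b)))" for x
  have n: "n2 x = (dist a x)\<^sup>2" for x
    unfolding n2_def dist_norm power2_norm_eq_inner
    by (subst euclidean_inner) (auto simp: inner_diff_left algebra_simps intro!: sum.cong)
  have sn: "smooth_on UNIV n2"
  proof -
    have "smooth_on UNIV (\<lambda>x. x \<bullet> b + - (a \<bullet> b))" for b
      by (intro smooth_on_add smooth_on_const smooth_on_inner open_UNIV)
    then show ?thesis
      unfolding smooth_on_def n2_def by (auto intro!: C_upto_sum C_upto_mult)
  qed
  define P where "P x = flat_exp 0 (4 * r\<^sup>2 + (- 1) * n2 x)" for x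
  define Q where "Q x = flat_exp 0 (n2 x + - (r\<^sup>2))" for x
  have P: "smooth_on UNIV P" unfolding P_def
    by (rule smooth_on_compose[OF open_UNIV open_UNIV subset_UNIV _ smooth_on_flat_exp])
      (intro smooth_on_add smooth_on_mult smooth_on_const sn open_UNIV)
  have Q: "smooth_on UNIV Q" unfolding Q_def
    by (rule smooth_on_compose[OF open_UNIV open_UNIV subset_UNIV _ smooth_on_flat_exp])
      (intro smooth_on_add smooth_on_mult smooth_on_const sn open_UNIV)
  have "P x + Q x \<noteq> 0" for x
  proof -
    have "P x > 0 \<or> Q x > 0"
      unfolding P_def Q_def flat_exp_pos_iff using assms by (smt (verit) zero_less_power)
    then show ?thesis
      using flat_exp_nonneg unfolding P_def Q_def by (smt (verit))
  qed
  then have "smooth_on UNIV (\<lambda>x. P x * inverse (P x + Q x))"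
    by (intro smooth_on_mult smooth_on_inverse smooth_on_add P Q open_UNIV)
  moreover have "P x * inverse (P x + Q x) = 1" if "x \<in> ball a r" for x
  proof -
    have "(dist a x)\<^sup>2 \<le> r\<^sup>2" using that assms by (intro power_mono) auto
    then have "Q x = 0" by (simp add: Q_def n flat_exp_def)
    then show ?thesis using \<open>P x + Q x \<noteq> 0\<close> by simp
  qed
  moreover have "P x * inverse (P x + Q x) = 0" if "x \<notin> cball a (2 * r)" for x
  proof -
    have "(2 * r)\<^sup>2 \<le> (dist a x)\<^sup>2" using that assms by (intro power_mono) auto
    then have "P x = 0" by (simp add: P_def n flat_exp_def power_mult_distrib)
    then show ?thesis by simp
  qed
  ultimately show ?thesis using that by blast
qed

section \<open>Smooth functions and bump functions on manifolds\<close>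

locale manifold =
  fixes A :: "('m::{t2_space, second_countable_topology}, 'e::euclidean_space) atlas"
  assumes smooth_manifold: "smooth_manifold A"
begin

lemma chartE:
  obtains U \<phi> where "(U, \<phi>) \<in> A" "p \<in> U"
proof -
  have "p \<in> (\<Union>(U, \<phi>)\<in>A. U)" using smooth_manifold by (simp add: smooth_manifold_def)
  then show ?thesis using that by blast
qed

lemma chart:
  assumes "(U, \<phi>) \<in> A"
  shows chart_domain_open: "open U" and chart_range_open: "open (\<phi> ` U)"
    and chart_homeomorphism: "homeomorphism U (\<phi> ` U) \<phi> (inv_into U \<phi>)"
  using assms smooth_manifold by (auto simp: smooth_manifold_def)

lemma chart_inv:
  assumes "(U, \<phi>) \<in> A" "q \<in> U"
  shows "inv_into U \<phi> (\<phi> q) = q"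
  using homeomorphism_apply1[OF chart_homeomorphism[OF assms(1)] assms(2)] .

lemma chart_transition:
  assumes "(U, \<phi>) \<in> A" "(V, \<psi>) \<in> A"
  shows "smooth_on (\<phi> ` (U \<inter> V)) (\<psi> \<circ> inv_into U \<phi>)"
  using assms smooth_manifold unfolding smooth_manifold_def by blast

lemma chart_image_open:
  assumes "(U, \<phi>) \<in> A" "open W"
  shows "open (\<phi> ` (U \<inter> W))"
proof -
  have "openin (top_of_set U) (U \<inter> W)" using assms(2) by (rule openin_open_Int)
  from homeomorphism_imp_open_map[OF chart_homeomorphism[OF assms(1)] this]
  show ?thesis using chart_range_open[OF assms(1)] openin_open_trans by blast
qed

lemma chart_preimage_open:
  assumes "(U, \<phi>) \<in> A" "open T"
  shows "open (U \<inter> \<phi> -` T)"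
proof -
  have "continuous_on U \<phi>" using chart_homeomorphism[OF assms(1)] homeomorphism_def by blast
  then show ?thesis
    using assms(2) chart_domain_open[OF assms(1)] by (simp add: continuous_on_open_vimage Int_commute)
qed

section \<open>Smooth functions on open subsets of the manifold\<close>

lemma smooth_fun_cong:
  assumes "open W" "\<And>q. q \<in> W \<Longrightarrow> f q = g q" "smooth_fun A W f"
  shows "smooth_fun A W g"
  unfolding smooth_fun_def
proof (clarify)
  fix U \<phi> assume c: "(U, \<phi>) \<in> A"
  show "smooth_on (\<phi> ` (U \<inter> W)) (g \<circ> inv_into U \<phi>)"
    by (rule smooth_on_cong[OF chart_image_open[OF c assms(1)], of "f \<circ> inv_into U \<phi>"])
      (use assms c in \<open>auto simp: chart_inv smooth_fun_def\<close>)
qed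

lemma smooth_fun_subset: "smooth_fun A W f \<Longrightarrow> W' \<subseteq> W \<Longrightarrow> smooth_fun A W' f"
  unfolding smooth_fun_def by (fastforce intro: smooth_on_subset)

lemma smooth_fun_local:
  assumes "\<And>p. p \<in> W \<Longrightarrow> \<exists>T. open T \<and> p \<in> T \<and> smooth_fun A T f"
  shows "smooth_fun A W f"
  unfolding smooth_fun_def
proof (clarify)
  fix U \<phi> assume c: "(U, \<phi>) \<in> A"
  show "smooth_on (\<phi> ` (U \<inter> W)) (f \<circ> inv_into U \<phi>)"
  proof (rule smooth_on_local)
    fix x assume "x \<in> \<phi> ` (U \<inter> W)"
    then obtain p where p: "x = \<phi> p" "p \<in> U" "p \<in> W" by blast
    then obtain T where "open T" "p \<in> T" "smooth_fun A T f" using assms by blast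
    then show "\<exists>T. open T \<and> x \<in> T \<and> smooth_on T (f \<circ> inv_into U \<phi>)"
      using c p chart_image_open[OF c \<open>open T\<close>]
      by (intro exI[of _ "\<phi> ` (U \<inter> T)"]) (auto simp: smooth_fun_def)
  qed
qed

lemma smooth_fun_const: "open W \<Longrightarrow> smooth_fun A W (\<lambda>q. c)"
  unfolding smooth_fun_def by (auto simp: comp_def intro!: smooth_on_const chart_image_open)

lemma smooth_fun_add:
  "open W \<Longrightarrow> smooth_fun A W f \<Longrightarrow> smooth_fun A W g \<Longrightarrow> smooth_fun A W (\<lambda>q. f q + g q)"
  unfolding smooth_fun_def by (fastforce simp: comp_def intro: smooth_on_add chart_image_open)

lemma smooth_fun_mult:
  "open W \<Longrightarrow> smooth_fun A W f \<Longrightarrow> smooth_fun A W g \<Longrightarrow> smooth_fun A W (\<lambda>q. f q * g q)"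
  unfolding smooth_fun_def by (fastforce simp: comp_def intro: smooth_on_mult chart_image_open)

lemma smooth_fun_inverse:
  "open W \<Longrightarrow> smooth_fun A W f \<Longrightarrow> (\<And>q. q \<in> W \<Longrightarrow> f q \<noteq> 0) \<Longrightarrow> smooth_fun A W (\<lambda>q. inverse (f q))"
  unfolding smooth_fun_def
  by (fastforce simp: comp_def chart_inv intro!: smooth_on_inverse chart_image_open)

lemma C_inf_const: "(\<lambda>q. c) \<in> C_inf A"
  by (simp add: smooth_fun_const)

lemma C_inf_add: "f \<in> C_inf A \<Longrightarrow> g \<in> C_inf A \<Longrightarrow> (\<lambda>q. f q + g q) \<in> C_inf A"
  by (simp add: smooth_fun_add)

lemma C_inf_mult: "f \<in> C_inf A \<Longrightarrow> g \<in> C_inf A \<Longrightarrow> (\<lambda>q. f q * g q) \<in> C_inf A"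
  by (simp add: smooth_fun_mult)

lemma C_inf_diff: "f \<in> C_inf A \<Longrightarrow> g \<in> C_inf A \<Longrightarrow> (\<lambda>q. f q - g q) \<in> C_inf A"
  using C_inf_add[OF _ C_inf_mult[OF C_inf_const[of "-1"]]] by simp

lemma smooth_fun_continuous:
  assumes "open W" "smooth_fun A W f"
  shows "continuous_on W f"
proof (intro continuous_at_imp_continuous_on ballI)
  fix p assume p: "p \<in> W"
  obtain U \<phi> where c: "(U, \<phi>) \<in> A" "p \<in> U" by (rule chartE)
  have "continuous_on (\<phi> ` (U \<inter> W)) (f \<circ> inv_into U \<phi>)"
    using assms(2) c(1) unfolding smooth_fun_def by (blast intro: smooth_on_imp_continuous)
  moreover have "continuous_on (U \<inter> W) \<phi>"
    using chart_homeomorphism[OF c(1)] by (meson Int_lower1 continuous_on_subset homeomorphism_def)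
  ultimately have "continuous_on (U \<inter> W) (\<lambda>q. (f \<circ> inv_into U \<phi>) (\<phi> q))"
    by (rule continuous_on_compose2) auto
  then have "continuous_on (U \<inter> W) f"
    by (rule continuous_on_eq) (auto simp: chart_inv[OF c(1)])
  then show "isCont f p"
    using p c continuous_on_eq_continuous_at[OF open_Int[OF chart_domain_open[OF c(1)] assms(1)]]
    by blast
qed

lemma nonzero_open:
  assumes "f \<in> C_inf A"
  shows "open {q. f q \<noteq> 0}"
  using smooth_fun_continuous[OF open_UNIV] assms
  by (auto intro!: open_Collect_neq continuous_intros)

text \<open>Extension by zero. A point outside W lies in the open set - K, where the function is 0;
  a closed K inside W is what gives this neighbourhood, as vanishing off W alone would not.\<close>

lemma smooth_fun_extend:
  assumes "open W" "open W'" "closed K" "K \<subseteq> W" "\<And>q. q \<notin> K \<Longrightarrow> \<rho> q = 0"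
    and "smooth_fun A W' \<rho>" "smooth_fun A (W \<inter> W') c"
  shows "smooth_fun A W' (\<lambda>q. if q \<in> W then \<rho> q * c q else 0)"
proof (rule smooth_fun_local)
  fix p assume p: "p \<in> W'"
  show "\<exists>T. open T \<and> p \<in> T \<and> smooth_fun A T (\<lambda>q. if q \<in> W then \<rho> q * c q else 0)"
  proof (cases "p \<in> W")
    case True
    have "smooth_fun A (W \<inter> W') (\<lambda>q. \<rho> q * c q)"
      using assms by (intro smooth_fun_mult) (auto intro: smooth_fun_subset)
    then have "smooth_fun A (W \<inter> W') (\<lambda>q. if q \<in> W then \<rho> q * c q else 0)"
      using assms(1,2) by (rule_tac smooth_fun_cong[rotated 2]) auto
    then show ?thesis using True p assms(1,2) by (intro exI[of _ "W \<inter> W'"]) auto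
  next
    case False
    have "smooth_fun A (- K) (\<lambda>q. if q \<in> W then \<rho> q * c q else 0)"
      by (rule smooth_fun_cong[OF _ _ smooth_fun_const[of _ 0]]) (use assms in auto)
    then show ?thesis using False assms(3,4) by (intro exI[of _ "- K"]) auto
  qed
qed

lemma smooth_fun_chart_compose:
  assumes c: "(U, \<phi>) \<in> A" and h: "smooth_on UNIV h"
  shows "smooth_fun A U (\<lambda>q. h (\<phi> q))"
  unfolding smooth_fun_def
proof (clarify)
  fix V \<psi> assume d: "(V, \<psi>) \<in> A"
  have "smooth_on (\<psi> ` (V \<inter> U)) (\<lambda>x. h ((\<phi> \<circ> inv_into V \<psi>) x))"
    by (rule smooth_on_compose[OF chart_image_open[OF d chart_domain_open[OF c]] open_UNIV
          subset_UNIV chart_transition[OF d c] h])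
  then show "smooth_on (\<psi> ` (V \<inter> U)) ((\<lambda>q. h (\<phi> q)) \<circ> inv_into V \<psi>)"
    by (simp add: comp_def)
qed

lemma bump:
  assumes "open W" "p \<in> W"
  obtains \<rho> K N where "\<rho> \<in> C_inf A" "closed K" "K \<subseteq> W" "\<And>q. q \<notin> K \<Longrightarrow> \<rho> q = 0"
    "open N" "p \<in> N" "N \<subseteq> W" "\<And>q. q \<in> N \<Longrightarrow> \<rho> q = 1"
proof -
  obtain U \<phi> where c: "(U, \<phi>) \<in> A" "p \<in> U" by (rule chartE)
  have "\<phi> p \<in> \<phi> ` (U \<inter> W)" using assms c by auto
  then obtain s where s: "s > 0" "cball (\<phi> p) s \<subseteq> \<phi> ` (U \<inter> W)"
    using chart_image_open[OF c(1) assms(1)] open_contains_cball by blast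
  define r where "r = s / 2"
  have r: "r > 0" "cball (\<phi> p) (2 * r) \<subseteq> \<phi> ` (U \<inter> W)" using s by (auto simp: r_def)
  obtain h :: "'e \<Rightarrow> real" where h: "smooth_on UNIV h" "\<And>x. x \<in> ball (\<phi> p) r \<Longrightarrow> h x = 1"
    "\<And>x. x \<notin> cball (\<phi> p) (2 * r) \<Longrightarrow> h x = 0"
    by (rule euclidean_bump[OF r(1), of "\<phi> p"]) (rule that)
  define \<rho> where "\<rho> q = (if q \<in> U then h (\<phi> q) else 0)" for q
  define K where "K = inv_into U \<phi> ` cball (\<phi> p) (2 * r)"
  define N where "N = U \<inter> \<phi> -` ball (\<phi> p) r"
  have "cball (\<phi> p) (2 * r) \<subseteq> \<phi> ` U" using r(2) by auto
  then have "continuous_on (cball (\<phi> p) (2 * r)) (inv_into U \<phi>)"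
    using chart_homeomorphism[OF c(1)] by (meson continuous_on_subset homeomorphism_def)
  \<comment> \<open>Closed in the whole manifold and not merely in U: K is compact and the space is
    Hausdorff.\<close>
  then have K: "closed K" unfolding K_def
    by (intro compact_imp_closed compact_continuous_image) auto
  have KW: "K \<subseteq> U \<inter> W" using r(2) chart_inv[OF c(1)] unfolding K_def by fastforce
  have K0: "\<rho> q = 0" if "q \<notin> K" for q
  proof (cases "q \<in> U")
    case True
    then have "\<phi> q \<notin> cball (\<phi> p) (2 * r)" using that chart_inv[OF c(1)] unfolding K_def by (metis imageI)
    then show ?thesis using h(3) by (simp add: \<rho>_def)
  qed (simp add: \<rho>_def)
  have "smooth_fun A UNIV \<rho>"
  proof (rule smooth_fun_local)
    fix q
    have "smooth_fun A U \<rho>"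
      by (rule smooth_fun_cong[OF chart_domain_open[OF c(1)] _ smooth_fun_chart_compose[OF c(1) h(1)]])
        (simp add: \<rho>_def)
    moreover have "smooth_fun A (- K) \<rho>"
      by (rule smooth_fun_cong[OF _ _ smooth_fun_const[of _ 0]]) (use K K0 in auto)
    ultimately show "\<exists>T. open T \<and> q \<in> T \<and> smooth_fun A T \<rho>"
      using chart_domain_open[OF c(1)] K KW by (cases "q \<in> U") blast+
  qed
  moreover have "open N" unfolding N_def by (rule chart_preimage_open[OF c(1)]) auto
  moreover have "p \<in> N" using c r by (simp add: N_def)
  moreover have "\<rho> q = 1" if "q \<in> N" for q using that h(2) by (auto simp: N_def \<rho>_def)
  moreover have "N \<subseteq> K" using \<open>\<And>q. q \<in> N \<Longrightarrow> \<rho> q = 1\<close> K0 by fastforce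
  ultimately show ?thesis using that[of \<rho> K N] K KW K0 by blast
qed

text \<open>The form of \<open>bump\<close> for products in which the other factor is already a
  global object, so that the support has no role in proving smoothness.\<close>

lemma cutoff:
  assumes "open W" "p \<in> W"
  obtains \<rho> N where "\<rho> \<in> C_inf A" "\<And>q. q \<notin> W \<Longrightarrow> \<rho> q = 0"
    "open N" "p \<in> N" "N \<subseteq> W" "\<And>q. q \<in> N \<Longrightarrow> \<rho> q = 1"
proof -
  obtain \<rho> K N where \<rho>: "\<rho> \<in> C_inf A" "closed K" "K \<subseteq> W" "\<And>q. q \<notin> K \<Longrightarrow> \<rho> q = 0"
    "open N" "p \<in> N" "N \<subseteq> W" "\<And>q. q \<in> N \<Longrightarrow> \<rho> q = 1"
    by (rule bump[OF assms]) (rule that)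
  show ?thesis by (rule that[of \<rho> N]) (use \<rho> in auto)
qed

section \<open>Tangent vectors: locality and existence\<close>

lemma tangentD:
  assumes "v \<in> tangent_space A p" "f \<in> C_inf A" "g \<in> C_inf A"
  shows tangent_add: "v (\<lambda>q. f q + g q) = v f + v g"
    and tangent_cmult: "v (\<lambda>q. c * f q) = c * v f"
    and tangent_mult: "v (\<lambda>q. f q * g q) = v f * g p + f p * v g"
  using assms unfolding tangent_space_def by blast+

lemma tangent_zero:
  assumes "v \<in> tangent_space A p"
  shows "v (\<lambda>q. 0) = 0"
  using tangent_cmult[OF assms C_inf_const C_inf_const, of 0 0] by simp

lemma tangent_diff:
  assumes v: "v \<in> tangent_space A p" and f: "f \<in> C_inf A" "g \<in> C_inf A"
  shows "v (\<lambda>q. f q - g q) = v f - v g"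
  using tangent_add[OF v f(1) C_inf_mult[OF C_inf_const f(2)], of "-1"] tangent_cmult[OF v f(2,2), of "-1"]
  by simp

text \<open>With a cutoff \<rho> supported in N, f - g = (1 - \<rho>) (f - g) holds globally, and
  both factors vanish at p; the Leibniz rule then gives 0.\<close>

lemma tangent_local:
  assumes v: "v \<in> tangent_space A p" and f: "f \<in> C_inf A" "g \<in> C_inf A"
    and N: "open N" "p \<in> N" "\<And>q. q \<in> N \<Longrightarrow> f q = g q"
  shows "v f = v g"
proof -
  obtain \<rho> N' where \<rho>: "\<rho> \<in> C_inf A" "\<And>q. q \<notin> N \<Longrightarrow> \<rho> q = 0"
    "open N'" "p \<in> N'" "N' \<subseteq> N" "\<And>q. q \<in> N' \<Longrightarrow> \<rho> q = 1"
    by (rule cutoff[OF N(1,2)]) (rule that)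
  have fg: "(\<lambda>q. f q - g q) \<in> C_inf A" by (rule C_inf_diff[OF f])
  have 1: "(\<lambda>q. 1 - \<rho> q) \<in> C_inf A" by (rule C_inf_diff[OF C_inf_const \<rho>(1)])
  have "(\<lambda>q. f q - g q) = (\<lambda>q. (1 - \<rho> q) * (f q - g q))"
    using \<rho>(2) N(3) by fastforce
  then have "v (\<lambda>q. f q - g q) = 0"
    using tangent_mult[OF v 1 fg] \<rho>(4,6) N(2,3) by simp
  then show ?thesis using tangent_diff[OF v f] by simp
qed

text \<open>The vector v is a partial derivative in a chart and f the matching coordinate, cut off
  to be global, so that v f = 1. A basis direction exists because the model space has positive
  dimension.\<close>

lemma tangent_space_nontrivial:
  obtains f v where "f \<in> C_inf A" "v \<in> tangent_space A p" "v f \<noteq> 0"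
proof -
  obtain U \<phi> where c: "(U, \<phi>) \<in> A" "p \<in> U" by (rule chartE)
  obtain b :: 'e where b: "b \<in> Basis" using nonempty_Basis by blast
  obtain \<rho> K N where \<rho>: "\<rho> \<in> C_inf A" "closed K" "K \<subseteq> U" "\<And>q. q \<notin> K \<Longrightarrow> \<rho> q = 0"
    "open N" "p \<in> N" "N \<subseteq> U" "\<And>q. q \<in> N \<Longrightarrow> \<rho> q = 1"
    by (rule bump[OF chart_domain_open[OF c(1)] c(2)]) (rule that)
  define f where "f q = (if q \<in> U then \<rho> q * (\<phi> q \<bullet> b) else 0)" for q
  define v where "v g = (if g \<in> C_inf A then
      frechet_derivative (g \<circ> inv_into U \<phi>) (at (\<phi> p)) b else 0)" for g
  have f: "f \<in> C_inf A" unfolding f_def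
    using smooth_fun_extend[OF chart_domain_open[OF c(1)] open_UNIV \<rho>(2,3,4),
      where c = "\<lambda>q. \<phi> q \<bullet> b"] \<rho>(1) smooth_fun_chart_compose[OF c(1) smooth_on_inner[OF open_UNIV, of b]]
    by simp
  have d: "((g \<circ> inv_into U \<phi>) has_derivative frechet_derivative (g \<circ> inv_into U \<phi>) (at (\<phi> p)))
      (at (\<phi> p))" if "g \<in> C_inf A" for g
    unfolding frechet_derivative_works[symmetric]
    by (rule smooth_on_imp_differentiable[of "\<phi> ` (U \<inter> UNIV)"])
      (use that c in \<open>auto simp: smooth_fun_def\<close>)
  have inv: "inv_into U \<phi> (\<phi> p) = p" using chart_inv c by blast
  have "v \<in> tangent_space A p" unfolding tangent_space_def
  proof (clarify, intro conjI ballI allI impI)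
    fix g h assume gh: "g \<in> C_inf A" "h \<in> C_inf A"
    have "((\<lambda>q. g q + h q) \<circ> inv_into U \<phi> has_derivative
        (\<lambda>w. frechet_derivative (g \<circ> inv_into U \<phi>) (at (\<phi> p)) w
           + frechet_derivative (h \<circ> inv_into U \<phi>) (at (\<phi> p)) w)) (at (\<phi> p))"
      using has_derivative_add[OF d[OF gh(1)] d[OF gh(2)]] by (simp add: comp_def)
    from frechet_derivative_at[OF this]
    show "v (\<lambda>q. g q + h q) = v g + v h"
      using gh C_inf_add[OF gh] by (simp add: v_def fun_eq_iff del: mem_Collect_eq)
    have "((\<lambda>q. g q * h q) \<circ> inv_into U \<phi> has_derivative
        (\<lambda>w. frechet_derivative (g \<circ> inv_into U \<phi>) (at (\<phi> p)) w * h p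
           + g p * frechet_derivative (h \<circ> inv_into U \<phi>) (at (\<phi> p)) w)) (at (\<phi> p))"
      using has_derivative_mult[OF d[OF gh(1)] d[OF gh(2)]] by (simp add: comp_def inv add.commute)
    from frechet_derivative_at[OF this]
    show "v (\<lambda>q. g q * h q) = v g * h p + g p * v h"
      using gh C_inf_mult[OF gh] by (simp add: v_def fun_eq_iff del: mem_Collect_eq)
  next
    fix a g assume g: "g \<in> C_inf A"
    have "((\<lambda>q. a * g q) \<circ> inv_into U \<phi> has_derivative
        (\<lambda>w. a * frechet_derivative (g \<circ> inv_into U \<phi>) (at (\<phi> p)) w)) (at (\<phi> p))"
      using has_derivative_mult_right[OF d[OF g]] by (simp add: comp_def)
    from frechet_derivative_at[OF this]
    show "v (\<lambda>q. a * g q) = a * v g"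
      using g C_inf_mult[OF C_inf_const g] by (simp add: v_def fun_eq_iff del: mem_Collect_eq)
  qed (simp add: v_def)
  moreover have "v f = 1"
  proof -
    have "((\<lambda>x. x \<bullet> b) has_derivative (\<lambda>w. w \<bullet> b)) (at (\<phi> p))"
      by (intro derivative_intros)
    moreover have "open (\<phi> ` (U \<inter> N))" "\<phi> p \<in> \<phi> ` (U \<inter> N)"
      using chart_image_open[OF c(1) \<rho>(5)] c(2) \<rho>(6) by auto
    moreover have "x \<bullet> b = (f \<circ> inv_into U \<phi>) x" if "x \<in> \<phi> ` (U \<inter> N)" for x
      using that \<rho>(8) by (auto simp: f_def chart_inv[OF c(1)])
    ultimately have "((f \<circ> inv_into U \<phi>) has_derivative (\<lambda>w. w \<bullet> b)) (at (\<phi> p))"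
      by (rule has_derivative_transform_within_open)
    from frechet_derivative_at[OF this] have "frechet_derivative (f \<circ> inv_into U \<phi>) (at (\<phi> p)) = (\<lambda>w. w \<bullet> b)"
      by simp
    then show ?thesis using f b by (simp add: v_def)
  qed
  ultimately show ?thesis using that f by simp
qed

end

section \<open>Sections of vector bundles\<close>

text \<open>\<open>independent\<close> speaks of sets, frames are indexed families; injectivity of e
  translates between the two.\<close>

lemma frame_coeff_zero:
  fixes e :: "nat \<Rightarrow> 'v::real_vector"
  assumes "inj_on e {..<k}" "independent (e ` {..<k})" "(\<Sum>i<k. a i *\<^sub>R e i) = 0" "i < k"
  shows "a i = 0"
proof -
  have "(\<Sum>x\<in>e ` {..<k}. a (inv_into {..<k} e x) *\<^sub>R x) = (\<Sum>i<k. a i *\<^sub>R e i)"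
    using assms(1) by (simp add: sum.reindex)
  then have "a (inv_into {..<k} e (e i)) = 0"
    by (intro independentD[OF assms(2), of "e ` {..<k}" "\<lambda>x. a (inv_into {..<k} e x)"])
      (use assms in auto)
  then show ?thesis using assms by simp
qed

lemma frame_coeff_unique:
  fixes e :: "nat \<Rightarrow> 'v::real_vector"
  assumes "inj_on e {..<k}" "independent (e ` {..<k})"
    and "(\<Sum>i<k. a i *\<^sub>R e i) = (\<Sum>i<k. b i *\<^sub>R e i)" "i < k"
  shows "a i = b i"
  using frame_coeff_zero[OF assms(1,2), of "\<lambda>i. a i - b i" i] assms(3,4)
  by (simp add: scaleR_diff_left sum_subtractf)

lemma span_frame:
  fixes e :: "nat \<Rightarrow> 'v::real_vector"
  assumes "inj_on e {..<k}" "x \<in> span (e ` {..<k})"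
  obtains a where "x = (\<Sum>i<k. a i *\<^sub>R e i)"
proof -
  obtain u where "x = (\<Sum>y\<in>e ` {..<k}. u y *\<^sub>R y)"
    using assms(2) span_finite[of "e ` {..<k}"] by auto
  then show ?thesis using that[of "\<lambda>i. u (e i)"] assms(1) by (simp add: sum.reindex)
qed

locale smooth_bundle = manifold A
  for A :: "('m::{t2_space, second_countable_topology}, 'e::euclidean_space) atlas" +
  fixes B :: "('m, 'v::real_vector, 'z) vbundle_scheme"
  assumes vector_bundle: "vector_bundle A B"
begin

lemma atlasE:
  obtains k F where "bundle_atlas A k (fibre B) F"
    "sections B = {s. (\<forall>p. s p \<in> fibre B p) \<and> (\<forall>(W, e)\<in>F. smooth_combination A W k e s)}"
  using vector_bundle unfolding vector_bundle_def by blast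

lemma bundle_frameE:
  assumes "bundle_atlas A k (fibre B) F"
  obtains W e where "(W, e) \<in> F" "p \<in> W"
proof -
  have "p \<in> (\<Union>(W, e)\<in>F. W)" using assms by (simp add: bundle_atlas_def)
  then show ?thesis using that by blast
qed

lemma bundle_atlasD:
  assumes "bundle_atlas A k (fibre B) F" "(W, e) \<in> F"
  shows "open W" "pointwise_basis (fibre B) W k e"
    "(W', e') \<in> F \<Longrightarrow> j < k \<Longrightarrow> smooth_combination A (W \<inter> W') k e (e' j)"
  using assms unfolding bundle_atlas_def by blast+

lemma fibre_finite_span:
  obtains S where "finite S" "fibre B p = span S"
proof -
  obtain k F where F: "bundle_atlas A k (fibre B) F" by (rule atlasE)
  obtain W e where "(W, e) \<in> F" "p \<in> W" by (rule bundle_frameE[OF F])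
  then have "fibre B p = span ((\<lambda>i. e i p) ` {..<k})"
    using bundle_atlasD(2)[OF F] by (auto simp: pointwise_basis_def)
  then show ?thesis using that[of "(\<lambda>i. e i p) ` {..<k}"] by simp
qed

lemma subspace_fibre: "subspace (fibre B p)"
  using fibre_finite_span[of p] by (metis subspace_span)

lemmas fibre_zero = subspace_0[OF subspace_fibre]
  and fibre_add = subspace_add[OF subspace_fibre]
  and fibre_diff = subspace_diff[OF subspace_fibre]
  and fibre_scale = subspace_scale[OF subspace_fibre]
  and fibre_sum = subspace_sum[OF subspace_fibre]

lemma section_fibre: "s \<in> sections B \<Longrightarrow> s p \<in> fibre B p"
  by (rule atlasE) blast

lemma section_add:
  assumes "s \<in> sections B" "t \<in> sections B"
  shows "(\<lambda>q. s q + t q) \<in> sections B"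
proof -
  obtain k F where F: "bundle_atlas A k (fibre B) F"
    "sections B = {s. (\<forall>p. s p \<in> fibre B p) \<and> (\<forall>(W, e)\<in>F. smooth_combination A W k e s)}"
    by (rule atlasE)
  have "smooth_combination A W k e (\<lambda>q. s q + t q)" if "(W, e) \<in> F" for W e
  proof -
    have "smooth_combination A W k e s" "smooth_combination A W k e t"
      using assms F(2) that by auto
    then obtain c d where "\<And>i. i < k \<Longrightarrow> smooth_fun A W (c i)" "\<And>i. i < k \<Longrightarrow> smooth_fun A W (d i)"
      "\<And>q. q \<in> W \<Longrightarrow> s q = (\<Sum>i<k. c i q *\<^sub>R e i q)" "\<And>q. q \<in> W \<Longrightarrow> t q = (\<Sum>i<k. d i q *\<^sub>R e i q)"
      unfolding smooth_combination_def by blast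
    then show ?thesis unfolding smooth_combination_def
      using bundle_atlasD(1)[OF F(1) that]
      by (intro exI[of _ "\<lambda>i q. c i q + d i q"])
        (auto simp: sum.distrib scaleR_add_left intro: smooth_fun_add)
  qed
  then show ?thesis using section_fibre[OF assms(1)] section_fibre[OF assms(2)]
    unfolding F(2) by (auto intro: fibre_add)
qed

lemma section_scale:
  assumes "f \<in> C_inf A" "s \<in> sections B"
  shows "(\<lambda>q. f q *\<^sub>R s q) \<in> sections B"
proof -
  obtain k F where F: "bundle_atlas A k (fibre B) F"
    "sections B = {s. (\<forall>p. s p \<in> fibre B p) \<and> (\<forall>(W, e)\<in>F. smooth_combination A W k e s)}"
    by (rule atlasE)
  have "smooth_combination A W k e (\<lambda>q. f q *\<^sub>R s q)" if "(W, e) \<in> F" for W e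
  proof -
    have "smooth_combination A W k e s" using assms F(2) that by auto
    then obtain c where "\<And>i. i < k \<Longrightarrow> smooth_fun A W (c i)"
      "\<And>q. q \<in> W \<Longrightarrow> s q = (\<Sum>i<k. c i q *\<^sub>R e i q)"
      unfolding smooth_combination_def by blast
    then show ?thesis unfolding smooth_combination_def
      using bundle_atlasD(1)[OF F(1) that] assms(1)
      by (intro exI[of _ "\<lambda>i q. f q * c i q"])
        (auto simp: scaleR_sum_right intro!: smooth_fun_mult intro: smooth_fun_subset)
  qed
  then show ?thesis using section_fibre[OF assms(2)] unfolding F(2) by (auto intro: fibre_scale)
qed

text \<open>The local representatives t have smooth coefficients in each frame of the atlas. As the
  frame is independent at every point, coefficients are unique, so the ones chosen pointwise for s
  coincide with those of t near each point and inherit smoothness.\<close>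

lemma section_local:
  assumes "\<And>p. \<exists>N t. open N \<and> p \<in> N \<and> t \<in> sections B \<and> (\<forall>q\<in>N. s q = t q)"
  shows "s \<in> sections B"
proof -
  obtain k F where F: "bundle_atlas A k (fibre B) F"
    "sections B = {s. (\<forall>p. s p \<in> fibre B p) \<and> (\<forall>(W, e)\<in>F. smooth_combination A W k e s)}"
    by (rule atlasE)
  have "smooth_combination A W k e s" if W: "(W, e) \<in> F" for W e
  proof -
    have loc: "\<exists>N c. open N \<and> p \<in> N \<and> N \<subseteq> W \<and> (\<forall>i<k. smooth_fun A N (c i)) \<and>
        (\<forall>q\<in>N. s q = (\<Sum>i<k. c i q *\<^sub>R e i q))" if "p \<in> W" for p
    proof -
      obtain N t where t: "open N" "p \<in> N" "t \<in> sections B" "\<forall>q\<in>N. s q = t q"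
        using assms[of p] by (elim exE conjE) (rule that)
      then have "smooth_combination A W k e t" using F(2) W by auto
      then obtain c where "\<And>i. i < k \<Longrightarrow> smooth_fun A W (c i)"
        "\<And>q. q \<in> W \<Longrightarrow> t q = (\<Sum>i<k. c i q *\<^sub>R e i q)"
        unfolding smooth_combination_def by blast
      then show ?thesis using t that bundle_atlasD(1)[OF F(1) W]
        by (intro exI[of _ "N \<inter> W"] exI[of _ c]) (auto intro: smooth_fun_subset)
    qed
    have "\<forall>p\<in>W. \<exists>a. s p = (\<Sum>i<k. a i *\<^sub>R e i p)"
    proof
      fix p assume "p \<in> W"
      from loc[OF this] obtain c :: "nat \<Rightarrow> 'm \<Rightarrow> real" where "s p = (\<Sum>i<k. c i p *\<^sub>R e i p)"
        by blast
      then show "\<exists>a. s p = (\<Sum>i<k. a i *\<^sub>R e i p)" by (rule exI[of _ "\<lambda>i. c i p"])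
    qed
    from bchoice[OF this] obtain a where a: "\<And>p. p \<in> W \<Longrightarrow> s p = (\<Sum>i<k. a p i *\<^sub>R e i p)"
      by blast
    have "smooth_fun A W (\<lambda>q. a q i)" if "i < k" for i
    proof (rule smooth_fun_local)
      fix p assume "p \<in> W"
      then obtain N c where N: "open N" "p \<in> N" "N \<subseteq> W" "\<And>i. i < k \<Longrightarrow> smooth_fun A N (c i)"
        "\<And>q. q \<in> N \<Longrightarrow> s q = (\<Sum>i<k. c i q *\<^sub>R e i q)"
        using loc[OF \<open>p \<in> W\<close>] by blast
      have "c i q = a q i" if "q \<in> N" for q
      proof (rule frame_coeff_unique[of "\<lambda>i. e i q"])
        show "(\<Sum>i<k. c i q *\<^sub>R e i q) = (\<Sum>i<k. a q i *\<^sub>R e i q)"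
          using N(3,5) a that by (metis subsetD)
      qed (use bundle_atlasD(2)[OF F(1) W] N(3) that \<open>i < k\<close> in \<open>auto simp: pointwise_basis_def\<close>)
      then have "smooth_fun A N (\<lambda>q. a q i)"
        by (rule smooth_fun_cong[OF N(1) _ N(4)[OF \<open>i < k\<close>]])
      then show "\<exists>T. open T \<and> p \<in> T \<and> smooth_fun A T (\<lambda>q. a q i)"
        using N(1,2) by (intro exI[of _ N] conjI)
    qed
    then show ?thesis unfolding smooth_combination_def
      using a by (intro exI[of _ "\<lambda>i q. a q i"]) auto
  qed
  moreover have "s p \<in> fibre B p" for p
  proof -
    obtain N t where "p \<in> N" "t \<in> sections B" "\<forall>q\<in>N. s q = t q" using assms[of p] by blast
    then show ?thesis using section_fibre[of t p] by simp
  qed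
  ultimately show ?thesis unfolding F(2) by auto
qed

text \<open>In contrast to the frames of a bundle atlas, both the E i and the coefficients are
  global; they form a basis and represent s on N only. This is the form to which global operations
  such as \<open>section_sum\<close> can be applied.\<close>

definition frame :: "'m set \<Rightarrow> nat \<Rightarrow> (nat \<Rightarrow> 'm \<Rightarrow> 'v) \<Rightarrow> bool" where
  "frame N k E \<longleftrightarrow> open N \<and> (\<forall>i<k. E i \<in> sections B) \<and> pointwise_basis (fibre B) N k E \<and>
     (\<forall>s\<in>sections B. \<exists>c. (\<forall>i<k. c i \<in> C_inf A) \<and> (\<forall>q\<in>N. s q = (\<Sum>i<k. c i q *\<^sub>R E i q)))"

lemma frameD:
  assumes "frame N k E"
  shows "open N" "i < k \<Longrightarrow> E i \<in> sections B"
    "q \<in> N \<Longrightarrow> inj_on (\<lambda>i. E i q) {..<k}"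
    "q \<in> N \<Longrightarrow> independent ((\<lambda>i. E i q) ` {..<k})"
    "q \<in> N \<Longrightarrow> span ((\<lambda>i. E i q) ` {..<k}) = fibre B q"
    "s \<in> sections B \<Longrightarrow>
        \<exists>c. (\<forall>i<k. c i \<in> C_inf A) \<and> (\<forall>q\<in>N. s q = (\<Sum>i<k. c i q *\<^sub>R E i q))"
  using assms unfolding frame_def pointwise_basis_def by blast+

text \<open>An atlas frame is multiplied by a bump function and extended by zero; on N, where the
  bump function is 1, nothing changes. The coefficients of a section are globalised in the same
  way.\<close>

lemma local_frame:
  obtains N k E where "p \<in> N" "frame N k E"
proof -
  obtain k F where F: "bundle_atlas A k (fibre B) F"
    "sections B = {s. (\<forall>p. s p \<in> fibre B p) \<and> (\<forall>(W, e)\<in>F. smooth_combination A W k e s)}"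
    by (rule atlasE)
  obtain W e where W: "(W, e) \<in> F" "p \<in> W" by (rule bundle_frameE[OF F(1)])
  note oW = bundle_atlasD(1)[OF F(1) W(1)]
  have basis: "inj_on (\<lambda>i. e i q) {..<k}" "independent ((\<lambda>i. e i q) ` {..<k})"
    "span ((\<lambda>i. e i q) ` {..<k}) = fibre B q" if "q \<in> W" for q
    using bundle_atlasD(2)[OF F(1) W(1)] that by (auto simp: pointwise_basis_def)
  obtain \<rho> K N where \<rho>: "\<rho> \<in> C_inf A" "closed K" "K \<subseteq> W" "\<And>q. q \<notin> K \<Longrightarrow> \<rho> q = 0"
    "open N" "p \<in> N" "N \<subseteq> W" "\<And>q. q \<in> N \<Longrightarrow> \<rho> q = 1"
    by (rule bump[OF oW W(2)]) (rule that)
  have ext: "smooth_fun A W' (\<lambda>q. if q \<in> W then \<rho> q * c q else 0)"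
    if "open W'" "smooth_fun A (W \<inter> W') c" for W' c
    by (rule smooth_fun_extend[OF oW that(1) \<rho>(2,3,4) _ that(2)])
      (use \<rho>(1) in \<open>auto intro: smooth_fun_subset\<close>)
  define E where "E i q = (if q \<in> W then \<rho> q *\<^sub>R e i q else 0)" for i q
  have E: "E i q = e i q" if "q \<in> N" for i q using that \<rho>(7,8) by (auto simp: E_def)
  have "E i \<in> sections B" if i: "i < k" for i
  proof -
    have "e i q \<in> fibre B q" if "q \<in> W" for q 
      using span_base[of "e i q" "(\<lambda>i. e i q) ` {..<k}"] basis(3)[OF that] i by simp
    then have "E i q \<in> fibre B q" for q by (simp add: E_def fibre_scale fibre_zero)
    moreover have "smooth_combination A W' k e' (E i)" if W': "(W', e') \<in> F" for W' e'
    proof -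
      obtain c where c: "\<And>j. j < k \<Longrightarrow> smooth_fun A (W' \<inter> W) (c j)"
        "\<And>q. q \<in> W' \<inter> W \<Longrightarrow> e i q = (\<Sum>j<k. c j q *\<^sub>R e' j q)"
        using bundle_atlasD(3)[OF F(1) W' W(1) i] unfolding smooth_combination_def by blast
      then show ?thesis unfolding smooth_combination_def
        using ext[OF bundle_atlasD(1)[OF F(1) W']]
        \<comment> \<open>In another frame of the atlas the coefficients are transition functions,
          known only on the overlap; they are cut off as well.\<close>
        by (intro exI[of _ "\<lambda>j q. if q \<in> W then \<rho> q * c j q else 0"])
          (auto simp: E_def scaleR_sum_right Int_commute)
    qed
    ultimately show ?thesis unfolding F(2) by auto
  qed
  moreover have "\<exists>c. (\<forall>i<k. c i \<in> C_inf A) \<and> (\<forall>q\<in>N. s q = (\<Sum>i<k. c i q *\<^sub>R E i q))"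
    if s: "s \<in> sections B" for s
  proof -
    have "smooth_combination A W k e s" using s W(1) unfolding F(2) by auto
    then obtain c where "\<And>i. i < k \<Longrightarrow> smooth_fun A W (c i)"
      "\<And>q. q \<in> W \<Longrightarrow> s q = (\<Sum>i<k. c i q *\<^sub>R e i q)"
      unfolding smooth_combination_def by blast
    then show ?thesis using ext[OF open_UNIV] \<rho>(7,8)
      by (intro exI[of _ "\<lambda>i q. if q \<in> W then \<rho> q * c i q else 0"]) (simp add: E subset_iff)
  qed
  moreover have "pointwise_basis (fibre B) N k E"
    unfolding pointwise_basis_def using basis \<rho>(7) by (simp add: E subset_iff)
  ultimately have "frame N k E" unfolding frame_def using \<rho>(5) by (intro conjI ballI allI impI)
  then show ?thesis using that \<rho>(6) by (rule_tac that)
qed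

lemma section_zero: "(\<lambda>q. 0) \<in> sections B"
proof -
  obtain k F where F: "bundle_atlas A k (fibre B) F"
    "sections B = {s. (\<forall>p. s p \<in> fibre B p) \<and> (\<forall>(W, e)\<in>F. smooth_combination A W k e s)}"
    by (rule atlasE)
  have "smooth_combination A W k e (\<lambda>q. 0)" if "(W, e) \<in> F" for W e
    using smooth_fun_const[OF bundle_atlasD(1)[OF F(1) that], of 0]
    unfolding smooth_combination_def by (intro exI[of _ "\<lambda>i q. 0"]) auto
  then show ?thesis unfolding F(2) by (auto simp: fibre_zero)
qed

lemma section_sum:
  assumes "\<And>i. i \<in> I \<Longrightarrow> s i \<in> sections B"
  shows "(\<lambda>q. \<Sum>i\<in>I. s i q) \<in> sections B"
  using assms
  by (induction I rule: infinite_finite_induct) (auto intro: section_add section_zero)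

lemma section_diff:
  assumes "s \<in> sections B" "t \<in> sections B"
  shows "(\<lambda>q. s q - t q) \<in> sections B"
  using section_add[OF assms(1) section_scale[OF C_inf_const assms(2)], of "-1"] by simp

lemma section_through:
  assumes "x \<in> fibre B p"
  obtains s where "s \<in> sections B" "s p = x"
proof -
  obtain N k E where p: "p \<in> N" and E: "frame N k E" by (rule local_frame)
  note E = frameD[OF E]
  obtain a where "x = (\<Sum>i<k. a i *\<^sub>R E i p)"
    using span_frame[OF E(3)[OF p], of x] assms E(5)[OF p] by metis
  moreover have "(\<lambda>q. \<Sum>i<k. a i *\<^sub>R E i q) \<in> sections B"
    by (intro section_sum section_scale[OF C_inf_const] E(2)) auto
  ultimately show ?thesis using that by blast
qed

text \<open>The function \<open>1 - \<rho>\<close> with the coefficient \<open>s\<close> itself makes the decomposition global.\<close>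

lemma vanishing_section:
  assumes s: "s \<in> sections B" and "s p = 0"
  obtains n f E where "\<And>i. i < n \<Longrightarrow> f i \<in> C_inf A" "\<And>i. i < n \<Longrightarrow> f i p = 0"
    "\<And>i. i < n \<Longrightarrow> E i \<in> sections B" "s = (\<lambda>q. \<Sum>i<(n::nat). f i q *\<^sub>R E i q)"
proof -
  obtain N k E where p: "p \<in> N" and E: "frame N k E" by (rule local_frame)
  note E = frameD[OF E]
  obtain c where c: "\<And>i. i < k \<Longrightarrow> c i \<in> C_inf A" "\<And>q. q \<in> N \<Longrightarrow> s q = (\<Sum>i<k. c i q *\<^sub>R E i q)"
    using E(6)[OF s] by blast
  obtain \<rho> N' where \<rho>: "\<rho> \<in> C_inf A" "\<And>q. q \<notin> N \<Longrightarrow> \<rho> q = 0"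
    "open N'" "p \<in> N'" "N' \<subseteq> N" "\<And>q. q \<in> N' \<Longrightarrow> \<rho> q = 1"
    by (rule cutoff[OF E(1) p]) (rule that)
  have c0: "c i p = 0" if "i < k" for i
    using frame_coeff_zero[OF E(3,4)[OF p], of "\<lambda>i. c i p"] c(2)[OF p] assms(2) that by simp
  define f where "f i q = (if i < k then \<rho> q * c i q else 1 - \<rho> q)" for i q
  define E' where "E' i = (if i < k then E i else s)" for i
  have s_eq: "s q = (\<Sum>i<Suc k. f i q *\<^sub>R E' i q)" for q
  proof -
    have "(\<Sum>i<k. f i q *\<^sub>R E' i q) = \<rho> q *\<^sub>R (\<Sum>i<k. c i q *\<^sub>R E i q)"
      by (simp add: f_def E'_def scaleR_sum_right)
    also have "\<dots> = \<rho> q *\<^sub>R s q" using c(2) \<rho>(2) by (cases "q \<in> N") auto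
    finally show ?thesis by (simp add: f_def E'_def scaleR_diff_left)
  qed
  show ?thesis
  proof (rule that[of "Suc k" f E'])
    show "f i \<in> C_inf A" if "i < Suc k" for i
      unfolding f_def using C_inf_mult[OF \<rho>(1) c(1)] C_inf_diff[OF C_inf_const \<rho>(1)]
      by (cases "i < k") auto
    show "f i p = 0" if "i < Suc k" for i using c0 \<rho>(4,6) by (simp add: f_def)
    show "E' i \<in> sections B" if "i < Suc k" for i using E(2) s by (simp add: E'_def)
    show "s = (\<lambda>q. \<Sum>i<Suc k. f i q *\<^sub>R E' i q)" using s_eq by (rule ext)
  qed
qed


subsection \<open>Dual sections\<close>

lemma dualD:
  assumes "\<alpha> \<in> dual_sections A B"
  shows dual_add: "x \<in> fibre B p \<Longrightarrow> y \<in> fibre B p \<Longrightarrow> \<alpha> p (x + y) = \<alpha> p x + \<alpha> p y"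
    and dual_scale: "x \<in> fibre B p \<Longrightarrow> \<alpha> p (c *\<^sub>R x) = c * \<alpha> p x"
    and dual_smooth: "s \<in> sections B \<Longrightarrow> (\<lambda>q. \<alpha> q (s q)) \<in> C_inf A"
  using assms unfolding dual_sections_def linear_between_def by auto

lemma dual_zero: "\<alpha> \<in> dual_sections A B \<Longrightarrow> \<alpha> p 0 = 0"
  using dual_scale[OF _ fibre_zero, of \<alpha> p 0] by simp

lemma dual_sum:
  assumes "\<alpha> \<in> dual_sections A B" "\<And>i. i \<in> I \<Longrightarrow> x i \<in> fibre B p"
  shows "\<alpha> p (\<Sum>i\<in>I. x i) = (\<Sum>i\<in>I. \<alpha> p (x i))"
  using assms(2)
  by (induction I rule: infinite_finite_induct)
    (auto simp: dual_zero[OF assms(1)] dual_add[OF assms(1)] fibre_sum)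

lemma dual_scale_fun:
  assumes "f \<in> C_inf A" "\<alpha> \<in> dual_sections A B"
  shows "(\<lambda>q x. f q * \<alpha> q x) \<in> dual_sections A B"
  using C_inf_mult[OF assms(1) dual_smooth[OF assms(2)]] assms(2)
  unfolding dual_sections_def linear_between_def by (auto simp: algebra_simps)

lemma dual_diff:
  assumes "\<alpha> \<in> dual_sections A B" "\<beta> \<in> dual_sections A B"
  shows "(\<lambda>q x. \<alpha> q x - \<beta> q x) \<in> dual_sections A B"
  using C_inf_diff[OF dual_smooth[OF assms(1)] dual_smooth[OF assms(2)]] assms
  unfolding dual_sections_def linear_between_def by (auto simp: algebra_simps)

text \<open>\<alpha> is a cut-off coordinate function of a local frame, for an index at which x has
  a nonzero coordinate. It is linear because coordinates are unique, and smooth on a section because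
  the coefficients of that section are.\<close>

lemma dual_separates:
  assumes "x \<in> fibre B p" "x \<noteq> 0"
  obtains \<alpha> where "\<alpha> \<in> dual_sections A B" "\<alpha> p x \<noteq> 0"
proof -
  obtain N k E where p: "p \<in> N" and E: "frame N k E" by (rule local_frame)
  note E = frameD[OF E]
  obtain \<rho> N' where \<rho>: "\<rho> \<in> C_inf A" "\<And>q. q \<notin> N \<Longrightarrow> \<rho> q = 0"
    "open N'" "p \<in> N'" "N' \<subseteq> N" "\<And>q. q \<in> N' \<Longrightarrow> \<rho> q = 1"
    by (rule cutoff[OF E(1) p]) (rule that)
  have "\<exists>a. y = (\<Sum>i<k. a i *\<^sub>R E i q)" if "q \<in> N" "y \<in> fibre B q" for q y
    using span_frame[OF E(3)[OF that(1)], of y] E(5)[OF that(1)] that(2) by metis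
  then obtain a where a: "\<And>q y. q \<in> N \<Longrightarrow> y \<in> fibre B q \<Longrightarrow> y = (\<Sum>i<k. a q y i *\<^sub>R E i q)"
    by metis
  have a_eq: "a q y i = b i"
    if "q \<in> N" "y \<in> fibre B q" "y = (\<Sum>i<k. b i *\<^sub>R E i q)" "i < k" for q y b i
    by (rule frame_coeff_unique[OF E(3,4)[OF that(1)] _ that(4)]) (use a that in metis)
  have "\<exists>i<k. a p x i \<noteq> 0"
  proof (rule ccontr)
    assume "\<not> ?thesis"
    then have "(\<Sum>i<k. a p x i *\<^sub>R E i p) = 0" by (intro sum.neutral) auto
    then show False using a[OF p assms(1)] assms(2) by simp
  qed
  then obtain i where i: "i < k" "a p x i \<noteq> 0" by blast
  define \<alpha> where "\<alpha> q y = (if q \<in> N then \<rho> q * a q y i else 0)" for q y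
  have "linear_between (fibre B q) UNIV (\<alpha> q)" for q
  proof (cases "q \<in> N")
    case True
    have "a q (y + z) i = a q y i + a q z i" if "y \<in> fibre B q" "z \<in> fibre B q" for y z
      by (rule a_eq[where b = "\<lambda>i. a q y i + a q z i", OF True fibre_add[OF that] _ i(1)])
        (use a[OF True that(1)] a[OF True that(2)] in \<open>simp add: scaleR_add_left sum.distrib\<close>)
    moreover have "a q (t *\<^sub>R y) i = t * a q y i" if "y \<in> fibre B q" for t y
      by (rule a_eq[where b = "\<lambda>i. t * a q y i", OF True fibre_scale[OF that] _ i(1)])
        (subst a[OF True that], simp add: scaleR_sum_right)
    ultimately show ?thesis unfolding linear_between_def \<alpha>_def by (auto simp: algebra_simps)
  qed (simp add: linear_between_def \<alpha>_def)
  moreover have "(\<lambda>q. \<alpha> q (s q)) \<in> C_inf A" if s: "s \<in> sections B" for s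
  proof -
    obtain c where c: "\<And>i. i < k \<Longrightarrow> c i \<in> C_inf A"
      "\<And>q. q \<in> N \<Longrightarrow> s q = (\<Sum>i<k. c i q *\<^sub>R E i q)"
      using E(6)[OF s] by blast
    have "a q (s q) i = c i q" if "q \<in> N" for q
      by (rule a_eq[OF that section_fibre[OF s] c(2)[OF that] i(1)])
    then have "(\<lambda>q. \<alpha> q (s q)) = (\<lambda>q. \<rho> q * c i q)"
      using \<rho>(2) unfolding \<alpha>_def by fastforce
    then show ?thesis using C_inf_mult[OF \<rho>(1) c(1)[OF i(1)]] by simp
  qed
  ultimately have "\<alpha> \<in> dual_sections A B" unfolding dual_sections_def by auto
  moreover have "\<alpha> p x \<noteq> 0" using p \<rho>(4,6) i(2) by (simp add: \<alpha>_def)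
  ultimately show ?thesis using that by blast
qed

lemma dual_separates_eq:
  assumes "x \<in> fibre B p" "y \<in> fibre B p" "\<And>\<alpha>. \<alpha> \<in> dual_sections A B \<Longrightarrow> \<alpha> p x = \<alpha> p y"
  shows "x = y"
proof (rule ccontr)
  assume "x \<noteq> y"
  then obtain \<alpha> where \<alpha>: "\<alpha> \<in> dual_sections A B" "\<alpha> p (x - y) \<noteq> 0"
    using dual_separates[OF fibre_diff[OF assms(1,2)]] by auto
  have "\<alpha> p (x + - 1 *\<^sub>R y) = \<alpha> p x + - 1 * \<alpha> p y"
    using dual_add[OF \<alpha>(1) assms(1) fibre_scale[OF assms(2)], of "-1"] dual_scale[OF \<alpha>(1) assms(2), of "-1"]
    by simp
  then show False using \<alpha> assms(3) by simp
qed

text \<open>Gaussian elimination without division: \<open>\<beta>(s) \<alpha> - \<alpha>(s) \<beta>\<close> annihilates \<open>s\<close>.\<close>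

lemma annihilator:
  assumes "finite S" "S \<subseteq> sections B" "inj_on (\<lambda>s. s p) S" "independent ((\<lambda>s. s p) ` S)"
    and "x \<in> fibre B p" "x \<notin> span ((\<lambda>s. s p) ` S)"
  shows "\<exists>\<alpha> N. \<alpha> \<in> dual_sections A B \<and> open N \<and> p \<in> N \<and> \<alpha> p x \<noteq> 0 \<and>
      (\<forall>q\<in>N. \<forall>s\<in>S. \<alpha> q (s q) = 0)"
  using assms
proof (induction S arbitrary: x rule: finite_induct)
  case empty
  then have "x \<noteq> 0" by (auto simp: span_zero)
  then obtain \<alpha> where "\<alpha> \<in> dual_sections A B" "\<alpha> p x \<noteq> 0" using dual_separates empty by metis
  then show ?case by (intro exI[of _ \<alpha>] exI[of _ UNIV]) auto
next
  case (insert s S)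
  let ?I = "(\<lambda>s. s p) ` S"
  have s: "s \<in> sections B" and S: "S \<subseteq> sections B" "inj_on (\<lambda>s. s p) S" "s p \<notin> ?I"
    using insert by auto
  have ind: "independent ?I" "s p \<notin> span ?I"
    using insert.prems(3) S(3) by (auto simp: independent_insert)
  obtain \<beta> N where \<beta>: "\<beta> \<in> dual_sections A B" "open N" "p \<in> N" "\<beta> p (s p) \<noteq> 0"
    "\<And>q t. q \<in> N \<Longrightarrow> t \<in> S \<Longrightarrow> \<beta> q (t q) = 0"
    using insert.IH[OF S(1,2) ind(1) section_fibre[OF s] ind(2)] by blast
  \<comment> \<open>This choice makes \<beta> vanish on x'. Hence \<gamma> takes on x' the value
    \<beta>(s) \<alpha>(x'), a product of nonzero numbers, and the same value on x because \<gamma>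
    annihilates s.\<close>
  define c where "c = \<beta> p x / \<beta> p (s p)"
  define x' where "x' = x - c *\<^sub>R s p"
  have x': "x' \<in> fibre B p" unfolding x'_def
    by (intro fibre_diff fibre_scale section_fibre s insert.prems)
  have "x = x' + c *\<^sub>R s p" by (simp add: x'_def)
  have "x' \<notin> span ?I"
  proof
    assume "x' \<in> span ?I"
    then have "x' \<in> span (insert (s p) ?I)"
      using span_mono[of ?I "insert (s p) ?I"] by blast
    then have "x' + c *\<^sub>R s p \<in> span (insert (s p) ?I)"
      by (simp add: span_add span_scale span_base)
    then show False using insert.prems(5) \<open>x = x' + c *\<^sub>R s p\<close> by simp
  qed
  then obtain \<alpha> N' where \<alpha>: "\<alpha> \<in> dual_sections A B" "open N'" "p \<in> N'" "\<alpha> p x' \<noteq> 0"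
    "\<And>q t. q \<in> N' \<Longrightarrow> t \<in> S \<Longrightarrow> \<alpha> q (t q) = 0"
    using insert.IH[OF S(1,2) ind(1) x'] by blast
  define \<gamma> where "\<gamma> q y = \<beta> q (s q) * \<alpha> q y - \<alpha> q (s q) * \<beta> q y" for q y
  have \<gamma>: "\<gamma> \<in> dual_sections A B" unfolding \<gamma>_def
    by (intro dual_diff dual_scale_fun dual_smooth s \<alpha>(1) \<beta>(1))
  have ex: "\<delta> p x = \<delta> p x' + c * \<delta> p (s p)" if "\<delta> \<in> dual_sections A B" for \<delta>
    unfolding \<open>x = x' + c *\<^sub>R s p\<close>
    using dual_add[OF that x' fibre_scale[OF section_fibre[OF s]]] dual_scale[OF that section_fibre[OF s]]
    by simp
  have "\<beta> p x' = 0" using ex[OF \<beta>(1)] \<beta>(4) by (simp add: c_def)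
  then have "\<gamma> p x' \<noteq> 0" using \<alpha>(4) \<beta>(4) by (simp add: \<gamma>_def)
  moreover have "\<gamma> q (s q) = 0" for q by (simp add: \<gamma>_def)
  ultimately have "\<gamma> p x \<noteq> 0" using ex[OF \<gamma>] by simp
  moreover have "\<gamma> q (t q) = 0" if "q \<in> N \<inter> N'" "t \<in> insert s S" for q t
    using that \<alpha>(5) \<beta>(5) by (auto simp: \<gamma>_def)
  ultimately show ?case
    using \<gamma> \<alpha>(2,3) \<beta>(2,3) by (intro exI[of _ \<gamma>] exI[of _ "N \<inter> N'"]) auto
qed

text \<open>For each i, the annihilator of the remaining sections is chosen nonzero on Z i at p,
  hence nearby by continuity. The \<alpha> i are not normalised to be 1 on Z i: a quotient would be
  smooth only where the denominator is nonzero.\<close>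

lemma dual_coframe:
  fixes k :: nat
  assumes Z: "\<And>i. i < k \<Longrightarrow> Z i \<in> sections B"
    and inj: "inj_on (\<lambda>i. Z i p) {..<k}" and ind: "independent ((\<lambda>i. Z i p) ` {..<k})"
  obtains \<alpha> N where "open N" "p \<in> N" "\<And>i. i < k \<Longrightarrow> \<alpha> i \<in> dual_sections A B"
    "\<And>i q. i < k \<Longrightarrow> q \<in> N \<Longrightarrow> \<alpha> i q (Z i q) \<noteq> 0"
    "\<And>i j q. i < k \<Longrightarrow> j < k \<Longrightarrow> i \<noteq> j \<Longrightarrow> q \<in> N \<Longrightarrow> \<alpha> i q (Z j q) = 0"
proof -
  have "\<exists>\<alpha> N. \<alpha> \<in> dual_sections A B \<and> open N \<and> p \<in> N \<and> (\<forall>q\<in>N. \<alpha> q (Z i q) \<noteq> 0) \<and>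
      (\<forall>q\<in>N. \<forall>j<k. i \<noteq> j \<longrightarrow> \<alpha> q (Z j q) = 0)" if i: "i < k" for i
  proof -
    let ?S = "Z ` ({..<k} - {i})"
    have im: "(\<lambda>s. s p) ` ?S = (\<lambda>i. Z i p) ` {..<k} - {Z i p}"
      using inj i by (auto simp: inj_on_def)
    have inj': "inj_on (\<lambda>s. s p) ?S" using inj unfolding inj_on_def by fastforce
    have ind': "independent ((\<lambda>s. s p) ` ?S)"
      using ind unfolding im by (rule independent_mono) auto
    have not: "Z i p \<notin> span ((\<lambda>s. s p) ` ?S)"
      using ind i unfolding im dependent_def by blast
    have "finite ?S" "?S \<subseteq> sections B" using Z by auto
    from annihilator[OF this inj' ind' section_fibre[OF Z[OF i]] not]
    obtain \<alpha> N where \<alpha>: "\<alpha> \<in> dual_sections A B" "open N" "p \<in> N" "\<alpha> p (Z i p) \<noteq> 0"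
      "\<forall>q\<in>N. \<forall>s\<in>?S. \<alpha> q (s q) = 0"
      by (elim exE conjE) (rule that)
    have "open {q. \<alpha> q (Z i q) \<noteq> 0}"
      by (rule nonzero_open[OF dual_smooth[OF \<alpha>(1) Z[OF i]]])
    then show ?thesis using \<alpha>
      by (intro exI[of _ \<alpha>] exI[of _ "N \<inter> {q. \<alpha> q (Z i q) \<noteq> 0}"]) auto
  qed
  then obtain \<alpha> N where \<alpha>: "\<And>i. i < k \<Longrightarrow> \<alpha> i \<in> dual_sections A B \<and> open (N i) \<and> p \<in> N i \<and>
      (\<forall>q\<in>N i. \<alpha> i q (Z i q) \<noteq> 0) \<and> (\<forall>q\<in>N i. \<forall>j<k. i \<noteq> j \<longrightarrow> \<alpha> i q (Z j q) = 0)"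
    by metis
  show ?thesis
    by (rule that[of "\<Inter>i<k. N i" \<alpha>]) (use \<alpha> in auto)
qed

lemma dual_coframe_coeff:
  fixes k :: nat
  assumes "\<And>i. i < k \<Longrightarrow> z i \<in> fibre B q" "\<alpha> \<in> dual_sections A B" "i < k"
    and "\<And>j. j < k \<Longrightarrow> i \<noteq> j \<Longrightarrow> \<alpha> q (z j) = 0"
  shows "\<alpha> q (\<Sum>j<k. c j *\<^sub>R z j) = c i * \<alpha> q (z i)"
proof -
  have "\<alpha> q (\<Sum>j<k. c j *\<^sub>R z j) = (\<Sum>j<k. c j * \<alpha> q (z j))"
    using assms(1) by (subst dual_sum[OF assms(2)]) (auto simp: fibre_scale dual_scale[OF assms(2)])
  also have "\<dots> = (\<Sum>j<k. if j = i then c i * \<alpha> q (z i) else 0)"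
    using assms(4) by (intro sum.cong) auto
  finally show ?thesis using assms(3) by simp
qed

text \<open>Applying \<alpha> i of a dual coframe to a linear relation among the Z j isolates the
  i-th coefficient times a nonzero number.\<close>

lemma independent_near:
  fixes k :: nat
  assumes Z: "\<And>i. i < k \<Longrightarrow> Z i \<in> sections B"
    and "inj_on (\<lambda>i. Z i p) {..<k}" "independent ((\<lambda>i. Z i p) ` {..<k})"
  obtains N where "open N" "p \<in> N" "\<And>q. q \<in> N \<Longrightarrow> inj_on (\<lambda>i. Z i q) {..<k}"
    "\<And>q. q \<in> N \<Longrightarrow> independent ((\<lambda>i. Z i q) ` {..<k})"
proof -
  obtain \<alpha> N where \<alpha>: "open N" "p \<in> N" "\<And>i. i < k \<Longrightarrow> \<alpha> i \<in> dual_sections A B"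
    "\<And>i q. i < k \<Longrightarrow> q \<in> N \<Longrightarrow> \<alpha> i q (Z i q) \<noteq> 0"
    "\<And>i j q. i < k \<Longrightarrow> j < k \<Longrightarrow> i \<noteq> j \<Longrightarrow> q \<in> N \<Longrightarrow> \<alpha> i q (Z j q) = 0"
    by (rule dual_coframe[where Z = Z and p = p and k = k, OF _ assms(2,3)]) (erule Z, rule that)
  have inj: "inj_on (\<lambda>i. Z i q) {..<k}" if "q \<in> N" for q
    using \<alpha>(4,5) that unfolding inj_on_def by (metis lessThan_iff)
  moreover have "independent ((\<lambda>i. Z i q) ` {..<k})" if "q \<in> N" for q
  proof
    assume "dependent ((\<lambda>i. Z i q) ` {..<k})"
    then obtain u i where u: "i < k" "u (Z i q) \<noteq> 0" "(\<Sum>v\<in>(\<lambda>i. Z i q) ` {..<k}. u v *\<^sub>R v) = 0"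
      by (subst (asm) dependent_finite) auto
    then have "(\<Sum>j<k. u (Z j q) *\<^sub>R Z j q) = 0" using inj[OF that] by (simp add: sum.reindex)
    then have "u (Z i q) * \<alpha> i q (Z i q) = 0"
      using dual_coframe_coeff[of k "\<lambda>j. Z j q" q "\<alpha> i" i "\<lambda>j. u (Z j q)"] \<alpha>(3,5) u(1) that
        section_fibre[OF Z] by (simp add: dual_zero)
    then show False using u \<alpha>(4) that by simp
  qed
  ultimately show ?thesis using that \<alpha>(1,2) by blast
qed

end

section \<open>Jets and linear connections\<close>

context manifold
begin

text \<open>N depends on W and p alone and is fixed before c, so a whole family of coefficients can
  be made global over one neighbourhood.\<close>

lemma extend_germ:
  assumes "open W" "p \<in> W"
  obtains N where "open N" "p \<in> N" "N \<subseteq> W"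
    "\<And>c. smooth_fun A W c \<Longrightarrow> \<exists>c'\<in>C_inf A. \<forall>q\<in>N. c' q = c q"
proof -
  obtain \<rho> K N where \<rho>: "\<rho> \<in> C_inf A" "closed K" "K \<subseteq> W" "\<And>q. q \<notin> K \<Longrightarrow> \<rho> q = 0"
    "open N" "p \<in> N" "N \<subseteq> W" "\<And>q. q \<in> N \<Longrightarrow> \<rho> q = 1"
    by (rule bump[OF assms]) (rule that)
  have "\<exists>c'\<in>C_inf A. \<forall>q\<in>N. c' q = c q" if "smooth_fun A W c" for c
  proof (intro bexI ballI)
    show "(if q \<in> W then \<rho> q * c q else 0) = c q" if "q \<in> N" for q
      using \<rho>(7,8) that by auto
    show "(\<lambda>q. if q \<in> W then \<rho> q * c q else 0) \<in> C_inf A"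
      using smooth_fun_extend[OF assms(1) open_UNIV \<rho>(2,3,4), where c = c] \<rho>(1) that by simp
  qed
  then show ?thesis using that[OF \<rho>(5-7)] by simp
qed

end

context smooth_bundle
begin

lemma fst_prolong [simp]: "fst (prolong A B X p) = X p"
  by (simp add: prolong_def)

lemma fst_jet_incl [simp]: "fst (jet_incl A B p \<phi>) = 0"
  by (simp add: jet_incl_def)

lemma jet_eqI:
  fixes \<xi> \<eta> :: "('m, 'v) jet"
  assumes "fst \<xi> = fst \<eta>" "\<And>\<alpha> v. snd \<xi> \<alpha> v = snd \<eta> \<alpha> v"
  shows "\<xi> = \<eta>"
  using assms by (simp add: prod_eq_iff fun_eq_iff)

lemma snd_prolong:
  "snd (prolong A B X p) \<alpha> v =
    (if \<alpha> \<in> dual_sections A B \<and> v \<in> tangent_space A p then v (\<lambda>q. \<alpha> q (X q)) else 0)"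
  by (simp add: prolong_def)

lemma snd_jet_incl:
  "snd (jet_incl A B p \<phi>) \<alpha> v =
    (if \<alpha> \<in> dual_sections A B \<and> v \<in> tangent_space A p then - \<alpha> p (\<phi> v) else 0)"
  by (simp add: jet_incl_def)

section \<open>Linearity, Leibniz rule and locality for jets\<close>

lemma prolong_add:
  assumes "X \<in> sections B" "Y \<in> sections B"
  shows "prolong A B (\<lambda>q. X q + Y q) p = prolong A B X p + prolong A B Y p"
proof (rule jet_eqI)
  fix \<alpha> v
  show "snd (prolong A B (\<lambda>q. X q + Y q) p) \<alpha> v = snd (prolong A B X p + prolong A B Y p) \<alpha> v"
    using tangent_add[OF _ dual_smooth[OF _ assms(1)] dual_smooth[OF _ assms(2)], of v p \<alpha> \<alpha>]
    by (simp add: snd_prolong dual_add section_fibre assms)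
qed simp

lemma prolong_scale:
  assumes "f \<in> C_inf A" "X \<in> sections B"
  shows "prolong A B (\<lambda>q. f q *\<^sub>R X q) p =
    f p *\<^sub>R prolong A B X p - jet_incl A B p (\<lambda>v. v f *\<^sub>R X p)"
  using jet_incl_tensor[OF assms section_fibre[OF assms(2)]] by simp

lemma prolong_zero: "prolong A B (\<lambda>q. 0) p = 0"
  by (rule jet_eqI) (auto simp: snd_prolong dual_zero tangent_zero zero_prod_def)

lemma prolong_local:
  assumes "X \<in> sections B" "Y \<in> sections B" "open N" "p \<in> N" "\<And>q. q \<in> N \<Longrightarrow> X q = Y q"
  shows "prolong A B X p = prolong A B Y p"
proof (rule jet_eqI)
  fix \<alpha> v
  show "snd (prolong A B X p) \<alpha> v = snd (prolong A B Y p) \<alpha> v"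
    using tangent_local[OF _ dual_smooth[OF _ assms(1)] dual_smooth[OF _ assms(2)] assms(3,4), of v \<alpha> \<alpha>]
      assms(5)
    by (simp add: snd_prolong)
qed (simp add: assms)

lemma jet_incl_add:
  assumes "\<And>v. v \<in> tangent_space A p \<Longrightarrow> \<phi> v \<in> fibre B p" "\<And>v. v \<in> tangent_space A p \<Longrightarrow> \<psi> v \<in> fibre B p"
  shows "jet_incl A B p (\<lambda>v. \<phi> v + \<psi> v) = jet_incl A B p \<phi> + jet_incl A B p \<psi>"
  by (rule jet_eqI) (simp_all add: snd_jet_incl dual_add assms)

lemma jet_incl_scale:
  assumes "\<And>v. v \<in> tangent_space A p \<Longrightarrow> \<phi> v \<in> fibre B p"
  shows "jet_incl A B p (\<lambda>v. c *\<^sub>R \<phi> v) = c *\<^sub>R jet_incl A B p \<phi>"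
  by (rule jet_eqI) (simp_all add: snd_jet_incl dual_scale assms)

lemma jet_incl_zero: "jet_incl A B p (\<lambda>v. 0) = 0"
  by (rule jet_eqI) (simp_all add: snd_jet_incl dual_zero)

lemma jet_incl_cong:
  assumes "\<And>v. v \<in> tangent_space A p \<Longrightarrow> \<phi> v = \<psi> v"
  shows "jet_incl A B p \<phi> = jet_incl A B p \<psi>"
  by (rule jet_eqI) (simp_all add: snd_jet_incl assms)

text \<open>A jet records \<phi> only through the numbers \<alpha> p (\<phi> v), and dual sections
  separate the points of a fibre.\<close>

lemma jet_incl_inject:
  assumes "jet_incl A B p \<phi> = jet_incl A B p \<psi>" "v \<in> tangent_space A p"
    and "\<phi> v \<in> fibre B p" "\<psi> v \<in> fibre B p"
  shows "\<phi> v = \<psi> v"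
proof (rule dual_separates_eq[OF assms(3,4)])
  fix \<alpha> assume "\<alpha> \<in> dual_sections A B"
  then show "\<alpha> p (\<phi> v) = \<alpha> p (\<psi> v)"
    using arg_cong[OF assms(1), of "\<lambda>\<xi>. snd \<xi> \<alpha> v"] assms(2) by (simp add: snd_jet_incl)
qed

text \<open>The Leibniz rule for prolongations, iterated: the failure of prolongation to be linear
  over functions is the sum of the \<open>df\<^sub>i \<otimes> X\<^sub>i\<close>. It serves to read
  off the derivative part of a jet section, and to compare prolongations with connections.\<close>

lemma prolong_combination:
  fixes n :: nat
  assumes "\<And>i. i < n \<Longrightarrow> f i \<in> C_inf A" "\<And>i. i < n \<Longrightarrow> X i \<in> sections B"
  shows "(\<Sum>i<n. f i p *\<^sub>R prolong A B (X i) p) =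
    prolong A B (\<lambda>q. \<Sum>i<n. f i q *\<^sub>R X i q) p + jet_incl A B p (\<lambda>v. \<Sum>i<n. v (f i) *\<^sub>R X i p)"
  using assms
proof (induction n)
  case 0
  then show ?case by (simp add: prolong_zero jet_incl_zero)
next
  case (Suc n)
  have "(\<lambda>q. \<Sum>i<n. f i q *\<^sub>R X i q) \<in> sections B" "(\<lambda>q. f n q *\<^sub>R X n q) \<in> sections B"
    by (intro section_sum section_scale Suc.prems; simp)+
  from prolong_add[OF this]
  have 1: "prolong A B (\<lambda>q. \<Sum>i<Suc n. f i q *\<^sub>R X i q) p =
      prolong A B (\<lambda>q. \<Sum>i<n. f i q *\<^sub>R X i q) p +
      (f n p *\<^sub>R prolong A B (X n) p - jet_incl A B p (\<lambda>v. v (f n) *\<^sub>R X n p))"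
    using prolong_scale[of "f n" "X n" p] Suc.prems by simp
  have 2: "jet_incl A B p (\<lambda>v. (\<Sum>i<n. v (f i) *\<^sub>R X i p) + v (f n) *\<^sub>R X n p) =
      jet_incl A B p (\<lambda>v. \<Sum>i<n. v (f i) *\<^sub>R X i p) + jet_incl A B p (\<lambda>v. v (f n) *\<^sub>R X n p)"
    by (intro jet_incl_add fibre_sum fibre_scale section_fibre Suc.prems) simp_all
  show ?case using Suc 1 2 by simp
qed

lemma prolong_jet_section:
  assumes "X \<in> sections B"
  shows "prolong A B X \<in> jet_sections A B"
proof -
  have "smooth_combination A UNIV 1 (\<lambda>i. prolong A B X) (prolong A B X)"
    unfolding smooth_combination_def
    using smooth_fun_const[OF open_UNIV, of 1] by (intro exI[of _ "\<lambda>i q. 1"]) simp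
  then have "\<exists>W k Y. open W \<and> p \<in> W \<and> (\<forall>i<k. Y i \<in> sections B) \<and>
      smooth_combination A W k (\<lambda>i. prolong A B (Y i)) (prolong A B X)" for p
    using assms by (intro exI[of _ UNIV] exI[of _ 1] exI[of _ "\<lambda>i. X"]) simp
  then show ?thesis using assms unfolding jet_sections_def jet_space_def by blast
qed

lemma jet_section_local:
  assumes "\<xi> \<in> jet_sections A B"
  obtains N k c X where "open N" "p \<in> N" "\<And>i. i < k \<Longrightarrow> X i \<in> sections B"
    "\<And>i. i < k \<Longrightarrow> c i \<in> C_inf A" "\<And>q. q \<in> N \<Longrightarrow> \<xi> q = (\<Sum>i<(k::nat). c i q *\<^sub>R prolong A B (X i) q)"
proof -
  obtain W k X where W: "open W" "p \<in> W" "\<forall>i<k. X i \<in> sections B"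
    "smooth_combination A W k (\<lambda>i. prolong A B (X i)) \<xi>"
    using assms unfolding jet_sections_def by blast
  then obtain c where c: "\<forall>i<k. smooth_fun A W (c i)"
    "\<forall>q\<in>W. \<xi> q = (\<Sum>i<k. c i q *\<^sub>R prolong A B (X i) q)"
    unfolding smooth_combination_def by blast
  obtain N where N: "open N" "p \<in> N" "N \<subseteq> W"
    "\<And>c. smooth_fun A W c \<Longrightarrow> \<exists>c'\<in>C_inf A. \<forall>q\<in>N. c' q = c q"
    by (rule extend_germ[OF W(1,2)]) (rule that)
  have "\<exists>c'. i < k \<longrightarrow> c' \<in> C_inf A \<and> (\<forall>q\<in>N. c' q = c i q)" for i
    using N(4)[of "c i"] c(1) by blast
  then obtain c' where c': "\<And>i. i < k \<Longrightarrow> c' i \<in> C_inf A \<and> (\<forall>q\<in>N. c' i q = c i q)"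
    by metis
  show ?thesis
  proof (rule that[OF N(1,2), of k X c'])
    show "\<xi> q = (\<Sum>i<k. c' i q *\<^sub>R prolong A B (X i) q)" if "q \<in> N" for q
      using c(2) c' that N(3) by (simp add: subset_iff)
  qed (use W(3) c' in auto)
qed

lemma fst_combination:
  fixes k :: nat and x :: "nat \<Rightarrow> ('m, 'v) jet"
  shows "fst (\<Sum>i<k. c i *\<^sub>R x i) = (\<Sum>i<k. c i *\<^sub>R fst (x i))"
  by (induction k) simp_all

lemma fst_jet_section:
  assumes "\<xi> \<in> jet_sections A B"
  shows "(\<lambda>q. fst (\<xi> q)) \<in> sections B"
proof (rule section_local)
  fix p
  obtain N k c X where N: "open N" "p \<in> N" "\<And>i. i < k \<Longrightarrow> X i \<in> sections B"
    "\<And>i. i < k \<Longrightarrow> c i \<in> C_inf A" "\<And>q. q \<in> N \<Longrightarrow> \<xi> q = (\<Sum>i<(k::nat). c i q *\<^sub>R prolong A B (X i) q)"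
    by (rule jet_section_local[OF assms]) (rule that)
  have "(\<lambda>q. \<Sum>i<k. c i q *\<^sub>R X i q) \<in> sections B"
    by (intro section_sum section_scale N(3,4)) simp_all
  then show "\<exists>N t. open N \<and> p \<in> N \<and> t \<in> sections B \<and> (\<forall>q\<in>N. fst (\<xi> q) = t q)"
    using N by (intro exI[of _ N] exI[of _ "\<lambda>q. \<Sum>i<k. c i q *\<^sub>R X i q"]) (simp add: fst_combination)
qed

lemma morphismI:
  assumes "\<And>p v w. v \<in> tangent_space A p \<Longrightarrow> w \<in> tangent_space A p \<Longrightarrow> \<Psi> p (v + w) = \<Psi> p v + \<Psi> p w"
    and "\<And>p v c. v \<in> tangent_space A p \<Longrightarrow> \<Psi> p (c *\<^sub>R v) = c *\<^sub>R \<Psi> p v"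
    and "\<And>p v. v \<in> tangent_space A p \<Longrightarrow> \<Psi> p v \<in> fibre B p"
    and "\<And>V. (\<And>p. V p \<in> tangent_space A p) \<Longrightarrow> (\<And>f. f \<in> C_inf A \<Longrightarrow> (\<lambda>p. V p f) \<in> C_inf A) \<Longrightarrow>
      (\<lambda>p. \<Psi> p (V p)) \<in> sections B"
  shows "bundle_morphism (tangent_bundle A) B \<Psi>"
  using assms unfolding bundle_morphism_def linear_between_def tangent_bundle_def by simp

lemma morphismD:
  assumes "bundle_morphism (tangent_bundle A) B \<Psi>"
  shows "v \<in> tangent_space A p \<Longrightarrow> w \<in> tangent_space A p \<Longrightarrow> \<Psi> p (v + w) = \<Psi> p v + \<Psi> p w"
    and "v \<in> tangent_space A p \<Longrightarrow> \<Psi> p (c *\<^sub>R v) = c *\<^sub>R \<Psi> p v"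
    and "v \<in> tangent_space A p \<Longrightarrow> \<Psi> p v \<in> fibre B p"
    and "(\<And>p. V p \<in> tangent_space A p) \<Longrightarrow> (\<And>f. f \<in> C_inf A \<Longrightarrow> (\<lambda>p. V p f) \<in> C_inf A) \<Longrightarrow>
      (\<lambda>p. \<Psi> p (V p)) \<in> sections B"
  using assms unfolding bundle_morphism_def linear_between_def tangent_bundle_def by simp_all

lemma tangent_vector_add_closed:
  "v \<in> tangent_space A p \<Longrightarrow> w \<in> tangent_space A p \<Longrightarrow> v + w \<in> tangent_space A p"
  unfolding tangent_space_def by (simp add: algebra_simps)

lemma tangent_vector_scale_closed:
  "v \<in> tangent_space A p \<Longrightarrow> c *\<^sub>R v \<in> tangent_space A p"
  unfolding tangent_space_def by (simp add: algebra_simps)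

text \<open>The exact sequence on the level of sections: \<Psi> is the part of \<xi> that differs
  from the prolongation of its projection. Near each point \<xi> is a combination of prolongations,
  and \<open>prolong_combination\<close> gives \<Psi> as the sum of the
  \<open>dc\<^sub>i \<otimes> X\<^sub>i\<close>. Injectivity of the inclusion makes these local
  expressions agree, and linearity and smoothness are read off from them.\<close>

lemma jet_section_split:
  assumes "\<xi> \<in> jet_sections A B"
  obtains \<Psi> where "bundle_morphism (tangent_bundle A) B \<Psi>"
    "\<And>p v. v \<notin> tangent_space A p \<Longrightarrow> \<Psi> p v = 0"
    "\<And>p. \<xi> p = prolong A B (\<lambda>q. fst (\<xi> q)) p + jet_incl A B p (\<Psi> p)"
proof -
  let ?X = "\<lambda>q. fst (\<xi> q)"
  have loc: "\<exists>N k c X. open N \<and> p \<in> N \<and> (\<forall>i<k. X i \<in> sections B \<and> c i \<in> C_inf A) \<and>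
      (\<forall>q\<in>N. \<xi> q = prolong A B ?X q + jet_incl A B q (\<lambda>v. \<Sum>i<(k::nat). v (c i) *\<^sub>R X i q))" for p
  proof -
    obtain N k c X where N: "open N" "p \<in> N" "\<And>i. i < k \<Longrightarrow> X i \<in> sections B"
      "\<And>i. i < k \<Longrightarrow> c i \<in> C_inf A" "\<And>q. q \<in> N \<Longrightarrow> \<xi> q = (\<Sum>i<(k::nat). c i q *\<^sub>R prolong A B (X i) q)"
      by (rule jet_section_local[OF assms]) (rule that)
    have s: "(\<lambda>q. \<Sum>i<k. c i q *\<^sub>R X i q) \<in> sections B"
      by (intro section_sum section_scale N(3,4)) simp_all
    have "\<xi> q = prolong A B ?X q + jet_incl A B q (\<lambda>v. \<Sum>i<k. v (c i) *\<^sub>R X i q)" if q: "q \<in> N" for q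
    proof -
      \<comment> \<open>The two global sections agree on N only, which is enough since prolongation
        depends on germs.\<close>
      have "prolong A B (\<lambda>q. \<Sum>i<k. c i q *\<^sub>R X i q) q = prolong A B ?X q"
        by (rule prolong_local[OF s fst_jet_section[OF assms] N(1) q]) (simp add: N(5) fst_combination)
      then show ?thesis using N(5)[OF q] prolong_combination[where n = k and f = c and X = X and p = q,
          OF N(4,3)] by simp
    qed
    then show ?thesis using N by blast
  qed
  have "\<exists>\<psi>. \<xi> p = prolong A B ?X p + jet_incl A B p \<psi> \<and>
      (\<forall>v. v \<notin> tangent_space A p \<longrightarrow> \<psi> v = 0) \<and> (\<forall>v\<in>tangent_space A p. \<psi> v \<in> fibre B p)" for p
  proof -
    obtain N k c X where N: "p \<in> N" "\<forall>i<k. X i \<in> sections B \<and> c i \<in> C_inf A"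
      "\<forall>q\<in>N. \<xi> q = prolong A B ?X q + jet_incl A B q (\<lambda>v. \<Sum>i<(k::nat). v (c i) *\<^sub>R X i q)"
      using loc[of p] by blast
    let ?\<psi> = "\<lambda>v. if v \<in> tangent_space A p then \<Sum>i<k. v (c i) *\<^sub>R X i p else 0"
    have "jet_incl A B p ?\<psi> = jet_incl A B p (\<lambda>v. \<Sum>i<k. v (c i) *\<^sub>R X i p)"
      by (rule jet_incl_cong) simp
    moreover have "(\<Sum>i<k. v (c i) *\<^sub>R X i p) \<in> fibre B p" for v :: "'m tangent"
      using N(2) by (intro fibre_sum fibre_scale section_fibre) simp
    ultimately show ?thesis using N(1,3) by (intro exI[of _ ?\<psi>]) simp
  qed
  then obtain \<Psi> where \<Psi>: "\<And>p. \<xi> p = prolong A B ?X p + jet_incl A B p (\<Psi> p)"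
    "\<And>p v. v \<notin> tangent_space A p \<Longrightarrow> \<Psi> p v = 0" "\<And>p v. v \<in> tangent_space A p \<Longrightarrow> \<Psi> p v \<in> fibre B p"
    by metis
  have \<Psi>_eq: "\<Psi> q v = \<phi> v"
    if "\<xi> q = prolong A B ?X q + jet_incl A B q \<phi>" "v \<in> tangent_space A q" "\<phi> v \<in> fibre B q" for q v \<phi>
    by (rule jet_incl_inject[where \<phi> = "\<Psi> q" and \<psi> = \<phi> and v = v and p = q,
        OF _ that(2) \<Psi>(3)[OF that(2)] that(3)]) (use \<Psi>(1)[of q] that(1) in simp)
  have "bundle_morphism (tangent_bundle A) B \<Psi>"
  proof (rule morphismI)
    fix p v w and a :: real
    assume v: "v \<in> tangent_space A p"
    obtain N k c X where N: "p \<in> N" "\<forall>i<k. X i \<in> sections B \<and> c i \<in> C_inf A"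
      "\<forall>q\<in>N. \<xi> q = prolong A B ?X q + jet_incl A B q (\<lambda>v. \<Sum>i<(k::nat). v (c i) *\<^sub>R X i q)"
      using loc[of p] by blast
    have fib: "(\<Sum>i<k. v (c i) *\<^sub>R X i p) \<in> fibre B p" for v :: "'m tangent"
      using N(2) by (intro fibre_sum fibre_scale section_fibre) simp
    have eq: "\<Psi> p v = (\<Sum>i<k. v (c i) *\<^sub>R X i p)" if "v \<in> tangent_space A p" for v
      using N(1,3) by (intro \<Psi>_eq[where \<phi> = "\<lambda>v. \<Sum>i<k. v (c i) *\<^sub>R X i p", OF _ that fib]) simp
    show "\<Psi> p (v + w) = \<Psi> p v + \<Psi> p w" if "w \<in> tangent_space A p"
      using eq v that tangent_vector_add_closed[OF v that] by (simp add: scaleR_add_left sum.distrib)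
    show "\<Psi> p (a *\<^sub>R v) = a *\<^sub>R \<Psi> p v"
      using eq v tangent_vector_scale_closed[OF v] by (simp add: scaleR_sum_right)
  next
    fix V assume V: "\<And>p. V p \<in> tangent_space A p" "\<And>f. f \<in> C_inf A \<Longrightarrow> (\<lambda>p. V p f) \<in> C_inf A"
    show "(\<lambda>p. \<Psi> p (V p)) \<in> sections B"
    proof (rule section_local)
      fix p
      obtain N k c X where N: "open N" "p \<in> N" "\<forall>i<k. X i \<in> sections B \<and> c i \<in> C_inf A"
        "\<forall>q\<in>N. \<xi> q = prolong A B ?X q + jet_incl A B q (\<lambda>v. \<Sum>i<(k::nat). v (c i) *\<^sub>R X i q)"
        using loc[of p] by blast
      have fib: "(\<Sum>i<k. v (c i) *\<^sub>R X i q) \<in> fibre B q" for v :: "'m tangent" and q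
        using N(3) by (intro fibre_sum fibre_scale section_fibre) simp
      have "\<forall>q\<in>N. \<Psi> q (V q) = (\<Sum>i<k. V q (c i) *\<^sub>R X i q)"
        using N(4) by (intro ballI \<Psi>_eq[where \<phi> = "\<lambda>v. \<Sum>i<k. v (c i) *\<^sub>R X i q" for q,
            OF _ V(1) fib]) simp
      moreover have "(\<lambda>q. \<Sum>i<k. V q (c i) *\<^sub>R X i q) \<in> sections B"
        using N(3) by (intro section_sum section_scale V(2)) simp_all
      ultimately show "\<exists>N t. open N \<and> p \<in> N \<and> t \<in> sections B \<and> (\<forall>q\<in>N. \<Psi> q (V q) = t q)"
        using N(1,2) by (intro exI[of _ N] exI[of _ "\<lambda>q. \<Sum>i<k. V q (c i) *\<^sub>R X i q"] conjI)
    qed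
  qed (rule \<Psi>(3))
  then show ?thesis using \<Psi>(1,2) by (rule_tac that)
qed


subsection \<open>Linear connections\<close>

lemma connectionD:
  assumes "linear_connection A B D"
  shows "X \<in> sections B \<Longrightarrow> bundle_morphism (tangent_bundle A) B (D X)"
    and "X \<in> sections B \<Longrightarrow> Y \<in> sections B \<Longrightarrow> v \<in> tangent_space A p \<Longrightarrow>
      D (\<lambda>q. X q + Y q) p v = D X p v + D Y p v"
    and "X \<in> sections B \<Longrightarrow> f \<in> C_inf A \<Longrightarrow> v \<in> tangent_space A p \<Longrightarrow>
      D (\<lambda>q. f q *\<^sub>R X q) p v = v f *\<^sub>R X p + f p *\<^sub>R D X p v"
    and "X \<notin> sections B \<Longrightarrow> D X p v = 0"
    and "v \<notin> tangent_space A p \<Longrightarrow> D X p v = 0"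
  using assms unfolding linear_connection_def by blast+

lemma connection_fibre:
  assumes "linear_connection A B D" "X \<in> sections B" "v \<in> tangent_space A p"
  shows "D X p v \<in> fibre B p"
  by (rule morphismD(3)[OF connectionD(1)[OF assms(1,2)] assms(3)])

lemma connection_combination:
  fixes n :: nat
  assumes D: "linear_connection A B D" and v: "v \<in> tangent_space A p"
    and "\<And>i. i < n \<Longrightarrow> f i \<in> C_inf A" "\<And>i. i < n \<Longrightarrow> X i \<in> sections B"
  shows "D (\<lambda>q. \<Sum>i<n. f i q *\<^sub>R X i q) p v = (\<Sum>i<n. v (f i) *\<^sub>R X i p + f i p *\<^sub>R D (X i) p v)"
  using assms(3,4)
proof (induction n)
  case 0
  show ?case
    using connectionD(3)[OF D section_zero C_inf_const v, of 0] tangent_zero[OF v] by simp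
next
  case (Suc n)
  have "(\<lambda>q. \<Sum>i<n. f i q *\<^sub>R X i q) \<in> sections B" "(\<lambda>q. f n q *\<^sub>R X n q) \<in> sections B"
    by (intro section_sum section_scale Suc.prems; simp)+
  from connectionD(2)[OF D this v] show ?case
    using connectionD(3)[OF D _ _ v, of "X n" "f n"] Suc by simp
qed

lemma splitting_vanishing:
  assumes D: "linear_connection A B D" and X: "X \<in> sections B" "X p = 0"
  shows "prolong A B X p + jet_incl A B p (D X p) = 0"
proof -
  obtain n f E where E: "\<And>i. i < n \<Longrightarrow> f i \<in> C_inf A" "\<And>i. i < n \<Longrightarrow> f i p = 0"
    "\<And>i. i < n \<Longrightarrow> E i \<in> sections B" "X = (\<lambda>q. \<Sum>i<(n::nat). f i q *\<^sub>R E i q)"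
    by (rule vanishing_section[OF X]) (rule that)
  have "jet_incl A B p (D X p) = jet_incl A B p (\<lambda>v. \<Sum>i<n. v (f i) *\<^sub>R E i p)"
  proof (rule jet_incl_cong)
    show "D X p v = (\<Sum>i<n. v (f i) *\<^sub>R E i p)" if "v \<in> tangent_space A p" for v
      unfolding E(4) using connection_combination[OF D that E(1,3)] E(2) by simp
  qed
  then show ?thesis using prolong_combination[where n = n and f = f and X = E and p = p,
      OF E(1,3)] E(2) by (simp add: E(4))
qed

text \<open>The definition picks an arbitrary section through X p. Two choices differ by a section
  vanishing at p, to which \<open>splitting_vanishing\<close> applies.\<close>

lemma splitting_section:
  assumes D: "linear_connection A B D" and X: "X \<in> sections B"
  shows "splitting A B D p (X p) = prolong A B X p + jet_incl A B p (D X p)"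
proof -
  define Y where "Y = (SOME Y. Y \<in> sections B \<and> Y p = X p)"
  have Y: "Y \<in> sections B" "Y p = X p"
    unfolding Y_def using someI[of "\<lambda>Y. Y \<in> sections B \<and> Y p = X p" X] X by auto
  let ?Z = "\<lambda>q. X q - Y q"
  have Z: "?Z \<in> sections B" using section_diff[OF X Y(1)] .
  have eq: "X = (\<lambda>q. Y q + ?Z q)" by simp
  have "prolong A B X p = prolong A B Y p + prolong A B ?Z p"
    by (subst eq) (rule prolong_add[OF Y(1) Z])
  moreover have "jet_incl A B p (D X p) = jet_incl A B p (\<lambda>v. D Y p v + D ?Z p v)"
    by (rule jet_incl_cong) (subst eq, rule connectionD(2)[OF D Y(1) Z])
  moreover have "\<dots> = jet_incl A B p (D Y p) + jet_incl A B p (D ?Z p)"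
    by (rule jet_incl_add) (auto intro: connection_fibre[OF D] Y(1) Z)
  moreover have "splitting A B D p (X p) = prolong A B Y p + jet_incl A B p (D Y p)"
    by (simp add: splitting_def Y_def Let_def)
  ultimately show ?thesis using splitting_vanishing[OF D Z, of p] Y(2) by (simp add: algebra_simps)
qed

text \<open>The added term is linear over functions in X, so the Leibniz rule survives. The case
  distinction in D' and the assumption on \<Psi> off the tangent space keep D' zero at the arguments
  where a connection is required to be zero.\<close>

lemma connection_perturb:
  assumes D: "linear_connection A B D" and \<alpha>: "\<alpha> \<in> dual_sections A B"
    and \<Psi>: "bundle_morphism (tangent_bundle A) B \<Psi>" "\<And>p v. v \<notin> tangent_space A p \<Longrightarrow> \<Psi> p v = 0"
  defines "D' \<equiv> \<lambda>X p v. D X p v + (if X \<in> sections B then \<alpha> p (X p) *\<^sub>R \<Psi> p v else 0)"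
  shows "linear_connection A B D'"
    and "X \<in> sections B \<Longrightarrow> splitting A B D' p (X p) =
      splitting A B D p (X p) + \<alpha> p (X p) *\<^sub>R jet_incl A B p (\<Psi> p)"
proof -
  show D': "linear_connection A B D'"
    unfolding linear_connection_def
  proof (intro conjI ballI allI impI)
    fix X assume X: "X \<in> sections B"
    note DX = morphismD[OF connectionD(1)[OF D X]] and \<Psi>' = morphismD[OF \<Psi>(1)]
    show "bundle_morphism (tangent_bundle A) B (D' X)"
    proof (rule morphismI)
      fix V assume V: "\<And>p. V p \<in> tangent_space A p" "\<And>f. f \<in> C_inf A \<Longrightarrow> (\<lambda>p. V p f) \<in> C_inf A"
      have "(\<lambda>p. D X p (V p)) \<in> sections B" "(\<lambda>p. \<alpha> p (X p) *\<^sub>R \<Psi> p (V p)) \<in> sections B"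
        using V by (auto intro!: DX(4) section_scale \<Psi>'(4) dual_smooth[OF \<alpha> X])
      from section_add[OF this] show "(\<lambda>p. D' X p (V p)) \<in> sections B"
        using X by (simp add: D'_def)
    qed (use X in \<open>simp_all add: D'_def DX(1-3) \<Psi>'(1-3) algebra_simps fibre_add fibre_scale\<close>)
    fix p v assume v: "v \<in> tangent_space A p"
    show "D' (\<lambda>q. X q + Y q) p v = D' X p v + D' Y p v" if "Y \<in> sections B" for Y
      using X that section_add[OF X that] connectionD(2)[OF D X that v]
        dual_add[OF \<alpha> section_fibre[OF X] section_fibre[OF that]]
      by (simp add: D'_def algebra_simps)
    show "D' (\<lambda>q. f q *\<^sub>R X q) p v = v f *\<^sub>R X p + f p *\<^sub>R D' X p v" if "f \<in> C_inf A" for f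
      using X section_scale[OF that X] connectionD(3)[OF D X that v] dual_scale[OF \<alpha> section_fibre[OF X]]
      by (simp add: D'_def algebra_simps)
  qed (use connectionD(4,5)[OF D] \<Psi>(2) in \<open>simp_all add: D'_def\<close>)
  show "splitting A B D' p (X p) =
      splitting A B D p (X p) + \<alpha> p (X p) *\<^sub>R jet_incl A B p (\<Psi> p)" if X: "X \<in> sections B"
  proof -
    have "jet_incl A B p (D' X p) = jet_incl A B p (\<lambda>v. D X p v + \<alpha> p (X p) *\<^sub>R \<Psi> p v)"
      by (rule jet_incl_cong) (simp add: D'_def X)
    also have "\<dots> = jet_incl A B p (D X p) + \<alpha> p (X p) *\<^sub>R jet_incl A B p (\<Psi> p)"
      using connection_fibre[OF D X] morphismD(3)[OF \<Psi>(1)]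
      by (simp add: jet_incl_add jet_incl_scale fibre_scale)
    finally show ?thesis using splitting_section[OF D' X] splitting_section[OF D X] by simp
  qed
qed

end

section \<open>Infinitesimal geometric structures\<close>

locale jet_structure = manifold A
  for A :: "('m::{t2_space, second_countable_topology}, 'e::euclidean_space) atlas" +
  fixes L :: "('m, 'v::real_vector) algebroid"
    and br :: "('m \<Rightarrow> ('m, 'v) jet) \<Rightarrow> ('m \<Rightarrow> ('m, 'v) jet) \<Rightarrow> 'm \<Rightarrow> ('m, 'v) jet"
    and g :: "'m \<Rightarrow> ('m, 'v) jet set"
  assumes lie_algebroid: "lie_algebroid A L"
    and jet_bracket: "jet_bracket A L br"
    and geometric: "infinitesimal_geometric_structure A L br g"
begin

section \<open>The bundles \<open>L\<close>, \<open>J\<close> and \<open>G\<close> as instances of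
  one theory of sections\<close>

sublocale L: smooth_bundle A L
  by unfold_locales (use lie_algebroid in \<open>simp add: lie_algebroid_def\<close>)

sublocale J: smooth_bundle A "jet_algebroid A L br"
  by unfold_locales (use jet_bracket in \<open>simp add: jet_bracket_def lie_algebroid_def\<close>)

lemma jet_algebroid_simps [simp]:
  "fibre (jet_algebroid A L br) = jet_space A L"
  "sections (jet_algebroid A L br) = jet_sections A L"
  "anchor (jet_algebroid A L br) p \<xi> = anchor L p (fst \<xi>)"
  "bracket (jet_algebroid A L br) = br"
  by (simp_all add: jet_algebroid_def)

text \<open>\<open>g\<close> as a vector bundle in its own right, so that frames, sections through a
  given vector and gluing can be used inside \<open>g\<close>.\<close>

definition structure_bundle :: "('m, ('m, 'v) jet) vbundle" where
  "structure_bundle = \<lparr>fibre = g, sections = subbundle_sections (jet_algebroid A L br) g\<rparr>"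

lemma structure_bundle_simps [simp]:
  "fibre structure_bundle = g"
  "\<xi> \<in> sections structure_bundle \<longleftrightarrow> \<xi> \<in> jet_sections A L \<and> (\<forall>p. \<xi> p \<in> g p)"
  by (auto simp: structure_bundle_def subbundle_sections_def)

lemma structure_subset: "g p \<subseteq> jet_space A L p"
  using geometric by (simp add: infinitesimal_geometric_structure_def subalgebroid_def subbundle_def)

sublocale G: smooth_bundle A structure_bundle
  by unfold_locales (use geometric in
    \<open>simp add: structure_bundle_def infinitesimal_geometric_structure_def subalgebroid_def subbundle_def\<close>)

lemma structure_subspace: "subspace (g p)"
  using G.subspace_fibre by simp

lemma structure_bracket:
  assumes "\<xi> \<in> sections structure_bundle" "\<eta> \<in> sections structure_bundle"
  shows "br \<xi> \<eta> p \<in> g p"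
  using geometric assms
  by (simp add: infinitesimal_geometric_structure_def subalgebroid_def subbundle_sections_def)

lemma fst_structure: "\<xi> \<in> g p \<Longrightarrow> fst \<xi> \<in> fibre L p"
  using structure_subset[of p] L.section_fibre by (auto simp: jet_space_def)

lemma image_subset: "igs_image g p \<subseteq> fibre L p"
  using fst_structure by (auto simp: igs_image_def)

lemma linear_fst: "linear fst"
  by (simp add: bounded_linear.linear bounded_linear_fst linear_iff)

lemma image_subspace: "subspace (igs_image g p)"
  unfolding igs_image_def by (rule linear_subspace_image[OF linear_fst structure_subspace])


subsection \<open>The projection to the base algebroid preserves brackets\<close>

lemma bracketD:
  assumes X: "X \<in> sections L" and Y: "Y \<in> sections L"
  shows bracket_section: "bracket L X Y \<in> sections L"
    and bracket_add: "Z \<in> sections L \<Longrightarrow>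
      bracket L X (\<lambda>q. Y q + Z q) p = bracket L X Y p + bracket L X Z p"
    and bracket_antisym: "bracket L X Y p = - bracket L Y X p"
    and bracket_leibniz: "f \<in> C_inf A \<Longrightarrow>
      bracket L X (\<lambda>q. f q *\<^sub>R Y q) p = f p *\<^sub>R bracket L X Y p + anchor L p (X p) f *\<^sub>R Y p"
proof -
  have l: "lie_bracket_on (sections L) (bracket L)" using lie_algebroid by (simp add: lie_algebroid_def)
  show "bracket L X Y \<in> sections L" using l X Y unfolding lie_bracket_on_def by blast
  have "bracket L X Y = - bracket L Y X" using l X Y unfolding lie_bracket_on_def by blast
  then show "bracket L X Y p = - bracket L Y X p" by simp
  have "bracket L X (Y + Z) = bracket L X Y + bracket L X Z" if "Z \<in> sections L"
    using l X Y that unfolding lie_bracket_on_def by blast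
  then show "Z \<in> sections L \<Longrightarrow>
      bracket L X (\<lambda>q. Y q + Z q) p = bracket L X Y p + bracket L X Z p"
    by (simp add: plus_fun_def)
  show "f \<in> C_inf A \<Longrightarrow>
      bracket L X (\<lambda>q. f q *\<^sub>R Y q) p = f p *\<^sub>R bracket L X Y p + anchor L p (X p) f *\<^sub>R Y p"
    using lie_algebroid X Y unfolding lie_algebroid_def by blast
qed

lemma jet_bracketD:
  assumes X: "X \<in> jet_sections A L" and Y: "Y \<in> jet_sections A L"
  shows jet_bracket_add: "Z \<in> jet_sections A L \<Longrightarrow> br X (\<lambda>q. Y q + Z q) p = br X Y p + br X Z p"
    and jet_bracket_antisym: "br X Y p = - br Y X p"
    and jet_bracket_leibniz: "f \<in> C_inf A \<Longrightarrow>
      br X (\<lambda>q. f q *\<^sub>R Y q) p = f p *\<^sub>R br X Y p + anchor L p (fst (X p)) f *\<^sub>R Y p"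
proof -
  have a: "lie_algebroid A (jet_algebroid A L br)" using jet_bracket by (simp add: jet_bracket_def)
  then have l: "lie_bracket_on (jet_sections A L) br" by (simp add: lie_algebroid_def)
  have "br X Y = - br Y X" using l X Y unfolding lie_bracket_on_def by blast
  then show "br X Y p = - br Y X p" by simp
  have "br X (Y + Z) = br X Y + br X Z" if "Z \<in> jet_sections A L"
    using l X Y that unfolding lie_bracket_on_def by blast
  then show "Z \<in> jet_sections A L \<Longrightarrow> br X (\<lambda>q. Y q + Z q) p = br X Y p + br X Z p"
    by (simp add: plus_fun_def)
  have "\<forall>X\<in>jet_sections A L. \<forall>Y\<in>jet_sections A L. \<forall>f\<in>C_inf A. \<forall>p.
      br X (\<lambda>q. f q *\<^sub>R Y q) p = f p *\<^sub>R br X Y p + anchor L p (fst (X p)) f *\<^sub>R Y p"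
    using a unfolding lie_algebroid_def jet_algebroid_simps by blast
  then show "f \<in> C_inf A \<Longrightarrow>
      br X (\<lambda>q. f q *\<^sub>R Y q) p = f p *\<^sub>R br X Y p + anchor L p (fst (X p)) f *\<^sub>R Y p"
    using X Y by blast
qed

lemmas jet_section_scale = J.section_scale[unfolded jet_algebroid_simps]
  and jet_section_sum = J.section_sum[unfolded jet_algebroid_simps]

text \<open>Stated at a single point p, because the reduction to prolongations uses cutoff functions
  with prescribed values at p.\<close>

definition projects_bracket :: "('m \<Rightarrow> ('m, 'v) jet) \<Rightarrow> ('m \<Rightarrow> ('m, 'v) jet) \<Rightarrow> 'm \<Rightarrow> bool" where
  "projects_bracket \<xi> \<eta> p \<longleftrightarrow>
     fst (br \<xi> \<eta> p) = bracket L (\<lambda>q. fst (\<xi> q)) (\<lambda>q. fst (\<eta> q)) p"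

lemma projects_bracket_add:
  assumes "\<xi> \<in> jet_sections A L" "\<eta> \<in> jet_sections A L" "\<zeta> \<in> jet_sections A L"
    and "projects_bracket \<xi> \<eta> p" "projects_bracket \<xi> \<zeta> p"
  shows "projects_bracket \<xi> (\<lambda>q. \<eta> q + \<zeta> q) p"
  using assms jet_bracket_add[OF assms(1-3)]
    bracket_add[OF L.fst_jet_section[OF assms(1)] L.fst_jet_section[OF assms(2)] L.fst_jet_section[OF assms(3)]]
  by (simp add: projects_bracket_def)

text \<open>The anchor of a jet is the anchor of its projection, so the derivative terms of the two
  Leibniz rules correspond. If f p = 0, only those terms remain.\<close>

lemma projects_bracket_scale:
  assumes "\<xi> \<in> jet_sections A L" "\<eta> \<in> jet_sections A L" "f \<in> C_inf A"
    and "projects_bracket \<xi> \<eta> p \<or> f p = 0"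
  shows "projects_bracket \<xi> (\<lambda>q. f q *\<^sub>R \<eta> q) p"
  using assms(4) jet_bracket_leibniz[OF assms(1-3)]
    bracket_leibniz[OF L.fst_jet_section[OF assms(1)] L.fst_jet_section[OF assms(2)] assms(3)]
  by (auto simp: projects_bracket_def)

lemma projects_bracket_sum:
  assumes "\<xi> \<in> jet_sections A L" "\<And>i. i < n \<Longrightarrow> \<eta> i \<in> jet_sections A L"
    and "\<And>i. i < n \<Longrightarrow> projects_bracket \<xi> (\<eta> i) p"
  shows "projects_bracket \<xi> (\<lambda>q. \<Sum>i<(n::nat). \<eta> i q) p"
  using assms(2,3)
proof (induction n)
  case 0
  have "(\<lambda>q. 0) \<in> jet_sections A L" using J.section_zero by simp
  from projects_bracket_scale[where f = "\<lambda>q. 0" and p = p,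
      OF assms(1) this C_inf_const] show ?case by simp
next
  case (Suc n)
  have "projects_bracket \<xi> (\<lambda>q. (\<Sum>i<n. \<eta> i q) + \<eta> n q) p"
    by (rule projects_bracket_add) (use Suc assms(1) in \<open>auto intro: jet_section_sum\<close>)
  then show ?case by simp
qed

text \<open>Near p, \<eta> is a combination of prolongations. A cutoff \<rho> turns this into a
  global identity with remainder (1 - \<rho>) \<eta>, whose coefficient vanishes at p.\<close>

lemma projects_bracket_if_prolong:
  assumes \<xi>: "\<xi> \<in> jet_sections A L" and \<eta>: "\<eta> \<in> jet_sections A L"
    and *: "\<And>X. X \<in> sections L \<Longrightarrow> projects_bracket \<xi> (prolong A L X) p"
  shows "projects_bracket \<xi> \<eta> p"
proof -
  obtain N k c X where N: "open N" "p \<in> N" "\<And>i. i < k \<Longrightarrow> X i \<in> sections L"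
    "\<And>i. i < k \<Longrightarrow> c i \<in> C_inf A" "\<And>q. q \<in> N \<Longrightarrow> \<eta> q = (\<Sum>i<(k::nat). c i q *\<^sub>R prolong A L (X i) q)"
    by (rule L.jet_section_local[OF \<eta>]) (rule that)
  obtain \<rho> N' where \<rho>: "\<rho> \<in> C_inf A" "\<And>q. q \<notin> N \<Longrightarrow> \<rho> q = 0"
    "open N'" "p \<in> N'" "N' \<subseteq> N" "\<And>q. q \<in> N' \<Longrightarrow> \<rho> q = 1"
    by (rule cutoff[OF N(1,2)]) (rule that)
  let ?\<zeta> = "\<lambda>q. \<Sum>i<k. (\<rho> q * c i q) *\<^sub>R prolong A L (X i) q"
  have "?\<zeta> q = \<rho> q *\<^sub>R (\<Sum>i<k. c i q *\<^sub>R prolong A L (X i) q)" for q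
    by (simp add: scaleR_sum_right)
  then have "\<eta> q = ?\<zeta> q + (1 - \<rho> q) *\<^sub>R \<eta> q" for q
    using N(5)[of q] \<rho>(2)[of q] by (cases "q \<in> N") (simp_all add: scaleR_diff_left)
  then have eq: "\<eta> = (\<lambda>q. ?\<zeta> q + (1 - \<rho> q) *\<^sub>R \<eta> q)" by (rule ext)
  have c: "(\<lambda>q. \<rho> q * c i q) \<in> C_inf A" if "i < k" for i by (rule C_inf_mult[OF \<rho>(1) N(4)[OF that]])
  have r: "(\<lambda>q. 1 - \<rho> q) \<in> C_inf A" by (rule C_inf_diff[OF C_inf_const \<rho>(1)])
  have "projects_bracket \<xi> ?\<zeta> p"
    by (intro projects_bracket_sum \<xi> jet_section_scale projects_bracket_scale disjI1 * c
        L.prolong_jet_section N(3))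
  moreover have "projects_bracket \<xi> (\<lambda>q. (1 - \<rho> q) *\<^sub>R \<eta> q) p"
    by (rule projects_bracket_scale[OF \<xi> \<eta> r]) (simp add: \<rho>(4,6))
  moreover have "?\<zeta> \<in> jet_sections A L"
    by (intro jet_section_sum jet_section_scale c L.prolong_jet_section N(3)) simp_all
  ultimately have "projects_bracket \<xi> (\<lambda>q. ?\<zeta> q + (1 - \<rho> q) *\<^sub>R \<eta> q) p"
    using projects_bracket_add[OF \<xi> _ jet_section_scale[OF r \<eta>]] by blast
  then show ?thesis by (subst eq)
qed

text \<open>The bracket of jets is prescribed on pairs of prolongations only. One argument is
  expanded at a time, with antisymmetry exchanging them in between.\<close>

lemma fst_jet_bracket:
  assumes \<xi>: "\<xi> \<in> jet_sections A L" and \<eta>: "\<eta> \<in> jet_sections A L"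
  shows "fst (br \<xi> \<eta> p) = bracket L (\<lambda>q. fst (\<xi> q)) (\<lambda>q. fst (\<eta> q)) p"
proof -
  have prolong: "projects_bracket (prolong A L X) (prolong A L Y) p"
    if "X \<in> sections L" "Y \<in> sections L" for X Y
    using jet_bracket that by (simp add: projects_bracket_def jet_bracket_def)
  have "projects_bracket \<xi> (prolong A L X) p" if X: "X \<in> sections L" for X
  proof -
    note JX = L.prolong_jet_section[OF X]
    have "projects_bracket (prolong A L X) \<xi> p"
      by (rule projects_bracket_if_prolong[OF JX \<xi> prolong[OF X]])
    then show ?thesis
      using jet_bracket_antisym[OF \<xi> JX, of p] bracket_antisym[OF L.fst_jet_section[OF \<xi>] X, of p]
      by (simp add: projects_bracket_def)
  qed
  then have "projects_bracket \<xi> \<eta> p" by (rule projects_bracket_if_prolong[OF \<xi> \<eta>])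
  then show ?thesis by (simp add: projects_bracket_def)
qed


subsection \<open>Uniqueness of the generator\<close>

text \<open>The common core of both necessity proofs. Condition \<open>*\<close> says that the
  perturbed splitting still maps the image into \<open>g\<close>; it holds when \<alpha> vanishes on
  the image as well as when the jets of \<Psi> lie in \<open>g\<close>. Uniqueness then forces the
  perturbation to vanish.\<close>

lemma unique_generator_rigid:
  assumes unique: "\<And>D'. generator A L g D' \<Longrightarrow> D' = D" and D: "generator A L g D"
    and \<alpha>: "\<alpha> \<in> dual_sections A L"
    and \<Psi>: "bundle_morphism (tangent_bundle A) L \<Psi>" "\<And>p v. v \<notin> tangent_space A p \<Longrightarrow> \<Psi> p v = 0"
    and *: "\<And>p x. x \<in> igs_image g p \<Longrightarrow> \<alpha> p x *\<^sub>R jet_incl A L p (\<Psi> p) \<in> g p"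
    and x: "x \<in> fibre L p"
  shows "\<alpha> p x = 0 \<or> \<Psi> p v = 0"
proof -
  have con: "linear_connection A L D" using D by (simp add: generator_def)
  let ?D' = "\<lambda>X p v. D X p v + (if X \<in> sections L then \<alpha> p (X p) *\<^sub>R \<Psi> p v else 0)"
  have "splitting A L ?D' p x \<in> g p" if x: "x \<in> igs_image g p" for p x
  proof -
    have "x \<in> fibre L p" using image_subset x by blast
    then obtain X where X: "X \<in> sections L" "X p = x" by (rule L.section_through)
    have "splitting A L D p x \<in> g p" using D x by (auto simp: generator_def)
    then show ?thesis
      using L.connection_perturb(2)[OF con \<alpha> \<Psi> X(1), of p] X(2) *[OF x]
        subspace_add[OF structure_subspace] by simp
  qed
  then have "generator A L g ?D'"
    using L.connection_perturb(1)[OF con \<alpha> \<Psi>] by (auto simp: generator_def)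
  then have eq: "?D' = D" by (rule unique)
  obtain X where X: "X \<in> sections L" "X p = x" by (rule L.section_through[OF x])
  show ?thesis using fun_cong[OF fun_cong[OF fun_cong[OF eq, of X], of p], of v] X by simp
qed

text \<open>If the image is a proper subspace, perturb by \<open>\<alpha> \<otimes> df \<otimes> Z\<close> with \<open>\<alpha>\<close> annihilating the image.\<close>

lemma unique_generator_surjective:
  assumes unique: "\<And>D'. generator A L g D' \<Longrightarrow> D' = D" and D: "generator A L g D"
    and rank: "constant_rank g"
  shows "igs_surjective L g"
proof (rule ccontr)
  assume "\<not> ?thesis"
  then obtain p x where x: "x \<in> fibre L p" "x \<notin> igs_image g p"
    using image_subset by (fastforce simp: igs_surjective_def)
  obtain r where r: "\<And>q. dim (igs_image g q) = r" using rank by (auto simp: constant_rank_def)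
  obtain T where T: "T \<subseteq> igs_image g p" "independent T" "igs_image g p \<subseteq> span T" "card T = r"
    using basis_exists[of "igs_image g p"] r by metis
  \<comment> \<open>An infinite set has \<open>card\<close> 0, so the value of \<open>dim\<close>
    alone does not give finiteness; it comes from the finitely spanned fibre.\<close>
  have fin: "finite T" if ind: "independent T" "T \<subseteq> igs_image g q" for T q
  proof -
    obtain S where "finite S" "fibre L q = span S" by (rule L.fibre_finite_span)
    then show ?thesis using independent_span_bound[OF _ ind(1)] ind(2) image_subset[of q] by blast
  qed
  obtain b where b: "bij_betw b {0..<r} T" using ex_bij_betw_nat_finite[OF fin[OF T(2,1)]] T(4) by blast
  then have bij: "inj_on b {..<r}" "b ` {..<r} = T" by (auto simp: bij_betw_def lessThan_atLeast0)
  \<comment> \<open>The basis is lifted to \<open>g\<close> and extended there: the projections of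
    sections of \<open>g\<close> stay in the image at every point.\<close>
  have "\<exists>\<xi>. \<xi> \<in> sections structure_bundle \<and> fst (\<xi> p) = b i" if "i < r" for i
  proof -
    have "b i \<in> igs_image g p" using bij(2) T(1) that by blast
    then obtain y where y: "y \<in> g p" "fst y = b i" by (auto simp: igs_image_def)
    have "y \<in> fibre structure_bundle p" using y by simp
    then show ?thesis using G.section_through y(2) by metis
  qed
  then obtain \<xi> where \<xi>: "\<And>i. i < r \<Longrightarrow> \<xi> i \<in> sections structure_bundle" "\<And>i. i < r \<Longrightarrow> fst (\<xi> i p) = b i"
    by metis
  define Z where "Z i q = fst (\<xi> i q)" for i q
  have Z: "Z i \<in> sections L" if "i < r" for i
    using L.fst_jet_section \<xi>(1)[OF that] by (simp add: Z_def[abs_def])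
  have Zg: "Z i q \<in> igs_image g q" if "i < r" for i q
    using \<xi>(1)[OF that] by (auto simp: Z_def igs_image_def)
  have Zp: "(\<lambda>i. Z i p) ` {..<r} = T" "inj_on (\<lambda>i. Z i p) {..<r}"
    using bij \<xi>(2) by (auto simp: Z_def image_def inj_on_def)
  obtain N where N: "open N" "p \<in> N" "\<And>q. q \<in> N \<Longrightarrow> inj_on (\<lambda>i. Z i q) {..<r}"
    "\<And>q. q \<in> N \<Longrightarrow> independent ((\<lambda>i. Z i q) ` {..<r})"
    by (rule L.independent_near[where Z = Z and p = p and k = r, OF _ Zp(2)])
      (use Z Zp T(2) that in auto)
  \<comment> \<open>Constant rank at work: a vector of the image outside this span would yield r + 1
    independent vectors in a space of dimension r.\<close>
  have span: "igs_image g q \<subseteq> span ((\<lambda>i. Z i q) ` {..<r})" if q: "q \<in> N" for q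
  proof -
    let ?T = "(\<lambda>i. Z i q) ` {..<r}"
    have sub: "?T \<subseteq> igs_image g q" using Zg by auto
    have "card ?T = r" using N(3)[OF q] by (simp add: card_image)
    show ?thesis
    proof
      fix y assume y: "y \<in> igs_image g q"
      show "y \<in> span ?T"
      proof (rule ccontr)
        assume n: "y \<notin> span ?T"
        then have ind: "independent (insert y ?T)" using N(4)[OF q] by (simp add: independent_insert)
        obtain T' where T': "T' \<subseteq> igs_image g q" "independent T'" "igs_image g q \<subseteq> span T'" "card T' = r"
          using basis_exists[of "igs_image g q"] r by metis
        have "card (insert y ?T) \<le> card T'"
          using independent_span_bound[OF fin[OF T'(2,1)] ind] sub y T'(3) by blast
        moreover have "card (insert y ?T) = Suc r"
          using n span_base \<open>card ?T = r\<close> by (metis card_insert_disjoint finite_imageI finite_lessThan)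
        ultimately show False using T'(4) by simp
      qed
    qed
  qed
  have xn: "x \<notin> span ((\<lambda>s. s p) ` Z ` {..<r})"
  proof -
    have "span T \<subseteq> igs_image g p" using T(1) image_subspace by (simp add: span_minimal)
    then show ?thesis using x(2) Zp(1) by (auto simp: image_image)
  qed
  have "inj_on (\<lambda>s. s p) (Z ` {..<r})" using Zp(2) by (auto simp: inj_on_def)
  moreover have "independent ((\<lambda>s. s p) ` Z ` {..<r})" using T(2) Zp(1) by (simp add: image_image)
  moreover have "Z ` {..<r} \<subseteq> sections L" using Z by auto
  ultimately have "\<exists>\<alpha> N. \<alpha> \<in> dual_sections A L \<and> open N \<and> p \<in> N \<and> \<alpha> p x \<noteq> 0 \<and>
      (\<forall>q\<in>N. \<forall>s\<in>Z ` {..<r}. \<alpha> q (s q) = 0)"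
    by (intro L.annihilator xn x(1)) simp_all
  then obtain \<alpha> N' where \<alpha>: "\<alpha> \<in> dual_sections A L" "open N'" "p \<in> N'" "\<alpha> p x \<noteq> 0"
    "\<forall>q\<in>N'. \<forall>s\<in>Z ` {..<r}. \<alpha> q (s q) = 0"
    by (elim exE conjE) (rule that)
  have "open (N \<inter> N')" "p \<in> N \<inter> N'" using N(1,2) \<alpha>(2,3) by auto
  then obtain \<rho> N'' where \<rho>: "\<rho> \<in> C_inf A" "\<And>q. q \<notin> N \<inter> N' \<Longrightarrow> \<rho> q = 0"
    "open N''" "p \<in> N''" "N'' \<subseteq> N \<inter> N'" "\<And>q. q \<in> N'' \<Longrightarrow> \<rho> q = 1"
    by (rule cutoff) (rule that)
  \<comment> \<open>\<alpha> is known to annihilate the image only on N \<inter> N'; the factor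
    \<rho> extends this to every point and keeps the value at p.\<close>
  let ?\<beta> = "\<lambda>q y. \<rho> q * \<alpha> q y"
  have \<beta>: "?\<beta> \<in> dual_sections A L" by (rule L.dual_scale_fun[OF \<rho>(1) \<alpha>(1)])
  have kill: "?\<beta> q y = 0" if y: "y \<in> igs_image g q" for q y
  proof (cases "q \<in> N \<inter> N'")
    case True
    then obtain a where "y = (\<Sum>i<r. a i *\<^sub>R Z i q)"
      using span_frame[OF N(3)[of q], of y] span[of q] y by blast
    moreover have "\<alpha> q (\<Sum>i<r. a i *\<^sub>R Z i q) = (\<Sum>i<r. \<alpha> q (a i *\<^sub>R Z i q))"
      by (rule L.dual_sum[OF \<alpha>(1)]) (use Z in \<open>auto intro: L.fibre_scale L.section_fibre\<close>)
    moreover have "\<alpha> q (a i *\<^sub>R Z i q) = 0" if "i < r" for i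
      using L.dual_scale[OF \<alpha>(1) L.section_fibre[OF Z[OF that]]] \<alpha>(5) True that by simp
    ultimately show ?thesis by simp
  qed (simp add: \<rho>(2))
  obtain f v where f: "f \<in> C_inf A" "v \<in> tangent_space A p" "v f \<noteq> 0" by (rule tangent_space_nontrivial)
  obtain Y where Y: "Y \<in> sections L" "Y p = x" by (rule L.section_through[OF x(1)])
  \<comment> \<open>The tensor \<open>df \<otimes> Y\<close>, extended by 0. Its value on v at p is
    a nonzero multiple of x, and x is nonzero because it lies outside a subspace.\<close>
  define \<Psi> where "\<Psi> q w = (if w \<in> tangent_space A q then w f *\<^sub>R Y q else 0)" for q w
  have \<Psi>: "bundle_morphism (tangent_bundle A) L \<Psi>"
  proof (rule L.morphismI)
    fix V assume V: "\<And>p. V p \<in> tangent_space A p" "\<And>f. f \<in> C_inf A \<Longrightarrow> (\<lambda>p. V p f) \<in> C_inf A"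
    show "(\<lambda>p. \<Psi> p (V p)) \<in> sections L"
      using L.section_scale[OF V(2)[OF f(1)] Y(1)] V(1) by (simp add: \<Psi>_def)
  qed (simp_all add: \<Psi>_def L.tangent_vector_add_closed L.tangent_vector_scale_closed
      scaleR_add_left L.fibre_scale L.section_fibre Y(1))
  have "?\<beta> q y *\<^sub>R jet_incl A L q (\<Psi> q) \<in> g q" if "y \<in> igs_image g q" for q y
    unfolding kill[OF that] using subspace_0[OF structure_subspace] by simp
  from unique_generator_rigid[OF unique D \<beta> \<Psi> _ this x(1), of v]
  have "?\<beta> p x = 0 \<or> \<Psi> p v = 0" by (simp add: \<Psi>_def)
  moreover have "?\<beta> p x \<noteq> 0" using \<alpha>(4) \<rho>(4,6) by simp
  moreover have "x \<noteq> 0" using x(2) subspace_0[OF image_subspace] by blast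
  then have "\<Psi> p v \<noteq> 0" using f(2,3) Y(2) by (simp add: \<Psi>_def)
  ultimately show False by blast
qed

text \<open>A section \<xi> of \<open>g\<close> through a vector of the kernel may leave the kernel
  at other points. Its projection X takes values in the image, so the generator maps X into
  \<open>g\<close>, and the corrected section is a section of the kernel. Since X p = 0, the
  correction does not change the value at p.\<close>

lemma unique_generator_kernel:
  assumes unique: "\<And>D'. generator A L g D' \<Longrightarrow> D' = D" and D: "generator A L g D"
  shows "structure_kernel g p = {0}"
proof (rule ccontr)
  assume "\<not> ?thesis"
  moreover have "0 \<in> structure_kernel g p"
    using subspace_0[OF structure_subspace] by (simp add: structure_kernel_def)
  ultimately obtain \<phi> where \<phi>: "\<phi> \<in> g p" "fst \<phi> = 0" "\<phi> \<noteq> 0" by (auto simp: structure_kernel_def)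
  have con: "linear_connection A L D" using D by (simp add: generator_def)
  have "\<phi> \<in> fibre structure_bundle p" using \<phi> by simp
  then obtain \<xi> where \<xi>: "\<xi> \<in> sections structure_bundle" "\<xi> p = \<phi>" by (rule G.section_through)
  then have \<xi>J: "\<xi> \<in> jet_sections A L" by simp
  define X where "X = (\<lambda>q. fst (\<xi> q))"
  have X: "X \<in> sections L" unfolding X_def by (rule L.fst_jet_section[OF \<xi>J])
  obtain \<Psi> where \<Psi>: "bundle_morphism (tangent_bundle A) L \<Psi>"
    "\<And>q v. v \<notin> tangent_space A q \<Longrightarrow> \<Psi> q v = 0"
    "\<And>q. \<xi> q = prolong A L (\<lambda>q. fst (\<xi> q)) q + jet_incl A L q (\<Psi> q)"
    by (rule L.jet_section_split[OF \<xi>J]) (rule that)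
  define \<Phi> where "\<Phi> q v = \<Psi> q v + (- 1) *\<^sub>R D X q v" for q v
  note \<Psi>' = L.morphismD[OF \<Psi>(1)] and DX = L.morphismD[OF L.connectionD(1)[OF con X]]
  have \<Phi>: "bundle_morphism (tangent_bundle A) L \<Phi>"
  proof (rule L.morphismI)
    fix V assume V: "\<And>p. V p \<in> tangent_space A p" "\<And>f. f \<in> C_inf A \<Longrightarrow> (\<lambda>p. V p f) \<in> C_inf A"
    show "(\<lambda>p. \<Phi> p (V p)) \<in> sections L" unfolding \<Phi>_def
      by (intro L.section_add L.section_scale[OF C_inf_const] \<Psi>'(4) DX(4) V)
  next
    show "\<Phi> p v \<in> fibre L p" if "v \<in> tangent_space A p" for p v
      unfolding \<Phi>_def by (intro L.fibre_add L.fibre_scale \<Psi>'(3) DX(3) that)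
  qed (simp_all add: \<Phi>_def \<Psi>'(1,2) DX(1,2) algebra_simps)
  have \<Phi>0: "\<Phi> q v = 0" if "v \<notin> tangent_space A q" for q v
    using \<Psi>(2)[OF that] L.connectionD(5)[OF con that] by (simp add: \<Phi>_def)
  have incl: "jet_incl A L q (\<Phi> q) = \<xi> q - splitting A L D q (X q)" for q
  proof -
    have "jet_incl A L q (\<lambda>v. \<Psi> q v + (- 1) *\<^sub>R D X q v) =
        jet_incl A L q (\<Psi> q) + jet_incl A L q (\<lambda>v. (- 1) *\<^sub>R D X q v)"
      by (rule L.jet_incl_add) (intro \<Psi>'(3) L.fibre_scale DX(3); assumption)+
    also have "jet_incl A L q (\<lambda>v. (- 1) *\<^sub>R D X q v) = (- 1) *\<^sub>R jet_incl A L q (D X q)"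
      by (rule L.jet_incl_scale) (rule DX(3))
    finally have e: "jet_incl A L q (\<Phi> q) = jet_incl A L q (\<Psi> q) + (- 1) *\<^sub>R jet_incl A L q (D X q)"
      unfolding \<Phi>_def[abs_def] .
    have "\<xi> q = prolong A L X q + jet_incl A L q (\<Psi> q)" using \<Psi>(3)[of q] unfolding X_def .
    then show ?thesis using L.splitting_section[OF con X, of q] by (simp add: e)
  qed
  have in_g: "jet_incl A L q (\<Phi> q) \<in> g q" for q
  proof -
    have "\<xi> q \<in> g q" using \<xi>(1) by simp
    moreover have "X q \<in> igs_image g q" using calculation by (auto simp: X_def igs_image_def)
    then have "splitting A L D q (X q) \<in> g q" using D by (auto simp: generator_def)
    ultimately show ?thesis unfolding incl by (intro subspace_diff[OF structure_subspace])
  qed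
  have X0: "X p = 0" using \<xi>(2) \<phi>(2) by (simp add: X_def)
  have "splitting A L D p (X p) = 0"
    using L.splitting_section[OF con X, of p] L.splitting_vanishing[OF con X, of p] X0 by simp
  then have \<phi>_eq: "jet_incl A L p (\<Phi> p) = \<phi>" using incl[of p] \<xi>(2) by simp
  have "\<exists>v\<in>tangent_space A p. \<Phi> p v \<noteq> 0"
  proof (rule ccontr)
    assume "\<not> ?thesis"
    then have "jet_incl A L p (\<Phi> p) = jet_incl A L p (\<lambda>v. 0)" by (intro L.jet_incl_cong) auto
    then show False using \<phi>_eq \<phi>(3) L.jet_incl_zero by simp
  qed
  then obtain v where v: "v \<in> tangent_space A p" "\<Phi> p v \<noteq> 0" by blast
  have fib: "\<Phi> p v \<in> fibre L p" by (rule L.morphismD(3)[OF \<Phi> v(1)])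
  \<comment> \<open>The nonzero vector \<Phi> p v also serves as the point of the fibre at which
    \<alpha> is tested.\<close>
  obtain \<alpha> where \<alpha>: "\<alpha> \<in> dual_sections A L" "\<alpha> p (\<Phi> p v) \<noteq> 0"
    by (rule L.dual_separates[OF fib v(2)])
  have "\<alpha> q x *\<^sub>R jet_incl A L q (\<Phi> q) \<in> g q" for q x
    by (rule subspace_scale[OF structure_subspace in_g])
  from unique_generator_rigid[OF unique D \<alpha>(1) \<Phi> \<Phi>0 this fib, of v] show False
    using \<alpha>(2) v(2) by blast
qed

end


subsection \<open>The Cartan connection of a surjective structure with trivial kernel\<close>

locale cartan_structure = jet_structure A L br g
  for A :: "('m::{t2_space, second_countable_topology}, 'e::euclidean_space) atlas"
    and L :: "('m, 'v::real_vector) algebroid" and br g +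
  assumes surjective: "igs_surjective L g" and kernel: "structure_kernel g p = {0}"
begin

section \<open>The inverse of the projection and its smoothness\<close>

lemma image_eq: "igs_image g p = fibre L p"
  using surjective by (simp add: igs_surjective_def)

lemma fst_inject:
  assumes "\<xi> \<in> g p" "\<eta> \<in> g p" "fst \<xi> = fst \<eta>"
  shows "\<xi> = \<eta>"
proof -
  have "\<xi> - \<eta> \<in> structure_kernel g p"
    using subspace_diff[OF structure_subspace assms(1,2)] assms(3) by (simp add: structure_kernel_def)
  then show ?thesis using kernel by simp
qed

definition lift :: "'m \<Rightarrow> 'v \<Rightarrow> ('m, 'v) jet" where
  "lift p x = (THE \<xi>. \<xi> \<in> g p \<and> fst \<xi> = x)"

lemma lift:
  assumes "x \<in> fibre L p"
  shows lift_in: "lift p x \<in> g p" and fst_lift: "fst (lift p x) = x"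
proof -
  have "x \<in> fst ` g p" using assms image_eq[of p] by (simp add: igs_image_def)
  then obtain \<xi> where "\<xi> \<in> g p" "fst \<xi> = x" by blast
  then have "\<exists>!\<xi>. \<xi> \<in> g p \<and> fst \<xi> = x" using fst_inject by blast
  from theI'[OF this] show "lift p x \<in> g p" "fst (lift p x) = x" by (auto simp: lift_def)
qed

lemma lift_eq: "\<xi> \<in> g p \<Longrightarrow> fst \<xi> = x \<Longrightarrow> lift p x = \<xi>"
  using fst_inject lift fst_structure by metis

lemma lift_add: "x \<in> fibre L p \<Longrightarrow> y \<in> fibre L p \<Longrightarrow> lift p (x + y) = lift p x + lift p y"
  by (rule lift_eq) (simp_all add: lift subspace_add[OF structure_subspace])

lemma lift_scale: "x \<in> fibre L p \<Longrightarrow> lift p (c *\<^sub>R x) = c *\<^sub>R lift p x"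
  by (rule lift_eq) (simp_all add: lift subspace_scale[OF structure_subspace])

lemma lift_section:
  assumes X: "X \<in> sections L"
  shows "(\<lambda>q. lift q (X q)) \<in> sections structure_bundle"
proof (rule G.section_local)
  fix p
  obtain N k \<xi> where p: "p \<in> N" and "G.frame N k \<xi>" by (rule G.local_frame)
  note \<xi> = G.frameD[OF this(2)]
  define Z where "Z i q = fst (\<xi> i q)" for i q
  have Z: "Z i \<in> sections L" if "i < k" for i
    using L.fst_jet_section \<xi>(2)[OF that] by (simp add: Z_def[abs_def])
  have \<xi>g: "\<xi> i q \<in> g q" if "i < k" for i q using \<xi>(2)[OF that] by simp
  have inj: "inj_on (\<lambda>i. Z i p) {..<k}"
    using \<xi>(3)[OF p] fst_inject \<xi>g unfolding inj_on_def Z_def by (metis lessThan_iff)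
  have "inj_on fst (span ((\<lambda>i. \<xi> i p) ` {..<k}))"
    using \<xi>(5)[OF p] fst_inject by (auto simp: inj_on_def)
  from linear_independent_injective_image[OF linear_fst \<xi>(4)[OF p] this]
  have ind: "independent ((\<lambda>i. Z i p) ` {..<k})" by (simp add: Z_def image_image)
  obtain \<alpha> N' where \<alpha>: "open N'" "p \<in> N'" "\<And>i. i < k \<Longrightarrow> \<alpha> i \<in> dual_sections A L"
    "\<And>i q. i < k \<Longrightarrow> q \<in> N' \<Longrightarrow> \<alpha> i q (Z i q) \<noteq> 0"
    "\<And>i j q. i < k \<Longrightarrow> j < k \<Longrightarrow> i \<noteq> j \<Longrightarrow> q \<in> N' \<Longrightarrow> \<alpha> i q (Z j q) = 0"
    by (rule L.dual_coframe[where Z = Z and p = p and k = k, OF _ inj ind]) (erule Z, rule that)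
  have cs: "smooth_fun A N' (\<lambda>q. \<alpha> i q (X q) * inverse (\<alpha> i q (Z i q)))" if "i < k" for i
    using L.dual_smooth[OF \<alpha>(3)[OF that] X] L.dual_smooth[OF \<alpha>(3)[OF that] Z[OF that]] \<alpha>(1,4) that
    by (intro smooth_fun_mult smooth_fun_inverse) (auto intro: smooth_fun_subset)
  obtain N'' where N'': "open N''" "p \<in> N''" "N'' \<subseteq> N'"
    "\<And>c. smooth_fun A N' c \<Longrightarrow> \<exists>c'\<in>C_inf A. \<forall>q\<in>N''. c' q = c q"
    by (rule extend_germ[OF \<alpha>(1,2)]) (rule that)
  have "\<exists>c. i < k \<longrightarrow> c \<in> C_inf A \<and> (\<forall>q\<in>N''. c q = \<alpha> i q (X q) * inverse (\<alpha> i q (Z i q)))" for i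
    using N''(4)[OF cs, of i] by blast
  then obtain c where c: "\<And>i. i < k \<Longrightarrow> c i \<in> C_inf A"
    "\<And>i q. i < k \<Longrightarrow> q \<in> N'' \<Longrightarrow> c i q = \<alpha> i q (X q) * inverse (\<alpha> i q (Z i q))"
    by metis
  have "lift q (X q) = (\<Sum>i<k. c i q *\<^sub>R \<xi> i q)" if q: "q \<in> N \<inter> N''" for q
  proof -
    have qN: "q \<in> N" "q \<in> N''" "q \<in> N'" using q N''(3) by auto
    have Xq: "X q \<in> fibre L q" by (rule L.section_fibre[OF X])
    have "lift q (X q) \<in> span ((\<lambda>i. \<xi> i q) ` {..<k})" using lift_in[OF Xq] \<xi>(5)[OF qN(1)] by simp
    then obtain b where b: "lift q (X q) = (\<Sum>i<k. b i *\<^sub>R \<xi> i q)" by (rule span_frame[OF \<xi>(3)[OF qN(1)]])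
    then have "X q = (\<Sum>i<k. b i *\<^sub>R Z i q)"
      using fst_lift[OF Xq] by (simp add: L.fst_combination Z_def)
    then have "\<alpha> i q (X q) = b i * \<alpha> i q (Z i q)" if "i < k" for i
      using L.dual_coframe_coeff[of k "\<lambda>i. Z i q" q "\<alpha> i" i b] that \<alpha>(3,5) qN(3)
        L.section_fibre[OF Z] by simp
    then have "c i q = b i" if "i < k" for i using c(2)[OF that qN(2)] \<alpha>(4)[OF that qN(3)] that by simp
    then show ?thesis using b by simp
  qed
  moreover have "(\<lambda>q. \<Sum>i<k. c i q *\<^sub>R \<xi> i q) \<in> sections structure_bundle"
    by (intro G.section_sum G.section_scale c(1) \<xi>(2)) simp_all
  moreover have "open (N \<inter> N'')" "p \<in> N \<inter> N''" using \<xi>(1) p N''(1,2) by auto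
  ultimately show "\<exists>N t. open N \<and> p \<in> N \<and> t \<in> sections structure_bundle \<and> (\<forall>q\<in>N. lift q (X q) = t q)"
    by blast
qed

lemma lift_jet_section: "X \<in> sections L \<Longrightarrow> (\<lambda>q. lift q (X q)) \<in> jet_sections A L"
  using lift_section by simp

text \<open>The jet on the left always projects to X p, so it lies in \<open>g\<close> exactly when
  it is the lift. This trades the pointwise splitting for an equation between sections.\<close>

lemma generator_iff:
  "generator A L g D \<longleftrightarrow> linear_connection A L D \<and>
     (\<forall>X\<in>sections L. \<forall>p. prolong A L X p + jet_incl A L p (D X p) = lift p (X p))"
proof (cases "linear_connection A L D")
  case True
  have "(\<forall>x\<in>fibre L p. splitting A L D p x \<in> g p) \<longleftrightarrow>
      (\<forall>X\<in>sections L. prolong A L X p + jet_incl A L p (D X p) = lift p (X p))" for p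
  proof (intro iffI ballI)
    fix X assume *: "\<forall>x\<in>fibre L p. splitting A L D p x \<in> g p" and X: "X \<in> sections L"
    have "prolong A L X p + jet_incl A L p (D X p) \<in> g p"
      using * L.section_fibre[OF X] L.splitting_section[OF True X] by metis
    then show "prolong A L X p + jet_incl A L p (D X p) = lift p (X p)"
      by (intro lift_eq[symmetric]) simp_all
  next
    fix x assume *: "\<forall>X\<in>sections L. prolong A L X p + jet_incl A L p (D X p) = lift p (X p)"
      and x: "x \<in> fibre L p"
    obtain X where X: "X \<in> sections L" "X p = x" by (rule L.section_through[OF x])
    then show "splitting A L D p x \<in> g p"
      using * L.splitting_section[OF True X(1), of p] lift_in[OF x] by simp
  qed
  then show ?thesis using True unfolding generator_def image_eq image_subset_iff by blast
qed (simp add: generator_def)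

lemma generator_unique:
  assumes D: "generator A L g D" and D': "generator A L g D'"
  shows "D = D'"
proof (intro ext)
  fix X p v
  have con: "linear_connection A L D" "linear_connection A L D'"
    using assms by (simp_all add: generator_def)
  show "D X p v = D' X p v"
  proof (cases "X \<in> sections L \<and> v \<in> tangent_space A p")
    case True
    then have "prolong A L X p + jet_incl A L p (D X p) = prolong A L X p + jet_incl A L p (D' X p)"
      using assms unfolding generator_iff by simp
    then have eq: "jet_incl A L p (D X p) = jet_incl A L p (D' X p)" by simp
    have X: "X \<in> sections L" and v: "v \<in> tangent_space A p" using True by simp_all
    show ?thesis
      by (rule L.jet_incl_inject[where \<phi> = "D X p" and \<psi> = "D' X p" and v = v, OF eq v
            L.connection_fibre[OF con(1) X v] L.connection_fibre[OF con(2) X v]])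
  qed (use L.connectionD(4,5)[OF con(1)] L.connectionD(4,5)[OF con(2)] in auto)
qed

text \<open>The derivative part of the lift of X, relative to the prolongation of X, is taken as D
  X. By injectivity of \<open>jet_incl\<close> the axioms of a connection can be compared as jets:
  the lift is linear over functions, so the derivative term in the Leibniz rule of D offsets the one
  in the rule for prolongations.\<close>

lemma generator_exists: "\<exists>D. generator A L g D"
proof -
  have "\<forall>X\<in>sections L. \<exists>\<Psi>. bundle_morphism (tangent_bundle A) L \<Psi> \<and>
      (\<forall>p v. v \<notin> tangent_space A p \<longrightarrow> \<Psi> p v = 0) \<and>
      (\<forall>p. lift p (X p) = prolong A L X p + jet_incl A L p (\<Psi> p))"
  proof
    fix X assume X: "X \<in> sections L"
    obtain \<Psi> where "bundle_morphism (tangent_bundle A) L \<Psi>"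
      "\<And>p v. v \<notin> tangent_space A p \<Longrightarrow> \<Psi> p v = 0"
      "\<And>p. lift p (X p) = prolong A L (\<lambda>q. fst (lift q (X q))) p + jet_incl A L p (\<Psi> p)"
      by (rule L.jet_section_split[OF lift_jet_section[OF X]]) (rule that)
    then show "\<exists>\<Psi>. bundle_morphism (tangent_bundle A) L \<Psi> \<and>
      (\<forall>p v. v \<notin> tangent_space A p \<longrightarrow> \<Psi> p v = 0) \<and>
      (\<forall>p. lift p (X p) = prolong A L X p + jet_incl A L p (\<Psi> p))"
      using fst_lift[OF L.section_fibre[OF X]] by auto
  qed
  from bchoice[OF this] obtain \<Psi> where \<Psi>:
    "\<And>X. X \<in> sections L \<Longrightarrow> bundle_morphism (tangent_bundle A) L (\<Psi> X)"
    "\<And>X p v. X \<in> sections L \<Longrightarrow> v \<notin> tangent_space A p \<Longrightarrow> \<Psi> X p v = 0"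
    "\<And>X p. X \<in> sections L \<Longrightarrow> lift p (X p) = prolong A L X p + jet_incl A L p (\<Psi> X p)"
    by blast
  \<comment> \<open>\<open>bchoice\<close> says nothing about \<Psi> off the smooth sections, where
    a connection has to be 0.\<close>
  define D where "D X p v = (if X \<in> sections L then \<Psi> X p v else 0)" for X p v
  have D: "D X = \<Psi> X" if "X \<in> sections L" for X using that by (intro ext) (simp add: D_def)
  have fib: "\<Psi> X p v \<in> fibre L p" if "X \<in> sections L" "v \<in> tangent_space A p" for X p v
    by (rule L.morphismD(3)[OF \<Psi>(1)[OF that(1)] that(2)])
  have eq: "\<Psi> X p v = \<phi> v"
    if X: "X \<in> sections L" and v: "v \<in> tangent_space A p" and \<phi>: "\<phi> v \<in> fibre L p"
      and e: "lift p (X p) = prolong A L X p + jet_incl A L p \<phi>" for X p v \<phi>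
    by (rule L.jet_incl_inject[where \<phi> = "\<Psi> X p" and \<psi> = \<phi> and v = v,
        OF _ v fib[OF X v] \<phi>]) (use \<Psi>(3)[OF X, of p] e in simp)
  have "linear_connection A L D"
    unfolding linear_connection_def
  proof (intro conjI ballI allI impI)
    fix X assume X: "X \<in> sections L"
    show "bundle_morphism (tangent_bundle A) L (D X)" using \<Psi>(1)[OF X] D[OF X] by simp
    fix p v assume v: "v \<in> tangent_space A p"
    show "D (\<lambda>q. X q + Y q) p v = D X p v + D Y p v" if Y: "Y \<in> sections L" for Y
    proof -
      have "jet_incl A L p (\<lambda>v. \<Psi> X p v + \<Psi> Y p v) = jet_incl A L p (\<Psi> X p) + jet_incl A L p (\<Psi> Y p)"
        by (rule L.jet_incl_add) (intro fib X Y; assumption)+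
      then have "lift p (X p + Y p) =
          prolong A L (\<lambda>q. X q + Y q) p + jet_incl A L p (\<lambda>v. \<Psi> X p v + \<Psi> Y p v)"
        using L.prolong_add[OF X Y, of p] \<Psi>(3)[OF X, of p] \<Psi>(3)[OF Y, of p]
          lift_add[OF L.section_fibre[OF X] L.section_fibre[OF Y], of p] by (simp add: algebra_simps)
      from eq[where X = "\<lambda>q. X q + Y q" and \<phi> = "\<lambda>v. \<Psi> X p v + \<Psi> Y p v",
          OF L.section_add[OF X Y] v L.fibre_add[OF fib[OF X v] fib[OF Y v]] this]
      show ?thesis unfolding D[OF X] D[OF Y] D[OF L.section_add[OF X Y]] .
    qed
    show "D (\<lambda>q. f q *\<^sub>R X q) p v = v f *\<^sub>R X p + f p *\<^sub>R D X p v" if f: "f \<in> C_inf A" for f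
    proof -
      have fX: "\<And>v :: 'm tangent. v f *\<^sub>R X p \<in> fibre L p" by (intro L.fibre_scale L.section_fibre X)
      have "jet_incl A L p (\<lambda>v. v f *\<^sub>R X p + f p *\<^sub>R \<Psi> X p v) =
          jet_incl A L p (\<lambda>v. v f *\<^sub>R X p) + jet_incl A L p (\<lambda>v. f p *\<^sub>R \<Psi> X p v)"
        by (rule L.jet_incl_add) (intro fX L.fibre_scale fib X; assumption)+
      also have "jet_incl A L p (\<lambda>v. f p *\<^sub>R \<Psi> X p v) = f p *\<^sub>R jet_incl A L p (\<Psi> X p)"
        by (rule L.jet_incl_scale) (rule fib[OF X])
      finally have l: "lift p (f p *\<^sub>R X p) =
          prolong A L (\<lambda>q. f q *\<^sub>R X q) p + jet_incl A L p (\<lambda>v. v f *\<^sub>R X p + f p *\<^sub>R \<Psi> X p v)"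
        using L.prolong_scale[OF f X, of p] \<Psi>(3)[OF X, of p] lift_scale[OF L.section_fibre[OF X], of p]
        by (simp add: algebra_simps)
      have fib': "v f *\<^sub>R X p + f p *\<^sub>R \<Psi> X p v \<in> fibre L p"
        by (rule L.fibre_add[OF fX L.fibre_scale[OF fib[OF X v]]])
      from eq[where X = "\<lambda>q. f q *\<^sub>R X q" and p = p and v = v
          and \<phi> = "\<lambda>v. v f *\<^sub>R X p + f p *\<^sub>R \<Psi> X p v",
          OF L.section_scale[OF f X] v fib' l]
      show ?thesis unfolding D[OF X] D[OF L.section_scale[OF f X]] .
    qed
  qed (auto simp: D_def \<Psi>(2))
  then have "generator A L g D" unfolding generator_iff using \<Psi>(3) D by simp
  then show ?thesis by blast
qed

lemma generator_splitting:
  assumes "generator A L g D" "x \<in> fibre L p"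
  shows "splitting A L D p x = lift p x"
proof -
  have con: "linear_connection A L D" using assms(1) by (simp add: generator_def)
  obtain X where X: "X \<in> sections L" "X p = x" by (rule L.section_through[OF assms(2)])
  then show ?thesis
    using L.splitting_section[OF con X(1), of p] assms(1) unfolding generator_iff by simp
qed

text \<open>The bracket of two lifts is identified through \<open>lift_eq\<close>. Compatibility of
  the anchors is \<open>fst_lift\<close>, because the anchor of jets factors through
  \<open>fst\<close>.\<close>

lemma generator_cartan:
  assumes D: "generator A L g D"
  shows "cartan_connection A L br D"
proof -
  have split: "splitting A L D p (X p) = lift p (X p)" if "X \<in> sections L" for X p
    by (rule generator_splitting[OF D L.section_fibre[OF that]])
  have "bundle_morphism L (jet_algebroid A L br) (splitting A L D)"
    unfolding bundle_morphism_def linear_between_def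
    using lift_in structure_subset L.fibre_add L.fibre_scale lift_jet_section split
    by (auto simp: generator_splitting[OF D] lift_add lift_scale)
  moreover have "splitting A L D p (bracket L X Y p) =
      br (\<lambda>p. splitting A L D p (X p)) (\<lambda>p. splitting A L D p (Y p)) p"
    if X: "X \<in> sections L" and Y: "Y \<in> sections L" for X Y p
    unfolding split[OF X] split[OF Y] split[OF bracket_section[OF X Y]]
  proof (rule lift_eq)
    show "br (\<lambda>p. lift p (X p)) (\<lambda>p. lift p (Y p)) p \<in> g p"
      by (rule structure_bracket[OF lift_section[OF X] lift_section[OF Y]])
    show "fst (br (\<lambda>p. lift p (X p)) (\<lambda>p. lift p (Y p)) p) = bracket L X Y p"
      unfolding fst_jet_bracket[OF lift_jet_section[OF X] lift_jet_section[OF Y]]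
      by (simp add: fst_lift L.section_fibre X Y)
  qed
  ultimately show ?thesis
    using D unfolding cartan_connection_def algebroid_morphism_def generator_def
    by (auto simp: generator_splitting[OF D] fst_lift)
qed

text \<open>The prolongation of W plus its derivative part is the unique element of \<open>g\<close>
  over W. So the prolongation lies in \<open>g\<close> exactly when it is itself this element, that
  is, when the derivative part is 0.\<close>

lemma generator_parallel:
  assumes D: "generator A L g D"
  shows "parallel L D W \<longleftrightarrow> symmetry A L g W"
proof (cases "W \<in> sections L")
  case W: True
  have con: "linear_connection A L D" using D by (simp add: generator_def)
  have lift: "prolong A L W p + jet_incl A L p (D W p) = lift p (W p)" for p
    using D W unfolding generator_iff by blast
  have "(\<forall>v. D W p v = 0) \<longleftrightarrow> prolong A L W p \<in> g p" for p
  proof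
    assume "\<forall>v. D W p v = 0"
    then have "jet_incl A L p (D W p) = 0" using L.jet_incl_zero by (simp add: fun_eq_iff[symmetric])
    then show "prolong A L W p \<in> g p" using lift[of p] lift_in[OF L.section_fibre[OF W], of p] by simp
  next
    assume "prolong A L W p \<in> g p"
    then have "lift p (W p) = prolong A L W p" by (rule lift_eq) simp
    then have eq: "jet_incl A L p (D W p) = jet_incl A L p (\<lambda>v. 0)"
      using lift[of p] L.jet_incl_zero by simp
    show "\<forall>v. D W p v = 0"
    proof
      fix v
      show "D W p v = 0"
      proof (cases "v \<in> tangent_space A p")
        case True
        show ?thesis
          by (rule L.jet_incl_inject[where \<phi> = "D W p" and \<psi> = "\<lambda>v. 0" and v = v,
              OF eq True L.connection_fibre[OF con W True] L.fibre_zero])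
      qed (rule L.connectionD(5)[OF con])
    qed
  qed
  then show ?thesis using W by (simp add: parallel_def symmetry_def)
qed (simp add: parallel_def symmetry_def)

end

theorem theorem2p1:
  fixes A :: "('m::{t2_space, second_countable_topology}, 'e::euclidean_space) atlas"
    and L :: "('m, 'v::real_vector) algebroid"
    and br :: "('m \<Rightarrow> ('m, 'v) jet) \<Rightarrow> ('m \<Rightarrow> ('m, 'v) jet) \<Rightarrow> 'm \<Rightarrow> ('m, 'v) jet"
    and g :: "'m \<Rightarrow> ('m, 'v) jet set"
  assumes "smooth_manifold A"
    and "lie_algebroid A L"
    and "jet_bracket A L br"
    and "infinitesimal_geometric_structure A L br g"
    and "constant_rank g"
  shows "((\<exists>!D. generator A L g D) \<longleftrightarrow>
            igs_surjective L g \<and> (\<forall>p. structure_kernel g p = {0})) \<and>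
         ((\<exists>!D. generator A L g D) \<longrightarrow>
            (\<forall>D. generator A L g D \<longrightarrow>
               cartan_connection A L br D \<and> (\<forall>W. parallel L D W \<longleftrightarrow> symmetry A L g W)))"
proof -
  interpret jet_structure A L br g
    using assms by unfold_locales
  have forward: "igs_surjective L g \<and> (\<forall>p. structure_kernel g p = {0})"
    if ex: "\<exists>!D. generator A L g D"
  proof -
    obtain D where D: "generator A L g D" "\<And>D'. generator A L g D' \<Longrightarrow> D' = D" using ex by blast
    have "igs_surjective L g" by (rule unique_generator_surjective[OF D(2,1) assms(5)])
    then show ?thesis using unique_generator_kernel[OF D(2,1)] by blast
  qed
  have cartan: "cartan_structure A L br g"
    if "igs_surjective L g \<and> (\<forall>p. structure_kernel g p = {0})"
    using that by unfold_locales auto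
  have backward: "\<exists>!D. generator A L g D"
    if "igs_surjective L g \<and> (\<forall>p. structure_kernel g p = {0})"
  proof -
    interpret cartan_structure A L br g by (rule cartan[OF that])
    show ?thesis using generator_exists generator_unique by blast
  qed
  have "cartan_connection A L br D \<and> (\<forall>W. parallel L D W \<longleftrightarrow> symmetry A L g W)"
    if "\<exists>!D. generator A L g D" "generator A L g D" for D
  proof -
    interpret cartan_structure A L br g by (rule cartan[OF forward[OF that(1)]])
    show ?thesis using generator_cartan[OF that(2)] generator_parallel[OF that(2)] by blast
  qed
  note cartan_parallel = this
  show ?thesis
  proof (rule conjI)
    show "(\<exists>!D. generator A L g D) \<longleftrightarrow>
        igs_surjective L g \<and> (\<forall>p. structure_kernel g p = {0})"
      using forward backward by (rule iffI)
  qed (intro impI allI, rule cartan_parallel)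
qed

end
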